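(* Let $N\ge1$, $\sigma>0$, $\kappa>-\sigma^2/N$, and let $Y\in\mathrm{Herm}(N)$ be the invariant Gaussian random matrix with $\mathbb E[\exp(i\mathrm{Tr}\,YS)]=\exp[-\frac{\sigma^2}{2}\mathrm{Tr}\,S^2-\frac\kappa2(\mathrm{Tr}\,S)^2]$, so that its diagonal vector $y_{\mathrm{diag}}$ has characteristic function $\exp[-\sigma^2\|s\|^2/2-\kappa(s^\top1_N)^2/2]$. Let $X\in\mathrm{Herm}(N)$ be an invariant random matrix with diagonal vector $x_{\mathrm{diag}}$ and unordered eigenvalue vector $x_{\mathrm{eig}}$. The following are equivalent: (1) $X$ belongs to the domain of attraction of $Y$; (2) $x_{\mathrm{diag}}$ belongs to the domain of attraction of $y_{\mathrm{diag}}$; (3) $x_{\mathrm{eig}}$ (viewed as a random vector in $\mathbb R^N$, summing independent copies as vectors) belongs to the domain of attraction of the centred Gaussian on $\mathbb R^N$ with characteristic function $\exp[-(N+1)\sigma^2\|s\|^2/2-(\kappa-\sigma^2)(s^\top1_N)^2/2]$.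
   Context: A random matrix $X\in\mathrm{Herm}(N)$ is invariant if $UXU^\dagger\overset d=X$ for all unitary $U$. A random element $x$ of a real finite-dimensional vector space (here $\mathrm{Herm}(N)$ or $\mathbb R^N$) belongs to the domain of attraction of a random element $y$ if there are sequences $B_m>0$ and deterministic $A_m$ in that space such that for independent copies $x_1,x_2,\dots$ of $x$, $\frac{x_1+\dots+x_m}{B_m}-A_m\to y$ in distribution. $1_N=(1,\dots,1)^\top$, $\|\cdot\|$ the Euclidean norm. *)

theory Defs
  imports "HOL-Probability.Probability"
begin

type_synonym 'n cmat = "complex ^ 'n ^ 'n"

definition hadj :: "'n::finite cmat \<Rightarrow> 'n cmat" where
  "hadj A = (\<chi> i j. cnj (A $ j $ i))"

definition herm :: "'n::finite cmat \<Rightarrow> bool" where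
  "herm A \<longleftrightarrow> hadj A = A"

definition unitary :: "'n::finite cmat \<Rightarrow> bool" where
  "unitary U \<longleftrightarrow> U ** hadj U = mat 1"

definition mtrace :: "'n::finite cmat \<Rightarrow> complex" where
  "mtrace A = (\<Sum>i\<in>UNIV. A $ i $ i)"

definition diag_vec :: "'n::finite cmat \<Rightarrow> real ^ 'n" where
  "diag_vec A = (\<chi> i. Re (A $ i $ i))"

definition diagm :: "real ^ 'n::finite \<Rightarrow> 'n cmat" where
  "diagm v = (\<chi> i j. if i = j then complex_of_real (v $ i) else 0)"

definition is_eig_vec :: "'n::finite cmat \<Rightarrow> real ^ 'n \<Rightarrow> bool" where
  "is_eig_vec X v \<longleftrightarrow> (\<exists>U. unitary U \<and> X = U ** diagm v ** hadj U)"

definition perm_vec :: "('n::finite \<Rightarrow> 'n) \<Rightarrow> real ^ 'n \<Rightarrow> real ^ 'n" where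
  "perm_vec p v = (\<chi> i. v $ p i)"

text \<open>Distribution of the unordered eigenvalue vector: eigenvalues (given by a
  measurable selector eig) put in a uniformly random order, independent of X.\<close>
definition eig_distr :: "'n::finite cmat measure \<Rightarrow> ('n cmat \<Rightarrow> real ^ 'n) \<Rightarrow> (real ^ 'n) measure" where
  "eig_distr M eig = distr (M \<Otimes>\<^sub>M uniform_count_measure {p. p permutes (UNIV::'n set)}) borel
      (\<lambda>(X, p). perm_vec p (eig X))"

definition conv_distr :: "(nat \<Rightarrow> 'a::euclidean_space measure) \<Rightarrow> 'a measure \<Rightarrow> bool" where
  "conv_distr Ms M \<longleftrightarrow> (\<forall>f :: 'a \<Rightarrow> real. continuous_on UNIV f \<and> bounded (range f) \<longrightarrow>
      (\<lambda>m. integral\<^sup>L (Ms m) f) \<longlonglongrightarrow> integral\<^sup>L M f)"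

definition normalized_sum_distr :: "'a::euclidean_space measure \<Rightarrow> nat \<Rightarrow> real \<Rightarrow> 'a \<Rightarrow> 'a measure" where
  "normalized_sum_distr M m B A =
     distr (PiM {..<m} (\<lambda>_. M)) borel (\<lambda>\<omega>. (1 / B) *\<^sub>R (\<Sum>i<m. \<omega> i) - A)"

text \<open>Domain of attraction, with centring constants A_m required to lie in the
  ambient space S (S = Herm(N) or S = UNIV).\<close>
definition dom_attr :: "'a::euclidean_space set \<Rightarrow> 'a measure \<Rightarrow> 'a measure \<Rightarrow> bool" where
  "dom_attr S M L \<longleftrightarrow> (\<exists>B :: nat \<Rightarrow> real. \<exists>A :: nat \<Rightarrow> 'a.
      (\<forall>m. B m > 0) \<and> (\<forall>m. A m \<in> S) \<and>
      conv_distr (\<lambda>m. normalized_sum_distr M m (B m) (A m)) L)"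

definition herm_law :: "'n::finite cmat measure \<Rightarrow> bool" where
  "herm_law M \<longleftrightarrow> prob_space M \<and> sets M = sets borel \<and> (AE X in M. herm X)"

definition invariant_law :: "'n::finite cmat measure \<Rightarrow> bool" where
  "invariant_law M \<longleftrightarrow> (\<forall>U. unitary U \<longrightarrow> distr M borel (\<lambda>X. U ** X ** hadj U) = M)"

end

theory Submission
  imports Defs "HOL-Real_Asymp.Real_Asymp"
begin

text \<open>
  For a fixed norming sequence \<open>B\<^sub>m\<close>, a random vector \<open>\<xi>\<close> is attracted to a centred Gaussian law
  with covariance form \<open>Q\<close> iff \<open>m P(\<bar>\<xi>\<bar> > \<epsilon> B\<^sub>m) \<longrightarrow> 0\<close> for all \<open>\<epsilon>\<close> and the truncated vectors \<open>T\<^sub>m\<close> satisfy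
  \<open>m Var(s \<bullet> T\<^sub>m) \<longrightarrow> Q(s)\<close> for all \<open>s\<close>. Necessity follows by symmetrising, sufficiency by expanding
  characteristic functions and the continuity theorem.

  All three laws can be truncated through the unitarily invariant event \<open>\<bar>X\<bar> \<le> B\<^sub>m\<close>, since the
  eigenvalue vector has the same norm as \<open>X\<close> and the tails of the diagonal control those of \<open>X\<close>.
  By invariance the covariance of the truncated matrix depends on two numbers only: with
  \<open>a = Var T\<^sub>i\<^sub>i\<close> and \<open>b = Cov(T\<^sub>i\<^sub>i, T\<^sub>j\<^sub>j)\<close> the form is \<open>(a - b) Tr S\<^sup>2 + b (Tr S)\<^sup>2\<close> on Hermitian
  matrices, \<open>(a - b) \<bar>s\<bar>\<^sup>2 + b (s \<bullet> 1)\<^sup>2\<close> on the diagonal and, because the unordered eigenvalue vector is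
  exchangeable with the norm and trace of \<open>X\<close>, \<open>(N + 1) (a - b) \<bar>s\<bar>\<^sup>2 + (2 b - a) (s \<bullet> 1)\<^sup>2\<close> on the eigenvalues.
  Hence the three variance conditions coincide.
\<close>

section \<open>Characteristic functions and weak convergence in Euclidean spaces\<close>

text \<open>All three attraction statements are compared for one given norming \<open>B\<close>:
  each holds with that \<open>B\<close> iff \<open>gauss_cond B\<close> does, so the same norming
  serves all three laws. Undoing the symmetrisation requires \<open>B\<close> to tend to infinity,
  which the definition of attraction does not contain. It is forced by a direction in which the
  limit is nondegenerate: the identity matrix, respectively the vector of ones. There the three
  limiting forms share the value N \<sigma>^2 + N^2 \<kappa>, the variance of Tr Y, and the bound on
  \<kappa> says that it is positive. The factor N + 1 arises from the Frobenius norm: it counts N (N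
  - 1) off-diagonal entries of second moment a - b beside the N diagonal ones, while the eigenvalue
  vector spreads the same total over N coordinates, so each has variance a + (N - 1) (a - b). The
  variance of the trace then forces covariance 2 b - a, and the difference is (N + 1) (a - b). The
  matrix type also contains non-Hermitian matrices, so characteristic functions are needed at every
  S; a Hermitian matrix sees only the Hermitian part of S.\<close>

definition vchar :: "'a::euclidean_space measure \<Rightarrow> 'a \<Rightarrow> complex" where
  "vchar M s = (CLINT x|M. iexp (s \<bullet> x))"

text \<open>Finite sums of characters: the algebra on which convergence of characteristic functions
  is convergence of integrals. Complex coefficients make Euler's formula for the sine
  available.\<close>

inductive trig_poly :: "('a::euclidean_space \<Rightarrow> complex) \<Rightarrow> bool" where
  monom: "trig_poly (\<lambda>x. c * iexp (s \<bullet> x))"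
| add: "trig_poly f \<Longrightarrow> trig_poly g \<Longrightarrow> trig_poly (\<lambda>x. f x + g x)"

lemma trig_poly_const: "trig_poly (\<lambda>x. c)"
  using trig_poly.monom[of c 0] by simp

lemma trig_poly_monom_mult: "trig_poly f \<Longrightarrow> trig_poly (\<lambda>x. (c * iexp (s \<bullet> x)) * f x)"
proof (induction rule: trig_poly.induct)
  case (monom d t)
  have "(\<lambda>x. (c * iexp (s \<bullet> x)) * (d * iexp (t \<bullet> x))) = (\<lambda>x. (c * d) * iexp ((s + t) \<bullet> x))"
    by (auto simp: fun_eq_iff inner_add_left exp_add[symmetric] distrib_left)
  then show ?case by (simp only: trig_poly.monom)
next
  case (add f g)
  from trig_poly.add[OF add.IH] show ?case by (simp only: distrib_left)
qed

lemma trig_poly_mult: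
  assumes "trig_poly f" "trig_poly g" shows "trig_poly (\<lambda>x. f x * g x)"
  using assms
proof (induction rule: trig_poly.induct)
  case (monom c s)
  then show ?case by (rule trig_poly_monom_mult)
next
  case (add f h)
  from trig_poly.add[OF add.IH(1)[OF add.prems] add.IH(2)[OF add.prems]]
  show ?case by (simp only: distrib_right)
qed

lemma trig_poly_sum:
  assumes "finite I" "\<And>i. i \<in> I \<Longrightarrow> trig_poly (f i)"
  shows "trig_poly (\<lambda>x. \<Sum>i\<in>I. f i x)"
  using assms by (induction rule: finite_induct) (auto intro: trig_poly_const trig_poly.add)

lemma trig_poly_sin: "trig_poly (\<lambda>x. c * of_real (sin (s \<bullet> x)))"
proof -
  have "(\<lambda>x. c * complex_of_real (sin (s \<bullet> x))) =
      (\<lambda>x. (c / (2 * \<i>)) * iexp (s \<bullet> x) + (- c / (2 * \<i>)) * iexp ((- s) \<bullet> x))"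
    by (auto simp: fun_eq_iff sin_of_real[symmetric] sin_exp_eq field_simps)
  then show ?thesis by (metis (no_types) trig_poly.intros)
qed

text \<open>A linear form turns into a combination of sines, each a sum of two characters, and
  products of characters add frequencies.\<close>

lemma trig_poly_of_polynomial_sin:
  fixes K :: real
  assumes "real_polynomial_function p"
  shows "trig_poly (\<lambda>x::'a::euclidean_space. complex_of_real (p (\<Sum>b\<in>Basis. sin (x \<bullet> b / K) *\<^sub>R b)))"
  using assms
proof (induction rule: real_polynomial_function.induct)
  case (linear f)
  then interpret bounded_linear f .
  have "(\<lambda>x::'a. complex_of_real (f (\<Sum>b\<in>Basis. sin (x \<bullet> b / K) *\<^sub>R b)))
      = (\<lambda>x. \<Sum>b\<in>Basis. of_real (f b) * of_real (sin (((1 / K) *\<^sub>R b) \<bullet> x)))"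
    by (auto simp: fun_eq_iff sum scaleR inner_commute mult.commute)
  then show ?case
    by (simp only:) (intro trig_poly_sum trig_poly_sin finite_Basis)
next
  case (const c)
  show ?case by (rule trig_poly_const)
next
  case (add f g)
  from trig_poly.add[OF add.IH] show ?case by simp
next
  case (mult f g)
  from trig_poly_mult[OF mult.IH] show ?case by simp
qed

lemma integrable_iexp_inner:
  fixes M :: "'a::euclidean_space measure"
  assumes "prob_space M" "sets M = sets borel"
  shows "integrable M (\<lambda>x. iexp (s \<bullet> x))"
proof -
  interpret prob_space M by fact
  note [measurable_cong] = assms(2)
  show ?thesis by (rule integrable_const_bound[where B=1]) auto
qed

lemma trig_poly_integrable:
  fixes M :: "'a::euclidean_space measure"
  assumes "prob_space M" "sets M = sets borel" "trig_poly f"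
  shows "integrable M f"
  using assms(3)
  by induction (auto intro!: integrable_iexp_inner assms)

lemma trig_poly_integral_tendsto:
  fixes M :: "nat \<Rightarrow> 'a::euclidean_space measure"
  assumes M: "\<And>m. prob_space (M m)" "\<And>m. sets (M m) = sets borel"
    and L: "prob_space L" "sets L = sets borel"
    and lim: "\<And>s. (\<lambda>m. vchar (M m) s) \<longlonglongrightarrow> vchar L s"
    and "trig_poly f"
  shows "(\<lambda>m. integral\<^sup>L (M m) f) \<longlonglongrightarrow> integral\<^sup>L L f"
  using assms(6)
proof induction
  case (monom c s)
  then show ?case using lim[of s] by (auto simp: vchar_def intro!: tendsto_mult)
next
  case (add f g)
  then show ?case
    using trig_poly_integrable[OF M] trig_poly_integrable[OF L]
    by (simp add: tendsto_add)
qed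

section \<open>One-dimensional projections, tightness and the continuity theorem\<close>

lemma real_distribution_inner:
  fixes M :: "'a::euclidean_space measure"
  assumes "prob_space M" "sets M = sets borel"
  shows "real_distribution (distr M borel (\<lambda>x. s \<bullet> x))"
    and "char (distr M borel (\<lambda>x. s \<bullet> x)) t = vchar M (t *\<^sub>R s)"
proof -
  interpret prob_space M by fact
  note [measurable_cong] = assms(2)
  show "real_distribution (distr M borel (\<lambda>x. s \<bullet> x))"
    by (rule real_distribution_distr) auto
  show "char (distr M borel (\<lambda>x. s \<bullet> x)) t = vchar M (t *\<^sub>R s)"
    unfolding char_def vchar_def by (subst integral_distr) auto
qed

text \<open>Along a fixed direction the one-dimensional Levy theorem applies. The clipped ramp
  \<open>?h R\<close> is a bounded continuous function, so its small integral under the limit passes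
  to the sequence, and it dominates a tail indicator.\<close>

lemma vchar_tendsto_imp_tight_inner:
  fixes M :: "nat \<Rightarrow> 'a::euclidean_space measure"
  assumes M: "\<And>m. prob_space (M m)" "\<And>m. sets (M m) = sets borel"
    and L: "prob_space L" "sets L = sets borel"
    and lim: "\<And>s. (\<lambda>m. vchar (M m) s) \<longlonglongrightarrow> vchar L s"
    and \<eta>: "\<eta> > 0"
  shows "eventually (\<lambda>K. measure L {x. \<bar>s \<bullet> x\<bar> > K} < \<eta> \<and>
     eventually (\<lambda>m. measure (M m) {x. \<bar>s \<bullet> x\<bar> > K} < \<eta>) sequentially) at_top"
proof -
  interpret L: prob_space L by fact
  interpret M: prob_space "M m" for m by (rule M)
  note [measurable_cong] = M(2) L(2)
  let ?h = "\<lambda>R u. min 1 (max 0 (\<bar>u\<bar> - R)) :: real"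
  have int: "integrable N (\<lambda>x. ?h R (s \<bullet> x))" if "prob_space N" "sets N = sets borel" for N :: "'a measure" and R
  proof -
    interpret prob_space N by fact
    note [measurable_cong] = that(2)
    show ?thesis by (rule integrable_const_bound[where B=1]) auto
  qed
  have wk: "weak_conv_m (\<lambda>m. distr (M m) borel (\<lambda>x. s \<bullet> x)) (distr L borel (\<lambda>x. s \<bullet> x))"
    by (rule levy_continuity) (auto intro!: real_distribution_inner M L lim simp: real_distribution_inner[OF M] real_distribution_inner[OF L])
  have conv: "(\<lambda>m. \<integral>x. ?h R (s \<bullet> x) \<partial>M m) \<longlonglongrightarrow> (\<integral>x. ?h R (s \<bullet> x) \<partial>L)" for R
  proof -
    have "(\<lambda>m. integral\<^sup>L (distr (M m) borel (\<lambda>x. s \<bullet> x)) (?h R)) \<longlonglongrightarrow> integral\<^sup>L (distr L borel (\<lambda>x. s \<bullet> x)) (?h R)"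
      by (rule weak_conv_imp_integral_bdd_continuous_conv[OF _ _ wk, where B=1])
        (auto intro!: real_distribution_inner M L continuous_on_interior[where S=UNIV] continuous_intros)
    then show ?thesis by (subst (asm) (1 2) integral_distr) auto
  qed
  have "((\<lambda>R. \<integral>x. ?h R (s \<bullet> x) \<partial>L) \<longlongrightarrow> (\<integral>x. 0 \<partial>L)) at_top"
  proof (rule integral_dominated_convergence_at_top[where w="\<lambda>_. 1"])
    show "AE x in L. ((\<lambda>R. ?h R (s \<bullet> x)) \<longlongrightarrow> 0) at_top"
    proof (rule AE_I2)
      fix x
      have "eventually (\<lambda>R. 0 = ?h R (s \<bullet> x)) at_top"
        using eventually_ge_at_top[of "\<bar>s \<bullet> x\<bar>"] by eventually_elim auto
      from tendsto_cong[THEN iffD1, OF this tendsto_const] show "((\<lambda>R. ?h R (s \<bullet> x)) \<longlongrightarrow> 0) at_top" .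
    qed
  qed auto
  then have "((\<lambda>R. \<integral>x. ?h R (s \<bullet> x) \<partial>L) \<longlongrightarrow> 0) at_top" by simp
  then have "eventually (\<lambda>R. (\<integral>x. ?h R (s \<bullet> x) \<partial>L) < \<eta>) at_top"
    using \<eta> by (rule order_tendstoD)
  \<comment> \<open>The shift by one is the width of the ramp: \<open>?h (K - 1)\<close> equals 1 as
    soon as the argument exceeds \<open>K\<close>.\<close>
  then have ev: "eventually (\<lambda>K. (\<integral>x. ?h (K - 1) (s \<bullet> x) \<partial>L) < \<eta>) at_top"
    by (auto simp: eventually_at_top_linorder) (metis add.commute le_diff_eq)
  have tail: "measure N {x. \<bar>s \<bullet> x\<bar> > K} \<le> (\<integral>x. ?h (K - 1) (s \<bullet> x) \<partial>N)"
    if N: "prob_space N" "sets N = sets borel" for N :: "'a measure" and K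
  proof -
    interpret prob_space N by fact
    note [measurable_cong] = that(2)
    have [simp]: "space N = UNIV" using sets_eq_imp_space_eq[OF N(2)] by simp
    have "measure N {x. \<bar>s \<bullet> x\<bar> > K} = (\<integral>x. indicator {x. \<bar>s \<bullet> x\<bar> > K} x \<partial>N)" by simp
    also have "\<dots> \<le> (\<integral>x. ?h (K - 1) (s \<bullet> x) \<partial>N)"
      by (intro integral_mono int[OF N] integrable_real_indicator)
        (auto split: split_indicator simp: emeasure_eq_measure)
    finally show ?thesis .
  qed
  from ev show ?thesis
  proof eventually_elim
    case (elim K)
    have "eventually (\<lambda>m. (\<integral>x. ?h (K - 1) (s \<bullet> x) \<partial>M m) < \<eta>) sequentially"
      using conv elim by (rule order_tendstoD)
    then show ?case
      using elim tail[OF L] tail[OF M]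
      by (auto elim!: eventually_mono intro: le_less_trans)
  qed
qed

text \<open>Tightness reduces the claim to a large cube. On the cube of side \<open>2 K\<close> a bounded continuous \<open>f\<close> is uniformly close to a polynomial in the
  functions \<open>sin (x \<bullet> b / K)\<close>, which is a trigonometric polynomial and stays bounded off the cube.\<close>

theorem vchar_tendsto_imp_conv_distr:
  fixes M :: "nat \<Rightarrow> 'a::euclidean_space measure"
  assumes M: "\<And>m. prob_space (M m)" "\<And>m. sets (M m) = sets borel"
    and L: "prob_space L" "sets L = sets borel"
    and lim: "\<And>s. (\<lambda>m. vchar (M m) s) \<longlonglongrightarrow> vchar L s"
  shows "conv_distr M L"
  unfolding conv_distr_def
proof (intro allI impI, elim conjE)
  fix f :: "'a \<Rightarrow> real" assume f: "continuous_on UNIV f" and bdd: "bounded (range f)"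
  interpret L: prob_space L by fact
  interpret M: prob_space "M m" for m by (rule M)
  note [measurable_cong] = M(2) L(2)
  have [measurable]: "f \<in> borel_measurable borel" by (rule borel_measurable_continuous_onI[OF f])
  obtain C where C: "C > 0" "\<And>x. \<bar>f x\<bar> \<le> C" using bdd by (auto simp: bounded_pos)
  show "(\<lambda>m. integral\<^sup>L (M m) f) \<longlonglongrightarrow> integral\<^sup>L L f"
  proof (rule LIMSEQ_I)
    fix r :: real assume "r > 0"
    \<comment> \<open>The total error is at most 5 e: 2 e for replacing \<open>f\<close> by the
      polynomial under each of the two laws, and e for the convergence of the polynomial
      integrals.\<close>
    define e where "e = min 1 (r / 6)"
    have e: "e > 0" "e \<le> 1" "e \<le> r / 6" using \<open>r > 0\<close> by (auto simp: e_def)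
    \<comment> \<open>Chosen so that the tails in all coordinate directions, weighted by 2 C + 1,
      add up to e.\<close>
    define \<eta> where "\<eta> = e / ((2 * C + 1) * DIM('a))"
    have \<eta>: "\<eta> > 0" using e C by (simp add: \<eta>_def)
    have "eventually (\<lambda>K. \<forall>b\<in>Basis. measure L {x. \<bar>b \<bullet> x\<bar> > K} < \<eta> \<and>
        eventually (\<lambda>m. measure (M m) {x. \<bar>b \<bullet> x\<bar> > K} < \<eta>) sequentially) at_top"
      using vchar_tendsto_imp_tight_inner[OF M L lim \<eta>] by (subst eventually_ball_finite_distrib) auto
    from eventually_happens'[OF _ eventually_conj[OF eventually_gt_at_top[of 0] this]]
    obtain K where K: "K > 0"
      and KLM: "\<forall>b\<in>Basis. measure L {x. \<bar>b \<bullet> x\<bar> > K} < \<eta> \<and>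
        eventually (\<lambda>m. measure (M m) {x. \<bar>b \<bullet> x\<bar> > K} < \<eta>) sequentially"
      by auto
    have KL: "\<And>b. b \<in> Basis \<Longrightarrow> measure L {x. \<bar>b \<bullet> x\<bar> > K} < \<eta>"
      and KM: "\<And>b. b \<in> Basis \<Longrightarrow> eventually (\<lambda>m. measure (M m) {x. \<bar>b \<bullet> x\<bar> > K} < \<eta>) sequentially"
      using KLM by blast+
    let ?S = "cbox (- One) One :: 'a set"
    \<comment> \<open>On the cube the arguments x \<bullet> b / K lie in [-1, 1], inside the
      interval where arcsin inverts sin, so \<open>f\<close> is a continuous function
      \<open>?g\<close> of the vector of sines. Stone-Weierstrass is applied to \<open>?g\<close> on
      the unit cube.\<close>
    let ?g = "\<lambda>u::'a. f (\<Sum>b\<in>Basis. (K * arcsin (u \<bullet> b)) *\<^sub>R b)"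
    have "continuous_on ?S ?g"
      by (rule continuous_on_compose2[OF f]) (auto intro!: continuous_intros simp: mem_box)
    then obtain p where p: "real_polynomial_function p" "\<And>u. u \<in> ?S \<Longrightarrow> \<bar>?g u - p u\<bar> < e"
      by (rule Stone_Weierstrass_real_polynomial_function[OF compact_cbox _ e(1)]) blast
    define \<sigma> where "\<sigma> x = (\<Sum>b\<in>Basis. sin (x \<bullet> b / K) *\<^sub>R b)" for x :: 'a
    have \<sigma>S: "\<sigma> x \<in> ?S" for x by (auto simp: \<sigma>_def mem_box)
    have tp: "trig_poly (\<lambda>x. complex_of_real (p (\<sigma> x)))"
      unfolding \<sigma>_def by (rule trig_poly_of_polynomial_sin[OF p(1)])
    have convp: "(\<lambda>m. \<integral>x. p (\<sigma> x) \<partial>M m) \<longlonglongrightarrow> (\<integral>x. p (\<sigma> x) \<partial>L)"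
      using trig_poly_integral_tendsto[OF M L lim tp] by (simp add: tendsto_of_real_iff)
    have close: "\<bar>f x - p (\<sigma> x)\<bar> \<le> e + (2 * C + 1) * (\<Sum>b\<in>Basis. indicator {x. \<bar>b \<bullet> x\<bar> > K} x)" for x
    proof (cases "\<forall>b\<in>Basis. \<bar>b \<bullet> x\<bar> \<le> K")
      case True
      have "arcsin (sin (x \<bullet> b / K)) = x \<bullet> b / K" if "b \<in> Basis" for b
      proof (rule arcsin_sin)
        have "\<bar>x \<bullet> b / K\<bar> \<le> 1" using True that K by (simp add: inner_commute)
        moreover have "pi / 2 > 1" using pi_gt3 by linarith
        ultimately show "- (pi / 2) \<le> x \<bullet> b / K" "x \<bullet> b / K \<le> pi / 2" by linarith+
      qed
      then have "?g (\<sigma> x) = f (\<Sum>b\<in>Basis. (x \<bullet> b) *\<^sub>R b)"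
        using K unfolding \<sigma>_def by (intro arg_cong[where f=f] sum.cong refl) simp
      also have "\<dots> = f x" by (simp only: euclidean_representation)
      finally have "\<bar>f x - p (\<sigma> x)\<bar> \<le> e" using p(2)[OF \<sigma>S[of x]] by simp
      moreover have "(\<Sum>b\<in>Basis. indicator {x. \<bar>b \<bullet> x\<bar> > K} x) \<ge> (0::real)" by (intro sum_nonneg) auto
      ultimately show ?thesis using C by (simp add: add_increasing2)
    next
      case False
      then obtain b where b: "b \<in> Basis" "\<bar>b \<bullet> x\<bar> > K" by auto
      have "(1::real) = indicator {x. \<bar>b \<bullet> x\<bar> > K} x" using b by auto
      also have "\<dots> \<le> (\<Sum>b\<in>Basis. indicator {x. \<bar>b \<bullet> x\<bar> > K} x)"
        by (rule member_le_sum) (use b in auto)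
      finally have "2 * C + 1 \<le> (2 * C + 1) * (\<Sum>b\<in>Basis. indicator {x. \<bar>b \<bullet> x\<bar> > K} x)"
        using C(1) by (simp add: mult_le_cancel_left1)
      moreover have "\<bar>f x - p (\<sigma> x)\<bar> \<le> 2 * C + e"
        using p(2)[OF \<sigma>S[of x]] C(2)[of x] C(2)[of "\<Sum>b\<in>Basis. (K * arcsin (\<sigma> x \<bullet> b)) *\<^sub>R b"] by linarith
      ultimately show ?thesis using e by linarith
    qed
    have close_int: "\<bar>(\<integral>x. f x \<partial>N) - (\<integral>x. p (\<sigma> x) \<partial>N)\<bar> \<le> 2 * e"
      if N: "prob_space N" "sets N = sets borel"
      and t: "\<And>b. b \<in> Basis \<Longrightarrow> measure N {x. \<bar>b \<bullet> x\<bar> > K} < \<eta>" for N :: "'a measure"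
    proof -
      interpret prob_space N by fact
      note [measurable_cong] = N(2)
      have [simp]: "space N = UNIV" using sets_eq_imp_space_eq[OF N(2)] by simp
      have i1: "integrable N f" by (rule integrable_const_bound[where B=C]) (use C in auto)
      have i2: "integrable N (\<lambda>x. p (\<sigma> x))"
        using integrable_Re[OF trig_poly_integrable[OF N tp]] by simp
      have "\<bar>(\<integral>x. f x \<partial>N) - (\<integral>x. p (\<sigma> x) \<partial>N)\<bar> = \<bar>\<integral>x. f x - p (\<sigma> x) \<partial>N\<bar>"
        using i1 i2 by simp
      also have "\<dots> \<le> (\<integral>x. \<bar>f x - p (\<sigma> x)\<bar> \<partial>N)" by (rule integral_abs_bound)
      also have "\<dots> \<le> (\<integral>x. e + (2 * C + 1) * (\<Sum>b\<in>Basis. indicator {x. \<bar>b \<bullet> x\<bar> > K} x) \<partial>N)"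
        by (rule integral_mono) (use close i1 i2 in \<open>auto simp: emeasure_eq_measure intro!: integrable_add\<close>)
      also have "\<dots> = e + (2 * C + 1) * (\<Sum>b\<in>Basis. measure N {x. \<bar>b \<bullet> x\<bar> > K})"
        using prob_space by (simp add: emeasure_eq_measure)
      also have "\<dots> \<le> e + (2 * C + 1) * (\<Sum>b\<in>(Basis::'a set). \<eta>)"
        by (intro add_left_mono mult_left_mono sum_mono) (use t C in \<open>auto simp: less_imp_le\<close>)
      also have "(2 * C + 1) * (\<Sum>b\<in>(Basis::'a set). \<eta>) = e"
      proof -
        have "2 * C + 1 \<noteq> 0" using C by linarith
        then show ?thesis by (simp add: \<eta>_def)
      qed
      finally show ?thesis by simp
    qed
    have "eventually (\<lambda>m. \<forall>b\<in>Basis. measure (M m) {x. \<bar>b \<bullet> x\<bar> > K} < \<eta>) sequentially"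
      using KM by (subst eventually_ball_finite_distrib) auto
    moreover have "eventually (\<lambda>m. dist (\<integral>x. p (\<sigma> x) \<partial>M m) (\<integral>x. p (\<sigma> x) \<partial>L) < e) sequentially"
      using convp e(1) by (rule tendstoD)
    ultimately have "eventually (\<lambda>m. norm (integral\<^sup>L (M m) f - integral\<^sup>L L f) < r) sequentially"
    proof eventually_elim
      case (elim m)
      have "\<bar>(\<integral>x. f x \<partial>M m) - (\<integral>x. p (\<sigma> x) \<partial>M m)\<bar> \<le> 2 * e" by (rule close_int[OF M]) (use elim in auto)
      moreover have "\<bar>(\<integral>x. f x \<partial>L) - (\<integral>x. p (\<sigma> x) \<partial>L)\<bar> \<le> 2 * e" by (rule close_int[OF L KL])
      ultimately show ?case using elim(2) e unfolding dist_real_def real_norm_def by linarith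
    qed
    then show "\<exists>no. \<forall>n\<ge>no. norm (integral\<^sup>L (M n) f - integral\<^sup>L L f) < r"
      by (simp add: eventually_sequentially)
  qed
qed

text \<open>Weak convergence is tested on real functions only, hence the split into cosine and
  sine.\<close>

lemma conv_distr_imp_vchar_tendsto:
  fixes M :: "nat \<Rightarrow> 'a::euclidean_space measure"
  assumes M: "\<And>m. prob_space (M m)" "\<And>m. sets (M m) = sets borel"
    and L: "prob_space L" "sets L = sets borel"
    and conv: "conv_distr M L"
  shows "(\<lambda>m. vchar (M m) s) \<longlonglongrightarrow> vchar L s"
proof -
  have c: "(\<lambda>m. \<integral>x. cos (s \<bullet> x) \<partial>M m) \<longlonglongrightarrow> (\<integral>x. cos (s \<bullet> x) \<partial>L)"
    by (rule conv[unfolded conv_distr_def, rule_format])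
      (auto intro!: continuous_intros boundedI[where B=1])
  have s: "(\<lambda>m. \<integral>x. sin (s \<bullet> x) \<partial>M m) \<longlonglongrightarrow> (\<integral>x. sin (s \<bullet> x) \<partial>L)"
    by (rule conv[unfolded conv_distr_def, rule_format])
      (auto intro!: continuous_intros boundedI[where B=1])
  have eq: "vchar N s = Complex (\<integral>x. cos (s \<bullet> x) \<partial>N) (\<integral>x. sin (s \<bullet> x) \<partial>N)"
    if "prob_space N" "sets N = sets borel" for N :: "'a measure"
    using integral_Re[OF integrable_iexp_inner[OF that, of s]] integral_Im[OF integrable_iexp_inner[OF that, of s]]
    by (auto simp: vchar_def complex_eq_iff Re_exp Im_exp)
  show ?thesis unfolding eq[OF M] eq[OF L] using c s by (rule tendsto_Complex)
qed

section \<open>Null arrays and normal limits\<close>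

lemma prob_space_normalized_sum:
  fixes M :: "'a::euclidean_space measure"
  assumes "prob_space M" "sets M = sets borel"
  shows "prob_space (normalized_sum_distr M m B A)" "sets (normalized_sum_distr M m B A) = sets borel"
proof -
  interpret M: prob_space M by fact
  interpret P: prob_space "PiM {..<m} (\<lambda>_. M)" by (rule prob_space_PiM) (rule assms(1))
  note [measurable_cong] = assms(2)
  show "prob_space (normalized_sum_distr M m B A)"
    unfolding normalized_sum_distr_def by (rule P.prob_space_distr) measurable
qed (simp add: normalized_sum_distr_def)

text \<open>Independence makes the integral factor over the product measure; the centring survives
  only as a factor of modulus one, which disappears on taking absolute values.\<close>

lemma vchar_normalized_sum:
  fixes M :: "'a::euclidean_space measure"
  assumes "prob_space M" "sets M = sets borel"
  shows "vchar (normalized_sum_distr M m B A) s = vchar M ((1 / B) *\<^sub>R s) ^ m * iexp (- (s \<bullet> A))"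
proof -
  interpret M: prob_space M by fact
  interpret P: product_sigma_finite "\<lambda>_::nat. M" ..
  note [measurable_cong] = assms(2)
  have "vchar (normalized_sum_distr M m B A) s =
      (CLINT \<omega>|PiM {..<m} (\<lambda>_. M). iexp (s \<bullet> ((1 / B) *\<^sub>R (\<Sum>i<m. \<omega> i) - A)))"
    unfolding vchar_def normalized_sum_distr_def by (subst integral_distr) auto
  also have "\<dots> = (CLINT \<omega>|PiM {..<m} (\<lambda>_. M). (\<Prod>i<m. iexp (((1 / B) *\<^sub>R s) \<bullet> \<omega> i)) * iexp (- (s \<bullet> A)))"
    by (intro Bochner_Integration.integral_cong refl)
      (simp add: inner_diff_right inner_sum_right exp_sum[symmetric] exp_add[symmetric] sum_distrib_left algebra_simps
        sum_divide_distrib)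
  also have "\<dots> = (\<Prod>i<m. vchar M ((1 / B) *\<^sub>R s)) * iexp (- (s \<bullet> A))"
    unfolding vchar_def
    by (subst integral_mult_left_zero, subst P.product_integral_prod) (auto intro!: integrable_iexp_inner assms simp del: inner_scaleR_left)
  finally show ?thesis by simp
qed

lemma norm_vchar_le_1:
  fixes M :: "'a::euclidean_space measure"
  assumes "prob_space M" "sets M = sets borel"
  shows "cmod (vchar M s) \<le> 1"
proof -
  interpret prob_space M by fact
  have "cmod (vchar M s) \<le> (\<integral>x. cmod (iexp (s \<bullet> x)) \<partial>M)" unfolding vchar_def by (rule integral_norm_bound)
  then show ?thesis by (simp add: prob_space)
qed

text \<open>Taking logarithms gives m (- ln a) \<longlonglongrightarrow> q, and a (- ln a) \<le> 1 -
  a \<le> - ln a squeezes m (1 - a) once a \<longlonglongrightarrow> 1 is known.\<close>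

lemma power_tendsto_exp_imp_one_minus:
  fixes a :: "nat \<Rightarrow> real"
  assumes a: "\<And>m. 0 \<le> a m" "\<And>m. a m \<le> 1" and lim: "(\<lambda>m. a m ^ m) \<longlonglongrightarrow> exp (- q)"
  shows "(\<lambda>m. real m * (1 - a m)) \<longlonglongrightarrow> q"
proof -
  have ev: "eventually (\<lambda>m. a m ^ m > 0 \<and> m > 0) sequentially"
    using order_tendstoD(1)[OF lim] eventually_gt_at_top[of 0] by (auto intro: eventually_conj)
  have pos: "eventually (\<lambda>m. a m > 0 \<and> m > 0) sequentially"
    using ev
  proof eventually_elim
    case (elim m)
    then show ?case using a(1)[of m] by (cases "a m = 0") (auto simp: power_0_left)
  qed
  have "(\<lambda>m. ln (a m ^ m)) \<longlonglongrightarrow> ln (exp (- q))" by (intro tendsto_ln lim) auto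
  then have "(\<lambda>m. - ln (a m ^ m)) \<longlonglongrightarrow> q" using tendsto_minus by fastforce
  then have l: "(\<lambda>m. real m * (- ln (a m))) \<longlonglongrightarrow> q"
    by (rule Lim_transform_eventually) (use pos in eventually_elim, simp add: ln_realpow)
  \<comment> \<open>Here \<open>a m\<close> is written as the exponential of a convergent sequence
    divided by m, which yields a \<longlonglongrightarrow> 1.\<close>
  have "(\<lambda>m. exp (- (real m * (- ln (a m)) * inverse (real m)))) \<longlonglongrightarrow> exp (- (q * 0))"
    by (intro tendsto_intros l lim_inverse_n)
  then have a1: "a \<longlonglongrightarrow> 1"
    by (intro Lim_transform_eventually[of _ 1 _ a]) (use pos in \<open>auto elim!: eventually_mono simp: field_simps\<close>)
  show ?thesis
  proof (rule tendsto_sandwich)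
    show "(\<lambda>m. a m * (real m * (- ln (a m)))) \<longlonglongrightarrow> q" using tendsto_mult[OF a1 l] by simp
    show "eventually (\<lambda>m. a m * (real m * (- ln (a m))) \<le> real m * (1 - a m)) sequentially"
      using pos
    proof eventually_elim
      case (elim m)
      have "ln (inverse (a m)) \<le> inverse (a m) - 1" using elim by (intro ln_le_minus_one) auto
      then have "a m * (- ln (a m)) \<le> a m * (inverse (a m) - 1)"
        using elim by (intro mult_left_mono) (auto simp: ln_inverse)
      also have "\<dots> = 1 - a m" using elim by (simp add: field_simps)
      finally have "real m * (a m * (- ln (a m))) \<le> real m * (1 - a m)" by (rule mult_left_mono) simp
      then show ?case by (simp add: mult.left_commute)
    qed
    show "eventually (\<lambda>m. real m * (1 - a m) \<le> real m * (- ln (a m))) sequentially"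
      using pos
    proof eventually_elim
      case (elim m)
      then show ?case using ln_le_minus_one[of "a m"] by (intro mult_left_mono) auto
    qed
  qed (rule l)
qed

section \<open>Symmetrisation by an independent copy\<close>

text \<open>The squared modulus of a characteristic function is the characteristic function of the
  difference of two independent copies; that difference is symmetric, so only the cosine
  remains.\<close>

lemma norm_square_charfun_eq:
  fixes \<tau> :: "'a \<Rightarrow> real"
  assumes "prob_space M" and [measurable]: "\<tau> \<in> borel_measurable M"
  shows "(cmod (CLINT x|M. iexp (\<tau> x)))\<^sup>2 = (\<integral>z. cos (\<tau> (fst z) - \<tau> (snd z)) \<partial>(M \<Otimes>\<^sub>M M))"
proof -
  interpret prob_space M by fact
  interpret P: pair_prob_space M M ..
  let ?I = "CLINT x|M. iexp (\<tau> x)"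
  have i: "integrable (M \<Otimes>\<^sub>M M) (\<lambda>z. iexp (\<tau> (fst z) - \<tau> (snd z)))"
    by (rule P.integrable_const_bound[where B=1]) auto
  have i': "integrable M (\<lambda>x. iexp (\<tau> x))"
    by (rule integrable_const_bound[where B=1]) auto
  have "(\<integral>z. iexp (\<tau> (fst z) - \<tau> (snd z)) \<partial>(M \<Otimes>\<^sub>M M)) = (CLINT x|M. CLINT y|M. iexp (\<tau> x - \<tau> y))"
    using P.integral_fst'[OF i] by simp
  also have "\<dots> = (CLINT x|M. CLINT y|M. iexp (\<tau> x) * cnj (iexp (\<tau> y)))"
    by (simp add: exp_cnj exp_add[symmetric] algebra_simps)
  also have "\<dots> = ?I * cnj ?I"
    using i' by (simp add: integral_cnj[symmetric] del: integral_cnj)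
  also have "\<dots> = of_real ((cmod ?I)\<^sup>2)" by (rule complex_norm_square[symmetric])
  finally have "(cmod ?I)\<^sup>2 = Re (\<integral>z. iexp (\<tau> (fst z) - \<tau> (snd z)) \<partial>(M \<Otimes>\<^sub>M M))" by simp
  also have "\<dots> = (\<integral>z. Re (iexp (\<tau> (fst z) - \<tau> (snd z))) \<partial>(M \<Otimes>\<^sub>M M))" by (rule integral_Re[OF i, symmetric])
  finally show ?thesis by (simp add: Re_exp)
qed

lemma (in prob_space) integrable_bounded_power:
  fixes f :: "'a \<Rightarrow> real"
  assumes [measurable]: "f \<in> borel_measurable M" and bdd: "\<And>x. \<bar>f x\<bar> \<le> C"
  shows "integrable M (\<lambda>x. f x ^ n)"
  by (rule integrable_const_bound[where B="C ^ n"]) (use bdd in \<open>auto simp: power_abs intro!: power_mono\<close>)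

lemma (in prob_space) variance_symmetrize:
  fixes \<tau> :: "'a \<Rightarrow> real"
  assumes [measurable]: "\<tau> \<in> borel_measurable M" and bdd: "\<And>x. \<bar>\<tau> x\<bar> \<le> C"
  shows "(\<integral>z. (\<tau> (fst z) - \<tau> (snd z))\<^sup>2 \<partial>(M \<Otimes>\<^sub>M M)) = 2 * variance \<tau>"
proof -
  interpret P: pair_prob_space M M ..
  have i1: "integrable M \<tau>" by (rule integrable_const_bound[where B=C]) (use bdd in auto)
  have i2: "integrable M (\<lambda>x. (\<tau> x)\<^sup>2)"
    by (rule integrable_bounded_power[OF assms])
  have i: "integrable (M \<Otimes>\<^sub>M M) (\<lambda>z. (\<tau> (fst z) - \<tau> (snd z))\<^sup>2)"
  proof (rule P.integrable_const_bound[where B="(2 * C)\<^sup>2"])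
    have "\<bar>\<tau> x - \<tau> y\<bar> \<le> \<bar>2 * C\<bar>" for x y using bdd[of x] bdd[of y] by linarith
    then show "AE z in M \<Otimes>\<^sub>M M. norm ((\<tau> (fst z) - \<tau> (snd z))\<^sup>2) \<le> (2 * C)\<^sup>2"
      by (simp add: abs_le_square_iff del: abs_mult)
  qed measurable
  have "(\<integral>z. (\<tau> (fst z) - \<tau> (snd z))\<^sup>2 \<partial>(M \<Otimes>\<^sub>M M)) = (\<integral>x. (\<integral>y. (\<tau> x - \<tau> y)\<^sup>2 \<partial>M) \<partial>M)"
    using P.integral_fst'[OF i] by simp
  also have "\<dots> = (\<integral>x. (\<tau> x)\<^sup>2 + expectation (\<lambda>y. (\<tau> y)\<^sup>2) - 2 * \<tau> x * expectation \<tau> \<partial>M)"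
    using i1 i2 by (simp add: power2_diff prob_space)
  also have "\<dots> = 2 * variance \<tau>"
    using i1 i2 by (simp add: variance_eq[OF i1 i2] prob_space) (simp add: power2_eq_square)
  finally show ?thesis .
qed

section \<open>Null arrays and their stability\<close>

text \<open>The condition that the largest of m independent copies of \<open>D m\<close> tends to
  zero in probability. Rows are identically distributed, so one space and one map per row encode the
  triangular array.\<close>

definition null_array :: "'a measure \<Rightarrow> (nat \<Rightarrow> 'a \<Rightarrow> 'b::real_normed_vector) \<Rightarrow> bool" where
  "null_array M D \<longleftrightarrow> (\<forall>\<epsilon>>0. (\<lambda>m. real m * measure M {x \<in> space M. norm (D m x) > \<epsilon>}) \<longlonglongrightarrow> 0)"

text \<open>Domination is required almost everywhere only, because the random matrices are Hermitian
  almost surely. The two arrays may take values in different spaces, so that entries can be compared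
  with vectors and matrices.\<close>

lemma null_array_mono_AE:
  fixes D :: "nat \<Rightarrow> 'a \<Rightarrow> 'b::euclidean_space" and D' :: "nat \<Rightarrow> 'a \<Rightarrow> 'c::euclidean_space"
  assumes M: "prob_space M" and D: "null_array M D"
    and [measurable]: "\<And>m. D m \<in> borel_measurable M" "\<And>m. D' m \<in> borel_measurable M"
    and le: "\<And>m. AE x in M. norm (D' m x) \<le> c * norm (D m x)" and c: "c > 0"
  shows "null_array M D'"
  unfolding null_array_def
proof (intro allI impI)
  fix \<epsilon> :: real assume \<epsilon>: "\<epsilon> > 0"
  interpret prob_space M by fact
  have lim: "(\<lambda>m. real m * measure M {x \<in> space M. norm (D m x) > \<epsilon> / c}) \<longlonglongrightarrow> 0"
    using D \<epsilon> c by (auto simp: null_array_def)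
  show "(\<lambda>m. real m * measure M {x \<in> space M. norm (D' m x) > \<epsilon>}) \<longlonglongrightarrow> 0"
  proof (rule tendsto_sandwich[OF _ _ tendsto_const lim])
    show "eventually (\<lambda>m. real m * measure M {x \<in> space M. norm (D' m x) > \<epsilon>} \<le>
       real m * measure M {x \<in> space M. norm (D m x) > \<epsilon> / c}) sequentially"
    proof (rule always_eventually, rule allI, intro mult_left_mono finite_measure_mono_AE)
      fix m
      show "AE x in M. x \<in> {x \<in> space M. norm (D' m x) > \<epsilon>} \<longrightarrow> x \<in> {x \<in> space M. norm (D m x) > \<epsilon> / c}"
        using le[of m] by eventually_elim (use c in \<open>auto simp: field_simps\<close>)
    qed auto
  qed auto
qed

lemma null_array_add:
  fixes D D' :: "nat \<Rightarrow> 'a \<Rightarrow> 'b::euclidean_space"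
  assumes M: "prob_space M" and D: "null_array M D" "null_array M D'"
    and [measurable]: "\<And>m. D m \<in> borel_measurable M" "\<And>m. D' m \<in> borel_measurable M"
  shows "null_array M (\<lambda>m x. D m x + D' m x)"
  unfolding null_array_def
proof (intro allI impI)
  fix \<epsilon> :: real assume \<epsilon>: "\<epsilon> > 0"
  interpret prob_space M by fact
  let ?S = "\<lambda>D m. {x \<in> space M. norm (D m x :: 'b) > \<epsilon> / 2}"
  have lim: "(\<lambda>m. real m * measure M (?S D m) + real m * measure M (?S D' m)) \<longlonglongrightarrow> 0 + 0"
    using D[unfolded null_array_def, rule_format, of "\<epsilon> / 2"] \<epsilon> by (intro tendsto_add) simp_all
  show "(\<lambda>m. real m * measure M {x \<in> space M. norm (D m x + D' m x) > \<epsilon>}) \<longlonglongrightarrow> 0"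
  proof (rule tendsto_sandwich[OF _ _ tendsto_const lim[unfolded add_0]])
    show "eventually (\<lambda>m. real m * measure M {x \<in> space M. norm (D m x + D' m x) > \<epsilon>} \<le>
       real m * measure M (?S D m) + real m * measure M (?S D' m)) sequentially"
    proof (rule always_eventually, rule allI)
      fix m
      have "measure M {x \<in> space M. norm (D m x + D' m x) > \<epsilon>} \<le> measure M (?S D m \<union> ?S D' m)"
      proof (rule finite_measure_mono)
        show "{x \<in> space M. norm (D m x + D' m x) > \<epsilon>} \<subseteq> ?S D m \<union> ?S D' m"
        proof safe
          fix x assume "norm (D m x + D' m x) > \<epsilon>" "\<not> norm (D' m x) > \<epsilon> / 2"
          then show "norm (D m x) > \<epsilon> / 2" using norm_triangle_ineq[of "D m x" "D' m x"] by linarith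
        qed
      qed measurable
      also have "\<dots> \<le> measure M (?S D m) + measure M (?S D' m)"
        by (rule measure_Un_le) measurable
      finally show "real m * measure M {x \<in> space M. norm (D m x + D' m x) > \<epsilon>} \<le>
       real m * measure M (?S D m) + real m * measure M (?S D' m)"
        by (simp add: distrib_left[symmetric] mult_left_mono)
    qed
  qed auto
qed

lemma null_array_sum:
  fixes D :: "'i \<Rightarrow> nat \<Rightarrow> 'a \<Rightarrow> 'b::euclidean_space"
  assumes M: "prob_space M" and "finite I" "\<And>i. i \<in> I \<Longrightarrow> null_array M (D i)"
    and "\<And>i m. i \<in> I \<Longrightarrow> D i m \<in> borel_measurable M"
  shows "null_array M (\<lambda>m x. \<Sum>i\<in>I. D i m x)"
  using assms(2-)
proof (induction rule: finite_induct)
  case empty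
  then show ?case by (simp add: null_array_def)
next
  case (insert i I)
  then show ?case by (auto intro!: null_array_add[OF M])
qed

lemma null_array_distr:
  fixes D :: "nat \<Rightarrow> 'c \<Rightarrow> 'b::euclidean_space"
  assumes [measurable]: "f \<in> measurable M N" "\<And>m. D m \<in> borel_measurable N"
  shows "null_array (distr M N f) D \<longleftrightarrow> null_array M (\<lambda>m x. D m (f x))"
proof -
  have "measure (distr M N f) {x \<in> space N. norm (D m x) > \<epsilon>} = measure M {x \<in> space M. norm (D m (f x)) > \<epsilon>}" for m \<epsilon>
    by (subst measure_distr) (auto intro!: arg_cong[where f="measure M"] dest: measurable_space[OF assms(1)])
  then show ?thesis by (simp add: null_array_def)
qed

section \<open>Third moments and Taylor expansion of characteristic functions\<close>

text \<open>Below the level \<epsilon> one factor of the cube is at most \<epsilon>; above it the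
  cube is at most C^3.\<close>

lemma null_array_third_moment:
  fixes D :: "nat \<Rightarrow> 'a \<Rightarrow> real"
  assumes "prob_space M" and D: "null_array M D" "\<And>m. D m \<in> borel_measurable M" "\<And>m x. \<bar>D m x\<bar> \<le> C"
    and \<epsilon>: "\<epsilon> > 0"
  shows "real m * (\<integral>x. \<bar>D m x\<bar> ^ 3 \<partial>M) \<le> \<epsilon> * (real m * (\<integral>x. (D m x)\<^sup>2 \<partial>M))
    + C ^ 3 * (real m * measure M {x \<in> space M. \<bar>D m x\<bar> > \<epsilon>})"
proof -
  interpret prob_space M by fact
  note [measurable] = D(2)
  have C: "0 \<le> C" using D(3)[of undefined undefined] by linarith
  have i2: "integrable M (\<lambda>x. (D m x)\<^sup>2)"
    by (rule integrable_bounded_power[OF D(2,3)])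
  have i3: "integrable M (\<lambda>x. \<bar>D m x\<bar> ^ 3)"
    by (rule integrable_bounded_power[where C=C]) (use D in auto)
  have "(\<integral>x. \<bar>D m x\<bar> ^ 3 \<partial>M) \<le> (\<integral>x. \<epsilon> * (D m x)\<^sup>2 + C ^ 3 * indicator {x \<in> space M. \<bar>D m x\<bar> > \<epsilon>} x \<partial>M)"
  proof (rule integral_mono)
    fix x assume x: "x \<in> space M"
    show "\<bar>D m x\<bar> ^ 3 \<le> \<epsilon> * (D m x)\<^sup>2 + C ^ 3 * indicator {x \<in> space M. \<bar>D m x\<bar> > \<epsilon>} x"
    proof (cases "\<bar>D m x\<bar> > \<epsilon>")
      case True
      have "\<bar>D m x\<bar> ^ 3 \<le> C ^ 3" using D by (intro power_mono) auto
      then show ?thesis using True x \<epsilon> by (simp add: add_increasing)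
    next
      case False
      have "\<bar>D m x\<bar> ^ 3 = \<bar>D m x\<bar> * (D m x)\<^sup>2" by (simp add: power3_eq_cube power2_eq_square)
      also have "\<dots> \<le> \<epsilon> * (D m x)\<^sup>2" using False by (intro mult_right_mono) auto
      finally show ?thesis using False by simp
    qed
  qed (use i2 i3 in \<open>auto simp: emeasure_eq_measure\<close>)
  also have "\<dots> = \<epsilon> * (\<integral>x. (D m x)\<^sup>2 \<partial>M) + C ^ 3 * measure M {x \<in> space M. \<bar>D m x\<bar> > \<epsilon>}"
    using i2 by (simp add: emeasure_eq_measure)
  finally have "real m * (\<integral>x. \<bar>D m x\<bar> ^ 3 \<partial>M) \<le>
      real m * (\<epsilon> * (\<integral>x. (D m x)\<^sup>2 \<partial>M) + C ^ 3 * measure M {x \<in> space M. \<bar>D m x\<bar> > \<epsilon>})"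
    by (rule mult_left_mono) auto
  then show ?thesis by (simp add: algebra_simps)
qed

lemma null_array_third_moment_tendsto:
  fixes D :: "nat \<Rightarrow> 'a \<Rightarrow> real"
  assumes M: "prob_space M" and D: "null_array M D" "\<And>m. D m \<in> borel_measurable M" "\<And>m x. \<bar>D m x\<bar> \<le> C"
    and V: "eventually (\<lambda>m. real m * (\<integral>x. (D m x)\<^sup>2 \<partial>M) \<le> V) sequentially"
  shows "(\<lambda>m. real m * (\<integral>x. \<bar>D m x\<bar> ^ 3 \<partial>M)) \<longlonglongrightarrow> 0"
proof (rule tendstoI)
  fix e :: real assume e: "e > 0"
  \<comment> \<open>The maximum with 1 keeps the denominator of \<epsilon> positive; \<epsilon> then
    makes the second-moment term at most e / 2.\<close>
  define V' where "V' = max V 1"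
  define \<epsilon> where "\<epsilon> = e / (2 * V')"
  have V': "V' \<ge> 1" "V \<le> V'" by (auto simp: V'_def)
  have \<epsilon>: "\<epsilon> > 0" using e V' by (simp add: \<epsilon>_def)
  have "(\<lambda>m. C ^ 3 * (real m * measure M {x \<in> space M. \<bar>D m x\<bar> > \<epsilon>})) \<longlonglongrightarrow> C ^ 3 * 0"
    using D(1) \<epsilon> by (intro tendsto_mult tendsto_const) (auto simp: null_array_def)
  then have "eventually (\<lambda>m. C ^ 3 * (real m * measure M {x \<in> space M. \<bar>D m x\<bar> > \<epsilon>}) < e / 2) sequentially"
    by (rule order_tendstoD(2)) (use e in simp)
  with V show "eventually (\<lambda>m. dist (real m * (\<integral>x. \<bar>D m x\<bar> ^ 3 \<partial>M)) 0 < e) sequentially"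
  proof eventually_elim
    case (elim m)
    have "\<epsilon> * (real m * (\<integral>x. (D m x)\<^sup>2 \<partial>M)) \<le> \<epsilon> * V'" using elim V' \<epsilon> by (intro mult_left_mono) auto
    also have "\<dots> = e / 2" using V' by (simp add: \<epsilon>_def)
    finally have "real m * (\<integral>x. \<bar>D m x\<bar> ^ 3 \<partial>M) < e"
      using null_array_third_moment[OF M D \<epsilon>, of m] elim by linarith
    then show ?case by (simp add: abs_mult)
  qed
qed

lemma iexp_approx_third: "cmod (iexp x - (1 + \<i> * x - (x\<^sup>2) / 2)) \<le> \<bar>x\<bar> ^ 3 / 6"
proof -
  have "(\<Sum>k \<le> 2. (\<i> * complex_of_real x)^k / fact k) = 1 + \<i> * x - (x\<^sup>2) / 2"
    by (simp add: numeral_2_eq_2 power_mult_distrib)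
  then show ?thesis using iexp_approx1[of x 2] by (simp add: eval_nat_numeral)
qed

lemma cos_approx_third: "\<bar>(1 - cos x) - x\<^sup>2 / 2\<bar> \<le> \<bar>x\<bar> ^ 3 / 6" for x :: real
proof -
  have "\<bar>Re (iexp x - (1 + \<i> * x - (x\<^sup>2) / 2))\<bar> \<le> \<bar>x\<bar> ^ 3 / 6"
    using abs_Re_le_cmod iexp_approx_third by (rule order_trans)
  then show ?thesis by (simp add: Re_exp abs_if split: if_splits)
qed

text \<open>The Taylor error is a sixth of the third absolute moment. That this is negligible
  presupposes a bound on m E D^2, which is bootstrapped from the same Taylor estimate.\<close>

lemma cos_tendsto_imp_second_moment_tendsto:
  fixes D :: "nat \<Rightarrow> 'a \<Rightarrow> real"
  assumes M: "prob_space M" and D: "null_array M D" "\<And>m. D m \<in> borel_measurable M" "\<And>m x. \<bar>D m x\<bar> \<le> C"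
    and lim: "(\<lambda>m. real m * (\<integral>x. 1 - cos (D m x) \<partial>M)) \<longlonglongrightarrow> v"
  shows "(\<lambda>m. real m * (\<integral>x. (D m x)\<^sup>2 \<partial>M)) \<longlonglongrightarrow> 2 * v"
proof -
  interpret prob_space M by fact
  note [measurable] = D(2)
  have C: "0 \<le> C" using D(3)[of undefined undefined] by linarith
  have i2: "integrable M (\<lambda>x. (D m x)\<^sup>2)" for m
    by (rule integrable_bounded_power[OF D(2,3)])
  have i3: "integrable M (\<lambda>x. \<bar>D m x\<bar> ^ 3)" for m
    by (rule integrable_bounded_power[where C=C]) (use D in auto)
  have ic: "integrable M (\<lambda>x. 1 - cos (D m x))" for m
  proof -
    have "integrable M (\<lambda>x. cos (D m x))" by (rule integrable_const_bound[where B=1]) auto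
    then show ?thesis by simp
  qed
  have key: "\<bar>real m * (\<integral>x. 1 - cos (D m x) \<partial>M) - real m * (\<integral>x. (D m x)\<^sup>2 \<partial>M) / 2\<bar> \<le> real m * (\<integral>x. \<bar>D m x\<bar> ^ 3 \<partial>M) / 6" for m
  proof -
    have "\<bar>(\<integral>x. 1 - cos (D m x) \<partial>M) - (\<integral>x. (D m x)\<^sup>2 / 2 \<partial>M)\<bar> = \<bar>\<integral>x. (1 - cos (D m x)) - (D m x)\<^sup>2 / 2 \<partial>M\<bar>"
      using i2 ic by (subst Bochner_Integration.integral_diff) auto
    also have "\<dots> \<le> (\<integral>x. \<bar>(1 - cos (D m x)) - (D m x)\<^sup>2 / 2\<bar> \<partial>M)" by (rule integral_abs_bound)
    also have "\<dots> \<le> (\<integral>x. \<bar>D m x\<bar> ^ 3 / 6 \<partial>M)"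
      by (rule integral_mono) (use i2 i3 ic cos_approx_third in \<open>auto intro!: integrable_abs Bochner_Integration.integrable_diff\<close>)
    finally have "real m * \<bar>(\<integral>x. 1 - cos (D m x) \<partial>M) - (\<integral>x. (D m x)\<^sup>2 / 2 \<partial>M)\<bar> \<le> real m * (\<integral>x. \<bar>D m x\<bar> ^ 3 / 6 \<partial>M)"
      by (rule mult_left_mono) auto
    then show ?thesis
      by (simp add: abs_mult right_diff_distrib[symmetric] times_divide_eq_right[symmetric] del: times_divide_eq_right)
  qed
  have "eventually (\<lambda>m. real m * measure M {x \<in> space M. norm (D m x) > 1} * C ^ 3 < 1) sequentially"
    by (rule order_tendstoD(2)[where y=0])
      (use D(1) in \<open>auto simp: null_array_def intro!: tendsto_mult_left_zero\<close>)
  moreover have "eventually (\<lambda>m. real m * (\<integral>x. 1 - cos (D m x) \<partial>M) < v + 1) sequentially"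
    by (rule order_tendstoD(2)[OF lim]) simp
  \<comment> \<open>Write S for m E D^2. The splitting at level 1 bounds m E \<bar>D\<bar>^3 by S +
    1, so S / 2 \<le> v + 1 + (S + 1) / 6. The coefficient 1/6 is absorbed by 1/2, which leaves S /
    3 on the left.\<close>
  ultimately have "eventually (\<lambda>m. real m * (\<integral>x. (D m x)\<^sup>2 \<partial>M) \<le> 3 * (v + 2)) sequentially"
  proof eventually_elim
    case (elim m)
    have "real m * (\<integral>x. \<bar>D m x\<bar> ^ 3 \<partial>M) \<le> real m * (\<integral>x. (D m x)\<^sup>2 \<partial>M) + 1"
      using null_array_third_moment[OF M D, of 1 m] elim(1) by (simp add: mult_ac)
    then show ?case using abs_le_D2[OF key[of m]] elim(2) by argo
  qed
  from null_array_third_moment_tendsto[OF M D this]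
  have t: "(\<lambda>m. real m * (\<integral>x. \<bar>D m x\<bar> ^ 3 \<partial>M) / 6) \<longlonglongrightarrow> 0" using tendsto_divide_zero by blast
  have "(\<lambda>m. real m * (\<integral>x. 1 - cos (D m x) \<partial>M) - real m * (\<integral>x. (D m x)\<^sup>2 \<partial>M) / 2) \<longlonglongrightarrow> 0"
    by (rule Lim_null_comparison[OF _ t]) (use key in auto)
  from tendsto_mult[OF tendsto_const[of 2] tendsto_diff[OF lim this]]
  show ?thesis by simp
qed

text \<open>Centring at the mean kills the linear Taylor term, so the characteristic function of the
  centred variable is 1 - Var / 2 up to a third moment. The centred array is still null because the
  means tend to zero. Powers of numbers in the unit disc differ by at most m times the difference of
  the bases.\<close>

lemma variance_tendsto_imp_charfun_power_tendsto:
  fixes \<tau> :: "nat \<Rightarrow> 'a \<Rightarrow> real"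
  assumes M: "prob_space M" and \<tau>: "null_array M \<tau>" "\<And>m. \<tau> m \<in> borel_measurable M" "\<And>m x. \<bar>\<tau> m x\<bar> \<le> C"
    and lim: "(\<lambda>m. real m * prob_space.variance M (\<tau> m)) \<longlonglongrightarrow> v"
  shows "(\<lambda>m. (CLINT x|M. iexp (\<tau> m x)) ^ m * iexp (- (real m * (\<integral>x. \<tau> m x \<partial>M)))) \<longlonglongrightarrow> exp (- (v / 2))"
proof -
  interpret prob_space M by fact
  note [measurable] = \<tau>(2)
  have C: "0 \<le> C" using \<tau>(3)[of undefined undefined] by linarith
  define \<mu> where "\<mu> m = expectation (\<tau> m)" for m
  define D where "D m x = \<tau> m x - \<mu> m" for m x
  have [measurable]: "D m \<in> borel_measurable M" for m by (simp add: D_def[abs_def])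
  have i1: "integrable M (\<tau> m)" for m by (rule integrable_const_bound[where B=C]) (use \<tau> in auto)
  have v: "variance (\<tau> m) = (\<integral>x. (D m x)\<^sup>2 \<partial>M)" for m by (simp add: D_def \<mu>_def)
  have \<mu>le: "\<bar>\<mu> m\<bar> \<le> \<epsilon> + C * prob {x \<in> space M. \<bar>\<tau> m x\<bar> > \<epsilon>}" if "\<epsilon> > 0" for m \<epsilon>
  proof -
    have "\<bar>\<mu> m\<bar> \<le> (\<integral>x. \<bar>\<tau> m x\<bar> \<partial>M)" unfolding \<mu>_def by (rule integral_abs_bound)
    also have "\<dots> \<le> (\<integral>x. \<epsilon> + C * indicator {x \<in> space M. \<bar>\<tau> m x\<bar> > \<epsilon>} x \<partial>M)"
      by (rule integral_mono)
        (use i1 \<tau>(3)[of m] C that in \<open>auto simp: emeasure_eq_measure add_increasing split: split_indicator\<close>)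
    also have "\<dots> = \<epsilon> + C * prob {x \<in> space M. \<bar>\<tau> m x\<bar> > \<epsilon>}" by (simp add: emeasure_eq_measure prob_space)
    finally show ?thesis .
  qed
  have \<mu>C: "\<bar>\<mu> m\<bar> \<le> C" for m
  proof -
    have "\<bar>\<mu> m\<bar> \<le> (\<integral>x. \<bar>\<tau> m x\<bar> \<partial>M)" unfolding \<mu>_def by (rule integral_abs_bound)
    also have "\<dots> \<le> (\<integral>x. C \<partial>M)" by (rule integral_mono) (use i1 \<tau>(3)[of m] in auto)
    finally show ?thesis by (simp add: prob_space)
  qed
  \<comment> \<open>For m > 0 a probability is at most m times itself, so the null condition
    controls the tail term of \<open>\<mu>le\<close>.\<close>
  have \<mu>0: "\<mu> \<longlonglongrightarrow> 0"
  proof (rule tendstoI)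
    fix e :: real assume e: "e > 0"
    have "(\<lambda>m. C * (real m * prob {x \<in> space M. \<bar>\<tau> m x\<bar> > e / 2})) \<longlonglongrightarrow> 0"
      using \<tau>(1)[unfolded null_array_def, rule_format, of "e / 2"] e by (intro tendsto_mult_right_zero) simp
    then have "eventually (\<lambda>m. C * (real m * prob {x \<in> space M. \<bar>\<tau> m x\<bar> > e / 2}) < e / 2) sequentially"
      by (rule order_tendstoD) (use e in simp)
    then show "eventually (\<lambda>m. dist (\<mu> m) 0 < e) sequentially" using eventually_gt_at_top[of 0]
    proof eventually_elim
      case (elim m)
      have "1 * prob {x \<in> space M. \<bar>\<tau> m x\<bar> > e / 2} \<le> real m * prob {x \<in> space M. \<bar>\<tau> m x\<bar> > e / 2}"
        using elim by (intro mult_right_mono) auto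
      from mult_left_mono[OF this C] show ?case using elim \<mu>le[of "e / 2" m] e by simp
    qed
  qed
  have nD: "null_array M D"
    unfolding null_array_def
  proof (intro allI impI)
    fix \<epsilon> :: real assume \<epsilon>: "\<epsilon> > 0"
    have lim: "(\<lambda>m. real m * prob {x \<in> space M. \<bar>\<tau> m x\<bar> > \<epsilon> / 2}) \<longlonglongrightarrow> 0"
      using \<tau>(1)[unfolded null_array_def, rule_format, of "\<epsilon> / 2"] \<epsilon> by simp
    have "eventually (\<lambda>m. dist (\<mu> m) 0 < \<epsilon> / 2) sequentially" using tendstoD[OF \<mu>0, of "\<epsilon> / 2"] \<epsilon> by simp
    then have le: "eventually (\<lambda>m. real m * prob {x \<in> space M. norm (D m x) > \<epsilon>} \<le>
        real m * prob {x \<in> space M. \<bar>\<tau> m x\<bar> > \<epsilon> / 2}) sequentially"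
      by eventually_elim (auto intro!: mult_left_mono finite_measure_mono simp: D_def)
    show "(\<lambda>m. real m * prob {x \<in> space M. norm (D m x) > \<epsilon>}) \<longlonglongrightarrow> 0"
      by (rule tendsto_sandwich[OF _ le tendsto_const lim]) auto
  qed
  have DC: "\<bar>D m x\<bar> \<le> 2 * C" for m x using \<tau>(3)[of m x] \<mu>C[of m] unfolding D_def by linarith
  have i2: "integrable M (\<lambda>x. (D m x)\<^sup>2)" for m
    by (rule integrable_bounded_power[OF _ DC]) simp
  have i3: "integrable M (\<lambda>x. \<bar>D m x\<bar> ^ 3)" for m
    by (rule integrable_bounded_power[where C="2 * C"]) (use DC in auto)
  have iD: "integrable M (D m)" for m unfolding D_def using i1 by auto
  have ie: "integrable M (\<lambda>x. iexp (D m x))" for m by (rule integrable_const_bound[where B=1]) auto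
  have ED: "expectation (D m) = 0" for m using i1 by (simp add: D_def[abs_def] \<mu>_def prob_space)
  define a where "a m = (CLINT x|M. iexp (D m x))" for m
  have norm_a: "cmod (a m) \<le> 1" for m
  proof -
    have "cmod (a m) \<le> (\<integral>x. cmod (iexp (D m x)) \<partial>M)" unfolding a_def by (rule integral_norm_bound)
    then show ?thesis by (simp add: prob_space)
  qed
  have app: "cmod (a m - of_real (1 - variance (\<tau> m) / 2)) \<le> (\<integral>x. \<bar>D m x\<bar> ^ 3 \<partial>M) / 6" for m
  proof -
    have it: "integrable M (\<lambda>x. 1 + \<i> * D m x - (D m x)\<^sup>2 / 2)"
      using iD i2 by (auto simp flip: of_real_power)
    have "(CLINT x|M. 1 + \<i> * D m x - (D m x)\<^sup>2 / 2) = of_real (1 - variance (\<tau> m) / 2)"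
      using iD[of m] i2[of m] ED[of m] by (simp add: v prob_space flip: of_real_power)
    then have "a m - of_real (1 - variance (\<tau> m) / 2) = (CLINT x|M. iexp (D m x) - (1 + \<i> * D m x - (D m x)\<^sup>2 / 2))"
      unfolding a_def using ie it by (subst Bochner_Integration.integral_diff) auto
    also have "cmod \<dots> \<le> (\<integral>x. cmod (iexp (D m x) - (1 + \<i> * D m x - (D m x)\<^sup>2 / 2)) \<partial>M)"
      by (rule integral_norm_bound)
    also have "\<dots> \<le> (\<integral>x. \<bar>D m x\<bar> ^ 3 / 6 \<partial>M)"
    proof (rule integral_mono)
      show "integrable M (\<lambda>x. cmod (iexp (D m x) - (1 + \<i> * D m x - (D m x)\<^sup>2 / 2)))"
        by (rule integrable_norm[OF Bochner_Integration.integrable_diff[OF ie it]])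
    qed (use i3 iexp_approx_third in auto)
    finally show ?thesis by simp
  qed
  have "eventually (\<lambda>m. real m * (\<integral>x. (D m x)\<^sup>2 \<partial>M) \<le> v + 1) sequentially"
    using order_tendstoD(2)[OF lim, of "v + 1"] by (auto simp: v elim!: eventually_mono)
  from null_array_third_moment_tendsto[OF M nD _ DC this]
  have t: "(\<lambda>m. real m * (\<integral>x. \<bar>D m x\<bar> ^ 3 \<partial>M)) \<longlonglongrightarrow> 0" by simp
  have v0: "v \<ge> 0"
    by (rule tendsto_lowerbound[OF lim]) (auto intro!: always_eventually mult_nonneg_nonneg)
  \<comment> \<open>The base whose m-th power is exactly the limit for m > 0; it stays in the unit
    disc because v \<ge> 0.\<close>
  define b where "b m = exp (- (v / (2 * real m)))" for m
  have bexp: "(\<lambda>m. real m * \<bar>1 - v / (2 * real m) - b m\<bar>) \<longlonglongrightarrow> 0"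
  proof -
    have "(\<lambda>m. real m * (1 - v / (2 * real m) - b m)) \<longlonglongrightarrow> 0" unfolding b_def by real_asymp
    from tendsto_rabs_zero[OF this] show ?thesis by (simp add: abs_mult)
  qed
  have bd: "cmod (a m ^ m - of_real (b m) ^ m) \<le>
      real m * (\<integral>x. \<bar>D m x\<bar> ^ 3 \<partial>M) / 6 + (\<bar>real m * variance (\<tau> m) - v\<bar> / 2 + real m * \<bar>1 - v / (2 * real m) - b m\<bar>)"
    if "m > 0" for m
  proof -
    have "cmod (a m ^ m - of_real (b m) ^ m) \<le> real m * cmod (a m - of_real (b m))"
      by (rule norm_power_diff) (use norm_a v0 in \<open>auto simp: b_def\<close>)
    also have "cmod (a m - of_real (b m)) \<le> cmod (a m - of_real (1 - variance (\<tau> m) / 2)) + cmod (of_real (1 - variance (\<tau> m) / 2) - of_real (b m))"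
      using norm_triangle_ineq[of "a m - of_real (1 - variance (\<tau> m) / 2)" "of_real (1 - variance (\<tau> m) / 2) - of_real (b m)"]
      by (simp del: of_real_diff)
    also have "cmod (of_real (1 - variance (\<tau> m) / 2) - of_real (b m)) = \<bar>1 - variance (\<tau> m) / 2 - b m\<bar>"
      by (simp only: of_real_diff[symmetric] norm_of_real)
    also have "\<dots> \<le> \<bar>v / (2 * real m) - variance (\<tau> m) / 2\<bar> + \<bar>1 - v / (2 * real m) - b m\<bar>" by linarith
    also have "\<bar>v / (2 * real m) - variance (\<tau> m) / 2\<bar> = \<bar>real m * variance (\<tau> m) - v\<bar> / (2 * real m)"
    proof -
      have "v / (2 * real m) - variance (\<tau> m) / 2 = (v - real m * variance (\<tau> m)) / (2 * real m)"
        using that by (simp add: field_simps)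
      then show ?thesis using that by (simp add: abs_minus_commute abs_divide)
    qed
    finally have "cmod (a m ^ m - of_real (b m) ^ m) \<le> real m * (cmod (a m - of_real (1 - variance (\<tau> m) / 2))
        + (\<bar>real m * variance (\<tau> m) - v\<bar> / (2 * real m) + \<bar>1 - v / (2 * real m) - b m\<bar>))"
      by (simp add: mult_left_mono)
    also have "\<dots> \<le> real m * ((\<integral>x. \<bar>D m x\<bar> ^ 3 \<partial>M) / 6
        + (\<bar>real m * variance (\<tau> m) - v\<bar> / (2 * real m) + \<bar>1 - v / (2 * real m) - b m\<bar>))"
      by (intro mult_left_mono add_right_mono app) auto
    also have "\<dots> = real m * (\<integral>x. \<bar>D m x\<bar> ^ 3 \<partial>M) / 6 + (\<bar>real m * variance (\<tau> m) - v\<bar> / 2 + real m * \<bar>1 - v / (2 * real m) - b m\<bar>)"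
      using that by (simp add: field_simps)
    finally show ?thesis .
  qed
  have "(\<lambda>m. real m * (\<integral>x. \<bar>D m x\<bar> ^ 3 \<partial>M) / 6 + (\<bar>real m * variance (\<tau> m) - v\<bar> / 2 + real m * \<bar>1 - v / (2 * real m) - b m\<bar>))
      \<longlonglongrightarrow> 0 / 6 + (\<bar>v - v\<bar> / 2 + 0)"
    by (intro tendsto_intros t lim bexp) auto
  then have lim0: "(\<lambda>m. real m * (\<integral>x. \<bar>D m x\<bar> ^ 3 \<partial>M) / 6 + (\<bar>real m * variance (\<tau> m) - v\<bar> / 2 + real m * \<bar>1 - v / (2 * real m) - b m\<bar>))
      \<longlonglongrightarrow> 0" by simp
  have "(\<lambda>m. a m ^ m - of_real (b m) ^ m) \<longlonglongrightarrow> 0"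
    by (rule Lim_null_comparison[OF _ lim0]) (rule eventually_mono[OF eventually_gt_at_top[of 0] bd])
  moreover have "eventually (\<lambda>m. complex_of_real (b m) ^ m = exp (- (v / 2))) sequentially"
    using eventually_gt_at_top[of 0]
    by eventually_elim (simp add: b_def of_real_power[symmetric] exp_of_nat_mult[symmetric] del: of_real_power of_real_exp)
  ultimately have "(\<lambda>m. a m ^ m - exp (- (v / 2))) \<longlonglongrightarrow> 0"
    by (rule Lim_transform_eventually[OF _ eventually_mono]) simp
  then have "(\<lambda>m. a m ^ m) \<longlonglongrightarrow> exp (- (v / 2))" by (simp add: LIM_zero_iff)
  moreover have "a m ^ m = (CLINT x|M. iexp (\<tau> m x)) ^ m * iexp (- (real m * expectation (\<tau> m)))" for m
  proof -
    have "a m = (CLINT x|M. iexp (\<tau> m x) * iexp (- \<mu> m))"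
      unfolding a_def D_def by (simp add: exp_add[symmetric] algebra_simps)
    then have "a m = (CLINT x|M. iexp (\<tau> m x)) * iexp (- \<mu> m)" by simp
    then show ?thesis by (simp add: power_mult_distrib exp_of_nat_mult[symmetric] \<mu>_def algebra_simps)
  qed
  ultimately show ?thesis by simp
qed

section \<open>Quadratic limits of symmetrised characteristic functions\<close>

text \<open>For large \<bar>u\<bar> both sine terms are of order 1 / \<bar>u\<bar>, so the average
  over t stays near 3 \<delta> / 2. For a single t the integrand vanishes whenever t u is a multiple
  of 2 pi.\<close>

lemma integral_one_minus_cos_square:
  fixes u \<delta> :: real
  assumes "\<delta> > 0" "u \<noteq> 0"
  shows "(\<integral>t. (1 - cos (t * u))\<^sup>2 * indicator {0..\<delta>} t \<partial>lborel) = 3 * \<delta> / 2 - 2 * sin (\<delta> * u) / u + sin (2 * \<delta> * u) / (4 * u)"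
proof -
  let ?F = "\<lambda>t. 3 * t / 2 - 2 * sin (t * u) / u + sin (2 * t * u) / (4 * u)"
  have "(\<integral>t. (1 - cos (t * u))\<^sup>2 * indicator {0..\<delta>} t \<partial>lborel) = ?F \<delta> - ?F 0"
  proof (rule integral_FTC_Icc_real)
    fix t
    have "cos (2 * t * u) = 2 * (cos (t * u))\<^sup>2 - 1" using cos_double_cos[of "t * u"] by (simp add: mult.assoc)
    then have eq: "(1 - cos (t * u))\<^sup>2 = 3 / 2 - 2 * cos (t * u) + cos (2 * t * u) / 2" by (simp add: power2_diff diff_divide_distrib)
    show "(?F has_real_derivative (1 - cos (t * u))\<^sup>2) (at t)"
      unfolding eq using assms by (auto intro!: derivative_eq_intros simp: field_simps)
    show "isCont (\<lambda>t. (1 - cos (t * u))\<^sup>2) t" by (intro continuous_intros)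
  qed (use assms in auto)
  then show ?thesis by simp
qed

text \<open>The identity \<open>2 (1 - cos \<theta>)\<^sup>2 = 4 (1 - cos \<theta>) - (1 - cos 2\<theta>)\<close> turns a quadratic limit
  of \<open>t \<mapsto> m E (1 - cos (t D\<^sub>m))\<close> into \<open>m E (1 - cos (t D\<^sub>m))\<^sup>2 \<longrightarrow> 0\<close>; averaging over
  \<open>t\<close> in an interval yields a test function bounded away from zero off the origin.\<close>

lemma quadratic_limit_imp_null_array:
  fixes D :: "nat \<Rightarrow> 'a \<Rightarrow> real"
  assumes P: "prob_space P" and [measurable]: "\<And>m. D m \<in> borel_measurable P"
    and lim: "\<And>t. (\<lambda>m. real m * (\<integral>z. 1 - cos (t * D m z) \<partial>P)) \<longlonglongrightarrow> t\<^sup>2 * q"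
    and \<delta>: "\<delta> > 0"
    and bd: "eventually (\<lambda>m. \<forall>t\<in>{0..\<delta>}. real m * (\<integral>z. 1 - cos (t * D m z) \<partial>P) \<le> H) sequentially"
  shows "null_array P D"
  unfolding null_array_def
proof (intro allI impI)
  fix \<epsilon> :: real assume \<epsilon>: "\<epsilon> > 0"
  interpret P: prob_space P by fact
  define h where "h m t = real m * (\<integral>z. 1 - cos (t * D m z) \<partial>P)" for m t
  define k where "k m t = real m * (\<integral>z. (1 - cos (t * D m z))\<^sup>2 \<partial>P)" for m t
  have ic: "integrable P (\<lambda>z. 1 - cos (t * D m z))" for m t
  proof -
    have "integrable P (\<lambda>z. cos (t * D m z))" by (rule P.integrable_const_bound[where B=1]) auto
    then show ?thesis by simp
  qed
  have bnd2: "\<bar>1 - cos y\<bar> \<le> 2" for y :: real using cos_ge_minus_one[of y] cos_le_one[of y] by (simp only: abs_le_iff) linarith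
  have ic2: "integrable P (\<lambda>z. (1 - cos (t * D m z))\<^sup>2)" for m t
    by (rule P.integrable_bounded_power[OF _ bnd2]) measurable
  have k_eq: "k m t = (4 * h m t - h m (2 * t)) / 2" for m t
  proof -
    have "(1 - cos (t * D m z))\<^sup>2 = (4 * (1 - cos (t * D m z)) - (1 - cos (2 * t * D m z))) / 2" for z
      using cos_double_cos[of "t * D m z"] by (simp add: power2_diff mult.assoc field_simps)
    then have "k m t = real m * (\<integral>z. (4 * (1 - cos (t * D m z)) - (1 - cos (2 * t * D m z))) / 2 \<partial>P)"
      by (simp only: k_def)
    also have "(\<integral>z. (4 * (1 - cos (t * D m z)) - (1 - cos (2 * t * D m z))) / 2 \<partial>P)
        = (4 * (\<integral>z. 1 - cos (t * D m z) \<partial>P) - (\<integral>z. 1 - cos (2 * t * D m z) \<partial>P)) / 2"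
      by (subst integral_divide_zero, subst Bochner_Integration.integral_diff)
        (intro integrable_mult_right ic integral_mult_right_zero refl | simp only: integral_mult_right_zero)+
    finally show ?thesis unfolding h_def by (simp add: algebra_simps)
  qed
  have k0: "0 \<le> k m t" for m t unfolding k_def by (intro mult_nonneg_nonneg Bochner_Integration.integral_nonneg) auto
  have h0: "0 \<le> h m t" for m t unfolding h_def by (intro mult_nonneg_nonneg Bochner_Integration.integral_nonneg) auto
  have k_le: "k m t \<le> 2 * h m t" for m t using h0[of m "2 * t"] unfolding k_eq by simp
  have k_lim: "(\<lambda>m. k m t) \<longlonglongrightarrow> 0" for t
  proof -
    have "(\<lambda>m. (4 * h m t - h m (2 * t)) / 2) \<longlonglongrightarrow> (4 * (t\<^sup>2 * q) - (2 * t)\<^sup>2 * q) / 2"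
      unfolding h_def by (intro tendsto_intros lim) auto
    then show ?thesis unfolding k_eq by (simp add: power_mult_distrib)
  qed
  \<comment> \<open>Lebesgue measure on [0, \<delta>], the interval over which t is
    averaged.\<close>
  define R where "R = restrict_space lborel {0..\<delta>}"
  have spR: "space R = {0..\<delta>}" by (simp add: R_def)
  have [measurable_cong]: "sets R = sets (restrict_space borel {0..\<delta>})"
    unfolding R_def by (rule sets_restrict_space_cong) simp
  interpret R: finite_measure R
    by (rule finite_measureI) (use \<delta> in \<open>simp add: R_def emeasure_restrict_space\<close>)
  interpret RP: pair_sigma_finite R P ..
  have [measurable]: "(\<lambda>t. t) \<in> borel_measurable R"
    unfolding R_def by (rule measurable_restrict_space1) simp
  have "(\<lambda>m. \<integral>t. k m t \<partial>R) \<longlonglongrightarrow> (\<integral>t. 0 \<partial>R)"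
  proof -
    obtain m0 where m0: "\<And>m t. m \<ge> m0 \<Longrightarrow> t \<in> {0..\<delta>} \<Longrightarrow> h m t \<le> H"
      using bd unfolding eventually_sequentially h_def by blast
    \<comment> \<open>The bound \<open>H\<close> holds only from some index on, while dominated
      convergence asks for it at every index; hence the shift by \<open>m0\<close>.\<close>
    have "(\<lambda>m. \<integral>t. k (m + m0) t \<partial>R) \<longlonglongrightarrow> (\<integral>t. 0 \<partial>R)"
    proof (rule integral_dominated_convergence[where w="\<lambda>_. 2 * H"])
      show "AE t in R. (\<lambda>m. k (m + m0) t) \<longlonglongrightarrow> 0"
        using LIMSEQ_ignore_initial_segment[OF k_lim] by auto
      show "AE t in R. norm (k (m + m0) t) \<le> 2 * H" for m
      proof (rule AE_I2)
        fix t assume "t \<in> space R"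
        then show "norm (k (m + m0) t) \<le> 2 * H"
          using m0[of "m + m0" t] k_le[of "m + m0" t] k0[of "m + m0" t] by (simp add: spR)
      qed
      show "k (m + m0) \<in> borel_measurable R" for m unfolding k_def[abs_def] by measurable
    qed auto
    then show ?thesis by (rule LIMSEQ_offset)
  qed
  then have kR: "(\<lambda>m. \<integral>t. k m t \<partial>R) \<longlonglongrightarrow> 0" by simp
  define g where "g u = (\<integral>t. (1 - cos (t * u))\<^sup>2 \<partial>R)" for u
  have g_eq: "g u = (\<integral>t. (1 - cos (t * u))\<^sup>2 * indicator {0..\<delta>} t \<partial>lborel)" for u
    unfolding g_def R_def by (subst integral_restrict_space) (auto simp: mult.commute)
  have g0: "g u \<ge> 0" for u unfolding g_def by (rule Bochner_Integration.integral_nonneg) auto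
  \<comment> \<open>Beyond 3 / \<delta> each sine quotient is at most \<delta> / 3, which leaves at
    least 3 \<delta> / 2 - 2 \<delta> / 3 - \<delta> / 12 = 3 \<delta> / 4.\<close>
  have g_big: "g u \<ge> \<delta> / 2" if u: "\<bar>u\<bar> \<ge> 3 / \<delta>" for u
  proof -
    have u0: "\<bar>u\<bar> > 0" using u \<delta> by (smt (verit) divide_pos_pos)
    have inv: "1 / \<bar>u\<bar> \<le> \<delta> / 3" using u u0 \<delta> by (simp add: field_simps)
    have "\<bar>sin (\<delta> * u) / u\<bar> \<le> 1 / \<bar>u\<bar>" by (simp add: abs_divide divide_right_mono)
    moreover have "\<bar>sin (2 * \<delta> * u) / u\<bar> \<le> 1 / \<bar>u\<bar>" by (simp add: abs_divide divide_right_mono)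
    ultimately have "\<bar>sin (\<delta> * u) / u\<bar> \<le> \<delta> / 3" "\<bar>sin (2 * \<delta> * u) / u\<bar> \<le> \<delta> / 3" using inv by linarith+
    moreover have "g u = 3 * \<delta> / 2 - 2 * (sin (\<delta> * u) / u) + (sin (2 * \<delta> * u) / u) / 4"
      unfolding g_eq using integral_one_minus_cos_square[OF \<delta>, of u] u0 by simp
    moreover have "\<delta> / 2 \<le> 3 * \<delta> / 2 - 2 * x + y / 4" if "\<bar>x\<bar> \<le> \<delta> / 3" "\<bar>y\<bar> \<le> \<delta> / 3" for x y :: real
      using that \<delta> by (simp add: abs_le_iff field_simps)
    ultimately show ?thesis by presburger
  qed
  have fub: "(\<integral>t. k m t \<partial>R) = real m * (\<integral>z. g (D m z) \<partial>P)" and ig: "integrable P (\<lambda>z. g (D m z))" for m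
  proof -
    interpret RPf: finite_measure "R \<Otimes>\<^sub>M P" by (rule finite_measure_pair_measure) unfold_locales
    have int: "integrable (R \<Otimes>\<^sub>M P) (\<lambda>(t, z). (1 - cos (t * D m z))\<^sup>2)"
    proof (rule RPf.integrable_const_bound[where B=4])
      have "(1 - cos y)\<^sup>2 \<le> 2\<^sup>2" for y :: real using bnd2[of y] by (subst abs_le_square_iff[symmetric]) simp
      then show "AE x in R \<Otimes>\<^sub>M P. norm (case x of (t, z) \<Rightarrow> (1 - cos (t * D m z))\<^sup>2) \<le> 4" by auto
    qed measurable
    show "(\<integral>t. k m t \<partial>R) = real m * (\<integral>z. g (D m z) \<partial>P)"
      using RP.Fubini_integral[OF int] by (simp add: k_def g_def)
    show "integrable P (\<lambda>z. g (D m z))" unfolding g_def using RP.integrable_snd[OF int] .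
  qed
  \<comment> \<open>Two regimes: far out \<open>g\<close> is at least \<delta> / 2; otherwise
    \<delta> \<bar>u\<bar> < 3 < pi, so the cosine is still monotone and the single value t =
    \<delta> already gives a lower bound. The minimum with 1 keeps the comparison angle inside
    [0, pi].\<close>
  define c where "c = min (\<delta> / 2) ((1 - cos (min (\<delta> * \<epsilon>) 1))\<^sup>2)"
  have c1: "cos (min (\<delta> * \<epsilon>) 1) < 1"
    using cos_monotone_0_pi[of 0 "min (\<delta> * \<epsilon>) 1"] \<delta> \<epsilon> pi_gt3 by simp
  have c: "c > 0" using \<delta> c1 by (simp add: c_def)
  have G: "c \<le> (1 - cos (\<delta> * u))\<^sup>2 + g u" if "\<bar>u\<bar> > \<epsilon>" for u
  proof (cases "\<bar>u\<bar> \<ge> 3 / \<delta>")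
    case True
    then show ?thesis using g_big[of u] by (simp add: c_def min_le_iff_disj add_increasing)
  next
    case False
    then have "\<delta> * \<bar>u\<bar> \<le> pi" using \<delta> pi_gt3 by (simp add: field_simps)
    moreover have "min (\<delta> * \<epsilon>) 1 \<le> \<delta> * \<bar>u\<bar>" using that \<delta> by (simp add: min_le_iff_disj)
    ultimately have "cos (\<delta> * \<bar>u\<bar>) \<le> cos (min (\<delta> * \<epsilon>) 1)"
      using \<delta> \<epsilon> by (intro cos_monotone_0_pi_le) auto
    also have "cos (\<delta> * \<bar>u\<bar>) = cos (\<delta> * u)" by (simp add: abs_if)
    finally have "(1 - cos (min (\<delta> * \<epsilon>) 1))\<^sup>2 \<le> (1 - cos (\<delta> * u))\<^sup>2" using c1 by (intro power_mono) auto
    then show ?thesis using g0[of u] unfolding c_def by (intro min.coboundedI2) linarith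
  qed
  have le: "real m * P.prob {z \<in> space P. \<bar>D m z\<bar> > \<epsilon>} \<le> (k m \<delta> + (\<integral>t. k m t \<partial>R)) / c" for m
  proof -
    have "c * P.prob {z \<in> space P. \<bar>D m z\<bar> > \<epsilon>} = (\<integral>z. c * indicator {z \<in> space P. \<bar>D m z\<bar> > \<epsilon>} z \<partial>P)"
      by (simp add: P.emeasure_eq_measure)
    also have "\<dots> \<le> (\<integral>z. (1 - cos (\<delta> * D m z))\<^sup>2 + g (D m z) \<partial>P)"
      by (rule integral_mono) (use ic2 ig G g0 in \<open>auto simp: P.emeasure_eq_measure split: split_indicator\<close>)
    also have "\<dots> = (\<integral>z. (1 - cos (\<delta> * D m z))\<^sup>2 \<partial>P) + (\<integral>z. g (D m z) \<partial>P)"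
      by (rule Bochner_Integration.integral_add[OF ic2 ig])
    finally have "real m * (c * P.prob {z \<in> space P. \<bar>D m z\<bar> > \<epsilon>}) \<le> real m * ((\<integral>z. (1 - cos (\<delta> * D m z))\<^sup>2 \<partial>P) + (\<integral>z. g (D m z) \<partial>P))"
      by (rule mult_left_mono) simp
    then show ?thesis using c by (simp add: fub k_def[of m \<delta>] field_simps)
  qed
  have "(\<lambda>m. (k m \<delta> + (\<integral>t. k m t \<partial>R)) / c) \<longlonglongrightarrow> (0 + 0) / c"
    by (intro tendsto_intros k_lim kR) (use c in simp)
  then have lim0: "(\<lambda>m. (k m \<delta> + (\<integral>t. k m t \<partial>R)) / c) \<longlonglongrightarrow> 0" by simp
  show "(\<lambda>m. real m * P.prob {z \<in> space P. \<epsilon> < norm (D m z)}) \<longlonglongrightarrow> 0"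
    by (rule tendsto_sandwich[OF _ _ tendsto_const lim0]) (use le in auto)
qed

text \<open>If \<open>B\<close> returned below a level b infinitely often, the uniform bound at a
  small multiple of t would give m I(t / 2^n) \<le> H for arbitrarily large m. Since doubling the
  argument costs a factor 4 at most, I(t) would vanish for every t > 0, which contradicts q >
  0.\<close>

lemma quadratic_limit_imp_norming_at_top:
  fixes \<theta> :: "'a \<Rightarrow> real" and B :: "nat \<Rightarrow> real"
  assumes P: "prob_space P" and [measurable]: "\<theta> \<in> borel_measurable P" and B: "\<And>m. B m > 0"
    and lim: "(\<lambda>m. real m * (\<integral>z. 1 - cos (\<theta> z / B m) \<partial>P)) \<longlonglongrightarrow> q"
    and q: "q > 0" and \<delta>: "\<delta> > 0"
    and bd: "eventually (\<lambda>m. \<forall>t\<in>{0..\<delta>}. real m * (\<integral>z. 1 - cos (t * (\<theta> z / B m)) \<partial>P) \<le> H) sequentially"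
  shows "filterlim B at_top sequentially"
proof (rule ccontr)
  assume "\<not> filterlim B at_top sequentially"
  then obtain b where b: "\<not> eventually (\<lambda>m. b \<le> B m) sequentially" by (auto simp: filterlim_at_top)
  interpret P: prob_space P by fact
  define I where "I t = (\<integral>z. 1 - cos (t * \<theta> z) \<partial>P)" for t
  have ic: "integrable P (\<lambda>z. 1 - cos (t * \<theta> z))" for t
  proof -
    have "integrable P (\<lambda>z. cos (t * \<theta> z))" by (rule P.integrable_const_bound[where B=1]) auto
    then show ?thesis by simp
  qed
  have I0: "I t \<ge> 0" for t unfolding I_def by (rule Bochner_Integration.integral_nonneg) auto
  \<comment> \<open>The gap 4 (1 - cos \<theta>) - (1 - cos 2\<theta>) is the square 2 (1 - cos
    \<theta>)^2.\<close>
  have dbl: "I (2 * t) \<le> 4 * I t" for t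
  proof -
    have "1 - cos (2 * t * \<theta> z) \<le> 4 * (1 - cos (t * \<theta> z))" for z
      using cos_double_cos[of "t * \<theta> z"] zero_le_power2[of "1 - cos (t * \<theta> z)"]
      by (simp add: power2_diff mult.assoc)
    then have "I (2 * t) \<le> (\<integral>z. 4 * (1 - cos (t * \<theta> z)) \<partial>P)"
      unfolding I_def by (intro integral_mono ic integrable_mult_right)
    then show ?thesis unfolding I_def by (simp only: integral_mult_right_zero)
  qed
  have dbln: "I (2 ^ n * t) \<le> 4 ^ n * I t" for n t
  proof (induction n)
    case (Suc n)
    have "I (2 ^ Suc n * t) \<le> 4 * I (2 ^ n * t)" using dbl[of "2 ^ n * t"] by (simp add: mult.assoc)
    with Suc show ?case by simp
  qed simp
  have b0: "b > 0"
  proof (rule ccontr)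
    assume "\<not> b > 0"
    then have "b \<le> B m" for m using B[of m] by linarith
    with b show False by simp
  qed
  have zero: "I t = 0" if t: "t > 0" for t
  proof (rule ccontr)
    assume "I t \<noteq> 0"
    with I0[of t] have It: "I t > 0" by simp
    \<comment> \<open>The number n of halvings brings t b / 2^n below \<delta>; the index j then
      exceeds the bound that the uniform estimate would impose on m.\<close>
    obtain n :: nat where n: "b * t / \<delta> < 2 ^ n" using real_arch_pow[of 2 "b * t / \<delta>"] by auto
    obtain j :: nat where j: "4 ^ n * H / I t < real j" using reals_Archimedean2 by blast
    have "frequently (\<lambda>m. B m < b) sequentially" using b by (simp add: frequently_def not_less)
    from frequently_eventually_frequently[OF this eventually_conj[OF bd eventually_ge_at_top[of j]]]
    obtain m where m: "B m < b" "j \<le> m" "\<And>r. r \<in> {0..\<delta>} \<Longrightarrow> real m * (\<integral>z. 1 - cos (r * (\<theta> z / B m)) \<partial>P) \<le> H"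
      by (auto dest!: frequently_ex)
    let ?r = "t / 2 ^ n * B m"
    have "?r \<le> t / 2 ^ n * b" using m t by (intro mult_left_mono) auto
    also have "\<dots> \<le> \<delta>" using n \<delta> by (simp add: field_simps)
    finally have "?r \<in> {0..\<delta>}" using t B[of m] by simp
    from m(3)[OF this] have mI: "real m * I (t / 2 ^ n) \<le> H" using B[of m] by (simp add: I_def mult.commute)
    have "I t \<le> 4 ^ n * I (t / 2 ^ n)" using dbln[of n "t / 2 ^ n"] by simp
    then have "real m * I t \<le> real m * (4 ^ n * I (t / 2 ^ n))" by (rule mult_left_mono) simp
    also have "\<dots> = 4 ^ n * (real m * I (t / 2 ^ n))" by (rule mult.left_commute)
    also have "\<dots> \<le> 4 ^ n * H" using mI by (rule mult_left_mono) simp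
    finally have "real m \<le> 4 ^ n * H / I t" using It by (simp add: field_simps)
    with j m(2) show False by simp
  qed
  have "(\<integral>z. 1 - cos (\<theta> z / B m) \<partial>P) = I (1 / B m)" for m by (simp add: I_def)
  then have "(\<lambda>m. real m * (\<integral>z. 1 - cos (\<theta> z / B m) \<partial>P)) = (\<lambda>_. 0)"
    using zero B by simp
  with lim have "q = 0" by (simp add: LIMSEQ_const_iff)
  with q show False by simp
qed

text \<open>If one copy exceeds \<epsilon> and the independent other is at most \<epsilon> / 2,
  their difference exceeds \<epsilon> / 2. The second event has probability at least 1/2 eventually,
  so tails of \<tau> are at most twice those of the difference.\<close>

lemma null_array_desymmetrize:
  fixes \<tau> :: "'a \<Rightarrow> real" and B :: "nat \<Rightarrow> real"
  assumes M: "prob_space M" and [measurable]: "\<tau> \<in> borel_measurable M" and B: "filterlim B at_top sequentially" "\<And>m. B m > 0"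
    and n: "null_array (M \<Otimes>\<^sub>M M) (\<lambda>m z. (\<tau> (fst z) - \<tau> (snd z)) / B m)"
  shows "null_array M (\<lambda>m x. \<tau> x / B m)"
  unfolding null_array_def
proof (intro allI impI)
  fix \<epsilon> :: real assume \<epsilon>: "\<epsilon> > 0"
  interpret M: prob_space M by fact
  interpret P: pair_prob_space M M ..
  let ?a = "\<lambda>m. M.prob {x \<in> space M. \<bar>\<tau> x\<bar> / B m > \<epsilon>}"
  let ?b = "\<lambda>m. M.prob {x \<in> space M. \<bar>\<tau> x\<bar> / B m \<le> \<epsilon> / 2}"
  let ?c = "\<lambda>m. P.prob {z \<in> space (M \<Otimes>\<^sub>M M). \<bar>(\<tau> (fst z) - \<tau> (snd z)) / B m\<bar> > \<epsilon> / 2}"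
  have le: "?a m * ?b m \<le> ?c m" for m
  proof -
    have "?a m * ?b m = P.prob ({x \<in> space M. \<bar>\<tau> x\<bar> / B m > \<epsilon>} \<times> {x \<in> space M. \<bar>\<tau> x\<bar> / B m \<le> \<epsilon> / 2})"
      by (subst measure_def, subst M.emeasure_pair_measure_Times) (auto simp: M.emeasure_eq_measure enn2real_mult)
    also have "\<dots> \<le> ?c m"
    proof (rule P.finite_measure_mono)
      show "{x \<in> space M. \<bar>\<tau> x\<bar> / B m > \<epsilon>} \<times> {x \<in> space M. \<bar>\<tau> x\<bar> / B m \<le> \<epsilon> / 2}
        \<subseteq> {z \<in> space (M \<Otimes>\<^sub>M M). \<bar>(\<tau> (fst z) - \<tau> (snd z)) / B m\<bar> > \<epsilon> / 2}"
      proof safe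
        fix x y assume "x \<in> space M" "y \<in> space M" "\<epsilon> < \<bar>\<tau> x\<bar> / B m" "\<bar>\<tau> y\<bar> / B m \<le> \<epsilon> / 2"
        then show "(x, y) \<in> space (M \<Otimes>\<^sub>M M)" by (simp add: space_pair_measure)
      next
        fix x y assume "\<epsilon> < \<bar>\<tau> x\<bar> / B m" "\<bar>\<tau> y\<bar> / B m \<le> \<epsilon> / 2"
        moreover have "\<bar>\<tau> x\<bar> / B m - \<bar>\<tau> y\<bar> / B m \<le> \<bar>\<tau> x - \<tau> y\<bar> / B m"
          using B(2)[of m] by (simp add: diff_divide_distrib[symmetric] divide_right_mono)
        ultimately show "\<epsilon> / 2 < \<bar>(\<tau> (fst (x, y)) - \<tau> (snd (x, y))) / B m\<bar>"
          using B(2)[of m] unfolding fst_conv snd_conv abs_divide by (simp only: abs_of_pos)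
      qed
    qed measurable
    finally show ?thesis .
  qed
  \<comment> \<open>This is where the divergence of \<open>B\<close> enters: a fixed random variable
    divided by \<open>B m\<close> tends to zero pointwise.\<close>
  have "?b \<longlonglongrightarrow> 1"
  proof -
    have "(\<lambda>m. \<integral>x. indicator {x \<in> space M. \<bar>\<tau> x\<bar> / B m \<le> \<epsilon> / 2} x \<partial>M) \<longlonglongrightarrow> (\<integral>x. (1::real) \<partial>M)"
    proof (rule integral_dominated_convergence[where w="\<lambda>_. 1"])
      show "AE x in M. (\<lambda>m. indicator {x \<in> space M. \<bar>\<tau> x\<bar> / B m \<le> \<epsilon> / 2} x) \<longlonglongrightarrow> (1::real)"
      proof (rule AE_I2)
        fix x assume x: "x \<in> space M"
        have "eventually (\<lambda>m. 2 * \<bar>\<tau> x\<bar> / \<epsilon> \<le> B m) sequentially" using B(1) by (simp add: filterlim_at_top)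
        then have "eventually (\<lambda>m. 1 = indicator {x \<in> space M. \<bar>\<tau> x\<bar> / B m \<le> \<epsilon> / 2} x) sequentially"
        proof eventually_elim
          case (elim m)
          then have "\<bar>\<tau> x\<bar> / B m \<le> \<epsilon> / 2" using B(2)[of m] \<epsilon> by (simp add: field_simps)
          then show ?case using x by simp
        qed
        then show "(\<lambda>m. indicator {x \<in> space M. \<bar>\<tau> x\<bar> / B m \<le> \<epsilon> / 2} x) \<longlonglongrightarrow> (1::real)"
          by (rule Lim_transform_eventually[OF tendsto_const])
      qed
    qed (auto split: split_indicator)
    then show ?thesis by (simp add: M.prob_space)
  qed
  then have ev: "eventually (\<lambda>m. ?b m > 1 / 2) sequentially" by (rule order_tendstoD) simp
  have lim: "(\<lambda>m. 2 * (real m * ?c m)) \<longlonglongrightarrow> 0"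
    using n[unfolded null_array_def, rule_format, of "\<epsilon> / 2"] \<epsilon> by (intro tendsto_mult_right_zero) simp
  have "eventually (\<lambda>m. real m * ?a m \<le> 2 * (real m * ?c m)) sequentially"
    using ev
  proof eventually_elim
    case (elim m)
    have "?a m * (1 / 2) \<le> ?a m * ?b m" using elim by (intro mult_left_mono) auto
    with le[of m] have "?a m \<le> 2 * ?c m" by simp
    from mult_left_mono[OF this, of "real m"] show ?case by simp
  qed
  then have "(\<lambda>m. real m * ?a m) \<longlonglongrightarrow> 0"
    by (rule tendsto_sandwich[OF _ _ tendsto_const lim, rotated]) auto
  moreover have "norm (\<tau> x / B m) = \<bar>\<tau> x\<bar> / B m" for x m using B(2)[of m] by (simp add: abs_divide)
  ultimately show "(\<lambda>m. real m * M.prob {x \<in> space M. \<epsilon> < norm (\<tau> x / B m)}) \<longlonglongrightarrow> 0" by (simp only:)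
qed

section \<open>Domains of attraction of Gaussian laws\<close>

lemma vchar_distr:
  fixes \<xi> :: "'a \<Rightarrow> 'b::euclidean_space"
  assumes [measurable]: "\<xi> \<in> borel_measurable M"
  shows "vchar (distr M borel \<xi>) s = (CLINT x|M. iexp (s \<bullet> \<xi> x))"
  unfolding vchar_def by (subst integral_distr) auto

text \<open>The same norming works for the symmetrised sums, whose characteristic function
  \<open>\<bar>\<phi>\<bar>\<^sup>2\<close> no longer depends on the centring.\<close>

lemma attraction_imp_symmetrized_tendsto:
  fixes M :: "'a::euclidean_space measure"
  assumes M: "prob_space M" "sets M = sets borel" and L: "prob_space L" "sets L = sets borel"
    and Lchar: "\<And>s. vchar L s = of_real (exp (- (Q s / 2)))"
    and conv: "conv_distr (\<lambda>m. normalized_sum_distr M m (B m) (A m)) L"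
  shows "(\<lambda>m. real m * (1 - (cmod (vchar M ((1 / B m) *\<^sub>R s)))\<^sup>2)) \<longlonglongrightarrow> Q s"
proof (rule power_tendsto_exp_imp_one_minus)
  show "(cmod (vchar M ((1 / B m) *\<^sub>R s)))\<^sup>2 \<le> 1" for m
    using norm_vchar_le_1[OF M] by (simp add: power_le_one)
  have "(\<lambda>m. (cmod (vchar (normalized_sum_distr M m (B m) (A m)) s))\<^sup>2) \<longlonglongrightarrow> (cmod (vchar L s))\<^sup>2"
    by (intro tendsto_intros conv_distr_imp_vchar_tendsto[OF prob_space_normalized_sum[OF M] L conv])
  moreover have "(cmod (vchar (normalized_sum_distr M m (B m) (A m)) s))\<^sup>2 = ((cmod (vchar M ((1 / B m) *\<^sub>R s)))\<^sup>2) ^ m" for m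
  proof -
    have "cmod (iexp (- (s \<bullet> A m))) = 1" by (rule norm_exp_i_times)
    then show ?thesis
      unfolding vchar_normalized_sum[OF M] norm_mult norm_power
      by (simp add: power_mult[symmetric] mult.commute)
  qed
  moreover have "(cmod (vchar L s))\<^sup>2 = exp (- Q s)"
    unfolding Lchar by (simp add: power2_eq_square exp_add[symmetric])
  ultimately show "(\<lambda>m. ((cmod (vchar M ((1 / B m) *\<^sub>R s)))\<^sup>2) ^ m) \<longlonglongrightarrow> exp (- Q s)" by simp
qed simp

text \<open>Averaging over t needs a bound uniform near the origin, which pointwise limits do not
  give. Weak convergence tested on min(2, \<delta> \<bar>x\<bar>) keeps the characteristic functions
  of the normalised sums within 1/2 of 1 on a ball. There \<bar>\<phi>\<bar>^m > 1/2, hence m (1 -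
  \<bar>\<phi>\<bar>^2) \<le> - 2 m ln \<bar>\<phi>\<bar> \<le> ln 4.\<close>

lemma attraction_imp_symmetrized_bounded:
  fixes M :: "'a::euclidean_space measure"
  assumes M: "prob_space M" "sets M = sets borel" and L: "prob_space L" "sets L = sets borel"
    and conv: "conv_distr (\<lambda>m. normalized_sum_distr M m (B m) (A m)) L"
  obtains \<delta> where "\<delta> > 0" "eventually (\<lambda>m. \<forall>s. norm s \<le> \<delta> \<longrightarrow>
      real m * (1 - (cmod (vchar M ((1 / B m) *\<^sub>R s)))\<^sup>2) \<le> ln 4) sequentially"
proof -
  interpret L: prob_space L by fact
  note [measurable_cong] = L(2)
  let ?f = "\<lambda>d x. min 2 (d * norm x) :: real"
  have "(\<lambda>n. \<integral>x. ?f (inverse (real (Suc n))) x \<partial>L) \<longlonglongrightarrow> (\<integral>x. 0 \<partial>L)"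
  proof (rule integral_dominated_convergence[where w="\<lambda>_. 2"])
    show "AE x in L. (\<lambda>n. ?f (inverse (real (Suc n))) x) \<longlonglongrightarrow> 0"
    proof (rule AE_I2)
      fix x
      have "(\<lambda>n. ?f (inverse (real (Suc n))) x) \<longlonglongrightarrow> ?f 0 x"
        by (intro tendsto_intros LIMSEQ_inverse_real_of_nat)
      then show "(\<lambda>n. ?f (inverse (real (Suc n))) x) \<longlonglongrightarrow> 0" by simp
    qed
  qed auto
  then have "(\<lambda>n. \<integral>x. ?f (inverse (real (Suc n))) x \<partial>L) \<longlonglongrightarrow> 0" by simp
  then have "eventually (\<lambda>n. (\<integral>x. ?f (inverse (real (Suc n))) x \<partial>L) < 1 / 2) sequentially"
    by (rule order_tendstoD) simp
  then obtain n where n: "(\<integral>x. ?f (inverse (real (Suc n))) x \<partial>L) < 1 / 2" by (auto simp: eventually_sequentially)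
  define \<delta> where "\<delta> = inverse (real (Suc n))"
  have \<delta>: "\<delta> > 0" by (simp add: \<delta>_def)
  have "(\<lambda>m. \<integral>x. ?f \<delta> x \<partial>normalized_sum_distr M m (B m) (A m)) \<longlonglongrightarrow> (\<integral>x. ?f \<delta> x \<partial>L)"
    by (rule conv[unfolded conv_distr_def, rule_format])
      (use \<delta> in \<open>auto intro!: continuous_intros boundedI[where B=2]\<close>)
  then have "eventually (\<lambda>m. (\<integral>x. ?f \<delta> x \<partial>normalized_sum_distr M m (B m) (A m)) < 1 / 2) sequentially"
    by (rule order_tendstoD) (use n in \<open>simp add: \<delta>_def\<close>)
  then have "eventually (\<lambda>m. \<forall>s. norm s \<le> \<delta> \<longrightarrow>
      real m * (1 - (cmod (vchar M ((1 / B m) *\<^sub>R s)))\<^sup>2) \<le> ln 4) sequentially"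
  proof (eventually_elim, intro allI impI)
    fix m and s :: 'a
    let ?N = "normalized_sum_distr M m (B m) (A m)"
    assume lt: "(\<integral>x. ?f \<delta> x \<partial>?N) < 1 / 2" and s: "norm s \<le> \<delta>"
    interpret N: prob_space ?N by (rule prob_space_normalized_sum[OF M])
    note [measurable_cong] = prob_space_normalized_sum(2)[OF M, of m "B m" "A m"]
    note iN = integrable_iexp_inner[OF prob_space_normalized_sum[OF M]]
    have "1 - vchar ?N s = (CLINT x|?N. 1 - iexp (s \<bullet> x))"
      unfolding vchar_def using iN by (subst Bochner_Integration.integral_diff) (auto simp: N.prob_space)
    also have "cmod \<dots> \<le> (\<integral>x. cmod (1 - iexp (s \<bullet> x)) \<partial>?N)" by (rule integral_norm_bound)
    also have "\<dots> \<le> (\<integral>x. ?f \<delta> x \<partial>?N)"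
    proof (rule integral_mono)
      fix x :: 'a
      have "cmod (iexp (s \<bullet> x) - 1) \<le> \<bar>s \<bullet> x\<bar>" using iexp_approx1[of "s \<bullet> x" 0] by simp
      also have "\<dots> \<le> norm s * norm x" by (rule Cauchy_Schwarz_ineq2)
      also have "\<dots> \<le> \<delta> * norm x" using s by (intro mult_right_mono) auto
      finally have "cmod (1 - iexp (s \<bullet> x)) \<le> \<delta> * norm x" by (simp add: norm_minus_commute)
      moreover have "cmod (1 - iexp (s \<bullet> x)) \<le> 2"
        using norm_triangle_ineq4[of 1 "iexp (s \<bullet> x)"] by simp
      ultimately show "cmod (1 - iexp (s \<bullet> x)) \<le> ?f \<delta> x" by simp
    next
      show "integrable ?N (\<lambda>x. cmod (1 - iexp (s \<bullet> x)))"
        using iN by (intro integrable_norm Bochner_Integration.integrable_diff) auto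
      show "integrable ?N (?f \<delta>)"
        by (rule N.integrable_const_bound[where B=2]) (use \<delta> in auto)
    qed
    finally have "cmod (1 - vchar ?N s) < 1 / 2" using lt by linarith
    then have ge: "cmod (vchar ?N s) > 1 / 2"
      using norm_triangle_ineq[of "1 - vchar ?N s" "vchar ?N s"] by simp
    let ?a = "cmod (vchar M ((1 / B m) *\<^sub>R s))"
    have "cmod (iexp (- (s \<bullet> A m))) = 1" by (rule norm_exp_i_times)
    then have eq: "cmod (vchar ?N s) = ?a ^ m"
      unfolding vchar_normalized_sum[OF M] norm_mult norm_power by simp
    show "real m * (1 - ?a\<^sup>2) \<le> ln 4"
    proof (cases "m = 0")
      case False
      have a0: "?a > 0" using ge eq False by (cases "?a = 0") (auto simp: power_0_left)
      have "ln (?a ^ m) \<ge> ln (1 / 2)" using ge eq by (subst ln_le_cancel_iff) (use a0 in auto)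
      then have "- real m * ln ?a \<le> ln 2" using a0 by (simp add: ln_realpow ln_div)
      moreover have "ln (?a\<^sup>2) \<le> ?a\<^sup>2 - 1" using a0 by (intro ln_le_minus_one) simp
      then have "real m * (1 - ?a\<^sup>2) \<le> real m * (- (2 * ln ?a))" using a0 by (intro mult_left_mono) (auto simp: ln_realpow)
      moreover have "ln (4::real) = 2 * ln 2" using ln_realpow[of 2 2] by simp
      ultimately show ?thesis by simp
    qed simp
  qed
  with \<delta> that show thesis by blast
qed

text \<open>Each direction is treated separately on the product space: the symmetrised projection is
  a null array by its quadratic limit and is then desymmetrised. Summing over a basis recovers the
  norm.\<close>

theorem attraction_imp_null_array:
  fixes M :: "'a::euclidean_space measure"
  assumes M: "prob_space M" "sets M = sets borel" and L: "prob_space L" "sets L = sets borel"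
    and Lchar: "\<And>s. vchar L s = of_real (exp (- (Q s / 2)))"
    and Qscale: "\<And>t s. Q (t *\<^sub>R s) = t\<^sup>2 * Q s" and Qpos: "Q e > 0"
    and B: "\<And>m. B m > 0"
    and conv: "conv_distr (\<lambda>m. normalized_sum_distr M m (B m) (A m)) L"
  shows "null_array M (\<lambda>m x. (1 / B m) *\<^sub>R x)"
proof -
  interpret M: prob_space M by fact
  interpret P: pair_prob_space M M ..
  note [measurable_cong] = M(2)
  define \<theta> where "\<theta> s z = s \<bullet> fst z - s \<bullet> snd z" for s :: 'a and z :: "'a \<times> 'a"
  have [measurable]: "\<theta> s \<in> borel_measurable (M \<Otimes>\<^sub>M M)" for s unfolding \<theta>_def[abs_def] by measurable
  have eq: "(\<integral>z. 1 - cos (t * (\<theta> s z / B m)) \<partial>(M \<Otimes>\<^sub>M M)) = 1 - (cmod (vchar M ((1 / B m) *\<^sub>R (t *\<^sub>R s))))\<^sup>2" for t s m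
  proof -
    let ?\<tau> = "\<lambda>x. ((1 / B m) *\<^sub>R (t *\<^sub>R s)) \<bullet> x"
    have "(cmod (vchar M ((1 / B m) *\<^sub>R (t *\<^sub>R s))))\<^sup>2 = (\<integral>z. cos (?\<tau> (fst z) - ?\<tau> (snd z)) \<partial>(M \<Otimes>\<^sub>M M))"
      unfolding vchar_def by (rule norm_square_charfun_eq[OF M(1)]) measurable
    also have "\<dots> = (\<integral>z. cos (t * (\<theta> s z / B m)) \<partial>(M \<Otimes>\<^sub>M M))"
      by (intro Bochner_Integration.integral_cong refl) (simp add: \<theta>_def algebra_simps diff_divide_distrib)
    finally have *: "(cmod (vchar M ((1 / B m) *\<^sub>R (t *\<^sub>R s))))\<^sup>2 = (\<integral>z. cos (t * (\<theta> s z / B m)) \<partial>(M \<Otimes>\<^sub>M M))" .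
    have "integrable (M \<Otimes>\<^sub>M M) (\<lambda>z. cos (t * (\<theta> s z / B m)))"
      by (rule P.integrable_const_bound[where B=1]) auto
    then show ?thesis unfolding * by (simp add: P.prob_space)
  qed
  have lim: "(\<lambda>m. real m * (\<integral>z. 1 - cos (t * (\<theta> s z / B m)) \<partial>(M \<Otimes>\<^sub>M M))) \<longlonglongrightarrow> t\<^sup>2 * Q s" for t s
    unfolding eq using attraction_imp_symmetrized_tendsto[where Q=Q and s="t *\<^sub>R s", OF M L Lchar conv] by (simp only: Qscale)
  obtain \<delta> where \<delta>: "\<delta> > 0" and bd: "eventually (\<lambda>m. \<forall>s. norm s \<le> \<delta> \<longrightarrow>
      real m * (1 - (cmod (vchar M ((1 / B m) *\<^sub>R s)))\<^sup>2) \<le> ln 4) sequentially"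
    using attraction_imp_symmetrized_bounded[OF M L conv] by blast
  \<comment> \<open>The length of t for which t s stays in the ball of radius \<delta>; adding 1
    covers s = 0.\<close>
  define \<delta>' where "\<delta>' s = \<delta> / (norm s + 1)" for s :: 'a
  have \<delta>': "\<delta>' s > 0" for s using \<delta> by (simp add: \<delta>'_def add_nonneg_pos)
  have bd': "eventually (\<lambda>m. \<forall>t\<in>{0..\<delta>' s}. real m * (\<integral>z. 1 - cos (t * (\<theta> s z / B m)) \<partial>(M \<Otimes>\<^sub>M M)) \<le> ln 4) sequentially" for s
    using bd
  proof (eventually_elim, intro ballI)
    fix m t assume *: "\<forall>s. norm s \<le> \<delta> \<longrightarrow> real m * (1 - (cmod (vchar M ((1 / B m) *\<^sub>R s)))\<^sup>2) \<le> ln 4" and t: "t \<in> {0..\<delta>' s}"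
    have "norm (t *\<^sub>R s) \<le> \<delta>' s * (norm s + 1)" using t by (simp add: mult_mono')
    also have "\<dots> = \<delta>" by (simp add: \<delta>'_def add_nonneg_eq_0_iff)
    finally show "real m * (\<integral>z. 1 - cos (t * (\<theta> s z / B m)) \<partial>(M \<Otimes>\<^sub>M M)) \<le> ln 4" unfolding eq using * by blast
  qed
  have n: "null_array (M \<Otimes>\<^sub>M M) (\<lambda>m z. \<theta> s z / B m)" for s
    by (rule quadratic_limit_imp_null_array[OF P.prob_space_axioms _ lim \<delta>' bd']) measurable
  \<comment> \<open>One nondegenerate direction \<open>e\<close> suffices, since the same
    \<open>B\<close> norms all directions.\<close>
  have Btop: "filterlim B at_top sequentially"
    using lim[of 1 e] by (intro quadratic_limit_imp_norming_at_top[OF P.prob_space_axioms _ B _ Qpos \<delta>' bd']) simp_all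
  have n1: "null_array M (\<lambda>m x. (s \<bullet> x) / B m)" for s
    using n[of s] unfolding \<theta>_def by (intro null_array_desymmetrize[OF M(1) _ Btop B]) simp_all
  have "null_array M (\<lambda>m x. \<Sum>b\<in>Basis. \<bar>(b \<bullet> x) / B m\<bar>)"
  proof (rule null_array_sum[OF M(1) finite_Basis])
    fix b :: 'a
    show "null_array M (\<lambda>m x. \<bar>(b \<bullet> x) / B m\<bar>)" using n1[of b] by (simp add: null_array_def)
  qed measurable
  then show ?thesis
  proof (rule null_array_mono_AE[OF M(1), where c=1])
    show "AE x in M. norm ((1 / B m) *\<^sub>R x) \<le> 1 * norm (\<Sum>b\<in>Basis. \<bar>(b \<bullet> x) / B m\<bar>)" for m
    proof (rule AE_I2)
      fix x
      have "norm ((1 / B m) *\<^sub>R x) \<le> (\<Sum>b\<in>Basis. \<bar>((1 / B m) *\<^sub>R x) \<bullet> b\<bar>)" by (rule norm_le_l1)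
      then show "norm ((1 / B m) *\<^sub>R x) \<le> 1 * norm (\<Sum>b\<in>Basis. \<bar>(b \<bullet> x) / B m\<bar>)" by (simp add: inner_commute)
    qed
  qed auto
qed

section \<open>The variance criterion for a fixed norming\<close>

text \<open>The truncating event \<open>E m\<close> is a parameter instead of {\<bar>\<xi>\<bar>
  \<le> \<open>B m\<close>}, and \<xi> lives on an arbitrary space: the diagonal of a matrix can
  thus be cut off by the norm of the whole matrix, which is what unitary invariance
  respects.\<close>

locale truncation = prob_space M for M :: "'a measure" +
  fixes \<xi> :: "'a \<Rightarrow> 'b::euclidean_space" and B :: "nat \<Rightarrow> real" and E :: "nat \<Rightarrow> 'a set" and T :: "nat \<Rightarrow> 'a \<Rightarrow> 'b"
  assumes \<xi>_meas [measurable]: "\<xi> \<in> borel_measurable M"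
    and B_pos: "\<And>m. B m > 0"
    and E_meas [measurable]: "\<And>m. E m \<in> sets M"
    and E_bound: "\<And>m x. x \<in> E m \<Longrightarrow> norm (\<xi> x) \<le> B m"
    and E_null: "(\<lambda>m. real m * prob (space M - E m)) \<longlonglongrightarrow> 0"
    and null: "null_array M (\<lambda>m x. (1 / B m) *\<^sub>R \<xi> x)"
  defines "T \<equiv> \<lambda>m x. indicator (E m) x *\<^sub>R ((1 / B m) *\<^sub>R \<xi> x)"
begin

lemma T_meas [measurable]: "T m \<in> borel_measurable M"
  unfolding T_def by measurable

lemma norm_T_le: "norm (T m x) \<le> 1"
  using E_bound[of x m] B_pos[of m] by (auto simp: T_def divide_simps split: split_indicator)

lemma inner_T_le: "\<bar>s \<bullet> T m x\<bar> \<le> norm s"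
proof -
  have "\<bar>s \<bullet> T m x\<bar> \<le> norm s * norm (T m x)" by (rule Cauchy_Schwarz_ineq2)
  also have "\<dots> \<le> norm s" using norm_T_le[of m x] by (simp add: mult_left_le)
  finally show ?thesis .
qed

lemma integrable_T: "integrable M (T m)"
  by (rule integrable_const_bound[where B=1]) (use norm_T_le in auto)

lemma null_array_inner_T: "null_array M (\<lambda>m x. s \<bullet> T m x)"
proof (rule null_array_mono_AE[OF prob_space_axioms null, where c="norm s + 1"])
  show "AE x in M. norm (s \<bullet> T m x) \<le> (norm s + 1) * norm ((1 / B m) *\<^sub>R \<xi> x)" for m
  proof (rule AE_I2)
    fix x
    have "\<bar>s \<bullet> T m x\<bar> \<le> norm s * norm (T m x)" by (rule Cauchy_Schwarz_ineq2)
    also have "\<dots> \<le> (norm s + 1) * norm ((1 / B m) *\<^sub>R \<xi> x)"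
      by (rule mult_mono) (auto simp: T_def split: split_indicator)
    finally show "norm (s \<bullet> T m x) \<le> (norm s + 1) * norm ((1 / B m) *\<^sub>R \<xi> x)" by simp
  qed
qed (measurable, simp add: add_nonneg_pos)

text \<open>The integrands agree on \<open>E m\<close> and have modulus one everywhere. After
  multiplication by m the error tends to zero by \<open>E_null\<close>, so truncation is invisible
  in m-th powers.\<close>

lemma charfun_T_close:
  "cmod (vchar (distr M borel \<xi>) ((1 / B m) *\<^sub>R s) - (CLINT x|M. iexp (s \<bullet> T m x))) \<le> 2 * prob (space M - E m)"
proof -
  have i1: "integrable M (\<lambda>x. iexp (((1 / B m) *\<^sub>R s) \<bullet> \<xi> x))" by (rule integrable_const_bound[where B=1]) auto
  have i2: "integrable M (\<lambda>x. iexp (s \<bullet> T m x))" by (rule integrable_const_bound[where B=1]) auto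
  have "vchar (distr M borel \<xi>) ((1 / B m) *\<^sub>R s) - (CLINT x|M. iexp (s \<bullet> T m x))
      = (CLINT x|M. iexp (((1 / B m) *\<^sub>R s) \<bullet> \<xi> x) - iexp (s \<bullet> T m x))"
    unfolding vchar_distr[OF \<xi>_meas] by (rule Bochner_Integration.integral_diff[OF i1 i2, symmetric])
  also have "cmod \<dots> \<le> (\<integral>x. cmod (iexp (((1 / B m) *\<^sub>R s) \<bullet> \<xi> x) - iexp (s \<bullet> T m x)) \<partial>M)"
    by (rule integral_norm_bound)
  also have "\<dots> \<le> (\<integral>x. 2 * indicator (space M - E m) x \<partial>M)"
  proof (rule integral_mono)
    fix x assume x: "x \<in> space M"
    show "cmod (iexp (((1 / B m) *\<^sub>R s) \<bullet> \<xi> x) - iexp (s \<bullet> T m x)) \<le> 2 * indicator (space M - E m) x"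
    proof (cases "x \<in> E m")
      case False
      have "cmod (iexp (((1 / B m) *\<^sub>R s) \<bullet> \<xi> x) - iexp (s \<bullet> T m x)) \<le>
          cmod (iexp (((1 / B m) *\<^sub>R s) \<bullet> \<xi> x)) + cmod (iexp (s \<bullet> T m x))" by (rule norm_triangle_ineq4)
      also have "\<dots> = 2" by (simp only: norm_exp_i_times)
      finally show ?thesis using False x by simp
    qed (simp add: T_def)
  qed (use integrable_norm[OF Bochner_Integration.integrable_diff[OF i1 i2]] in \<open>auto simp: emeasure_eq_measure\<close>)
  also have "\<dots> = 2 * prob (space M - E m)" by (simp add: emeasure_eq_measure Int_absorb1)
  finally show ?thesis .
qed

lemma norm_charfun_T: "cmod (CLINT x|M. iexp (s \<bullet> T m x)) \<le> 1"
proof -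
  have "cmod (CLINT x|M. iexp (s \<bullet> T m x)) \<le> (\<integral>x. cmod (iexp (s \<bullet> T m x)) \<partial>M)" by (rule integral_norm_bound)
  then show ?thesis by (simp add: prob_space)
qed

lemma prob_space_law: "prob_space (distr M borel \<xi>)" by (rule prob_space_distr) simp

text \<open>Squared moduli do not see the centring, and replacing \<phi> by the truncated \<psi>
  changes m (1 - \<bar>\<phi>\<bar>^2) by at most 4 m P(complement of \<open>E m\<close>). What
  remains is m E (1 - cos D) for the bounded null array D of differences of two truncated copies,
  whose second moment is twice the variance.\<close>

theorem attraction_imp_variance_tendsto:
  assumes L: "prob_space L" "sets L = sets borel"
    and Lchar: "\<And>s. vchar L s = of_real (exp (- (Q s / 2)))"
    and conv: "conv_distr (\<lambda>m. normalized_sum_distr (distr M borel \<xi>) m (B m) (A m)) L"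
  shows "(\<lambda>m. real m * variance (\<lambda>x. s \<bullet> T m x)) \<longlonglongrightarrow> Q s"
proof -
  interpret P: pair_prob_space M M ..
  let ?\<phi> = "\<lambda>m. cmod (vchar (distr M borel \<xi>) ((1 / B m) *\<^sub>R s))" and ?\<psi> = "\<lambda>m. cmod (CLINT x|M. iexp (s \<bullet> T m x))"
  let ?D = "\<lambda>m z. s \<bullet> T m (fst z) - s \<bullet> T m (snd z)"
  have lim: "(\<lambda>m. real m * (1 - (?\<phi> m)\<^sup>2)) \<longlonglongrightarrow> Q s"
    by (rule attraction_imp_symmetrized_tendsto[OF prob_space_law _ L Lchar conv]) simp
  have diff: "\<bar>real m * (1 - (?\<psi> m)\<^sup>2) - real m * (1 - (?\<phi> m)\<^sup>2)\<bar> \<le> 4 * (real m * prob (space M - E m))" for m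
  proof -
    have "\<bar>?\<phi> m - ?\<psi> m\<bar> \<le> 2 * prob (space M - E m)" using norm_triangle_ineq3 charfun_T_close by (rule order_trans)
    moreover have "\<bar>?\<phi> m + ?\<psi> m\<bar> \<le> 2"
      using norm_charfun_T[of s m] norm_vchar_le_1[OF prob_space_law sets_distr, of "(1 / B m) *\<^sub>R s"]
        norm_ge_zero[of "CLINT x|M. iexp (s \<bullet> T m x)"] norm_ge_zero[of "vchar (distr M borel \<xi>) ((1 / B m) *\<^sub>R s)"]
      by (simp only: abs_of_nonneg add_nonneg_nonneg)
    ultimately have "\<bar>?\<phi> m - ?\<psi> m\<bar> * \<bar>?\<phi> m + ?\<psi> m\<bar> \<le> (2 * prob (space M - E m)) * 2" by (intro mult_mono) auto
    also have "\<bar>?\<phi> m - ?\<psi> m\<bar> * \<bar>?\<phi> m + ?\<psi> m\<bar> = \<bar>(?\<phi> m)\<^sup>2 - (?\<psi> m)\<^sup>2\<bar>"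
      unfolding abs_mult[symmetric] by (rule arg_cong[where f=abs]) (simp add: power2_eq_square algebra_simps)
    finally have "real m * \<bar>(?\<phi> m)\<^sup>2 - (?\<psi> m)\<^sup>2\<bar> \<le> real m * ((2 * prob (space M - E m)) * 2)"
      by (rule mult_left_mono) simp
    moreover have "real m * (1 - (?\<psi> m)\<^sup>2) - real m * (1 - (?\<phi> m)\<^sup>2) = real m * ((?\<phi> m)\<^sup>2 - (?\<psi> m)\<^sup>2)"
      by (simp add: algebra_simps)
    ultimately show ?thesis by (simp add: abs_mult)
  qed
  have lim0: "(\<lambda>m. real m * (1 - (?\<psi> m)\<^sup>2) - real m * (1 - (?\<phi> m)\<^sup>2)) \<longlonglongrightarrow> 0"
    by (rule Lim_null_comparison[OF _ tendsto_mult_right_zero[OF E_null, of 4]]) (use diff in simp)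
  have "(\<lambda>m. real m * (1 - (?\<psi> m)\<^sup>2)) \<longlonglongrightarrow> Q s"
    using tendsto_add[OF lim0 lim] by simp
  moreover have "1 - (?\<psi> m)\<^sup>2 = (\<integral>z. 1 - cos (?D m z) \<partial>(M \<Otimes>\<^sub>M M))" for m
  proof -
    have "integrable (M \<Otimes>\<^sub>M M) (\<lambda>z. cos (?D m z))" by (rule P.integrable_const_bound[where B=1]) auto
    then show ?thesis by (subst norm_square_charfun_eq[OF prob_space_axioms]) (auto simp: P.prob_space)
  qed
  ultimately have limc: "(\<lambda>m. real m * (\<integral>z. 1 - cos (?D m z) \<partial>(M \<Otimes>\<^sub>M M))) \<longlonglongrightarrow> Q s" by simp
  have nD: "null_array (M \<Otimes>\<^sub>M M) ?D"
  proof -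
    have "null_array (distr (M \<Otimes>\<^sub>M M) M fst) (\<lambda>m x. s \<bullet> T m x)"
      unfolding distr_pair_fst by (rule null_array_inner_T)
    then have n1: "null_array (M \<Otimes>\<^sub>M M) (\<lambda>m z. s \<bullet> T m (fst z))" by (subst (asm) null_array_distr) auto
    have sw: "distr (M \<Otimes>\<^sub>M M) M snd = M"
    proof -
      have "distr (M \<Otimes>\<^sub>M M) M fst = distr (distr (M \<Otimes>\<^sub>M M) (M \<Otimes>\<^sub>M M) (\<lambda>(x, y). (y, x))) M fst"
        using P.distr_pair_swap by simp
      also have "\<dots> = distr (M \<Otimes>\<^sub>M M) M snd" by (subst distr_distr) (auto simp: comp_def case_prod_beta)
      finally show ?thesis by (simp add: distr_pair_fst)
    qed
    have "null_array (distr (M \<Otimes>\<^sub>M M) M snd) (\<lambda>m x. (- s) \<bullet> T m x)"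
      unfolding sw by (rule null_array_inner_T)
    then have n2: "null_array (M \<Otimes>\<^sub>M M) (\<lambda>m z. (- s) \<bullet> T m (snd z))" by (subst (asm) null_array_distr) auto
    show ?thesis using null_array_add[OF P.prob_space_axioms n1 n2] by simp
  qed
  have "(\<lambda>m. real m * (\<integral>z. (?D m z)\<^sup>2 \<partial>(M \<Otimes>\<^sub>M M))) \<longlonglongrightarrow> 2 * Q s"
  proof (rule cos_tendsto_imp_second_moment_tendsto[OF P.prob_space_axioms nD _ _ limc])
    show "\<bar>?D m z\<bar> \<le> 2 * norm s" for m z using inner_T_le[of s m "fst z"] inner_T_le[of s m "snd z"] by linarith
  qed measurable
  moreover have "(\<integral>z. (?D m z)\<^sup>2 \<partial>(M \<Otimes>\<^sub>M M)) = 2 * variance (\<lambda>x. s \<bullet> T m x)" for m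
    by (rule variance_symmetrize[OF _ inner_T_le]) measurable
  ultimately have "(\<lambda>m. real m * (2 * variance (\<lambda>x. s \<bullet> T m x))) \<longlonglongrightarrow> 2 * Q s" by simp
  from tendsto_divide[OF this tendsto_const[of 2]] show ?thesis by simp
qed

text \<open>The centring m E \<open>T m\<close> is exactly the phase that compensates the means in
  the m-th power of the truncated characteristic function.\<close>

theorem variance_tendsto_imp_attraction:
  assumes L: "prob_space L" "sets L = sets borel"
    and Lchar: "\<And>s. vchar L s = of_real (exp (- (Q s / 2)))"
    and var: "\<And>s. (\<lambda>m. real m * variance (\<lambda>x. s \<bullet> T m x)) \<longlonglongrightarrow> Q s"
  shows "conv_distr (\<lambda>m. normalized_sum_distr (distr M borel \<xi>) m (B m) (real m *\<^sub>R expectation (T m))) L"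
proof (rule vchar_tendsto_imp_conv_distr[OF _ _ L])
  let ?N = "\<lambda>m. normalized_sum_distr (distr M borel \<xi>) m (B m) (real m *\<^sub>R expectation (T m))"
  show "prob_space (?N m)" "sets (?N m) = sets borel" for m by (auto intro!: prob_space_normalized_sum prob_space_law)
  fix s :: 'b
  let ?\<phi> = "\<lambda>m. vchar (distr M borel \<xi>) ((1 / B m) *\<^sub>R s)" and ?\<psi> = "\<lambda>m. (CLINT x|M. iexp (s \<bullet> T m x))"
  let ?e = "\<lambda>m. iexp (- (real m * expectation (\<lambda>x. s \<bullet> T m x)))"
  have lim: "(\<lambda>m. ?\<psi> m ^ m * ?e m) \<longlonglongrightarrow> exp (- (Q s / 2))"
    by (rule variance_tendsto_imp_charfun_power_tendsto[OF prob_space_axioms null_array_inner_T _ inner_T_le var]) measurable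
  have close: "cmod (?\<phi> m ^ m * ?e m - ?\<psi> m ^ m * ?e m) \<le> 2 * (real m * prob (space M - E m))" for m
  proof -
    have "cmod (?e m) = 1" by (rule norm_exp_i_times)
    then have "cmod (?\<phi> m ^ m * ?e m - ?\<psi> m ^ m * ?e m) = cmod (?\<phi> m ^ m - ?\<psi> m ^ m)"
      unfolding left_diff_distrib[symmetric] norm_mult by simp
    also have "\<dots> \<le> real m * cmod (?\<phi> m - ?\<psi> m)"
      by (rule norm_power_diff) (auto intro!: norm_charfun_T norm_vchar_le_1 prob_space_law)
    also have "\<dots> \<le> real m * (2 * prob (space M - E m))" by (intro mult_left_mono charfun_T_close) simp
    finally show ?thesis by simp
  qed
  have "(\<lambda>m. ?\<phi> m ^ m * ?e m - ?\<psi> m ^ m * ?e m) \<longlonglongrightarrow> 0"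
    by (rule Lim_null_comparison[OF _ tendsto_mult_right_zero[OF E_null, of 2]]) (use close in simp)
  from tendsto_add[OF this lim] have "(\<lambda>m. ?\<phi> m ^ m * ?e m) \<longlonglongrightarrow> exp (- (Q s / 2))" by simp
  moreover have "vchar (?N m) s = ?\<phi> m ^ m * ?e m" for m
    using integrable_T[of m] by (subst vchar_normalized_sum) (auto intro!: prob_space_law simp: integral_inner_right)
  ultimately show "(\<lambda>m. vchar (?N m) s) \<longlonglongrightarrow> vchar L s" by (simp add: Lchar)
qed

end

section \<open>Second moments of unitarily invariant laws\<close>

abbreviation uconj :: "'n::finite cmat \<Rightarrow> 'n cmat \<Rightarrow> 'n cmat" where
  "uconj U X \<equiv> U ** X ** hadj U"

lemma uconj_component: "uconj U X $ i $ j = (\<Sum>k\<in>UNIV. \<Sum>l\<in>UNIV. U $ i $ k * X $ k $ l * cnj (U $ j $ l))"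
proof -
  have "uconj U X $ i $ j = (\<Sum>l\<in>UNIV. \<Sum>k\<in>UNIV. U $ i $ k * X $ k $ l * cnj (U $ j $ l))"
    by (simp add: matrix_matrix_mult_def hadj_def sum_distrib_right)
  also have "\<dots> = (\<Sum>k\<in>UNIV. \<Sum>l\<in>UNIV. U $ i $ k * X $ k $ l * cnj (U $ j $ l))" by (rule sum.swap)
  finally show ?thesis .
qed

lemma unitary_iff: "unitary U \<longleftrightarrow> (\<forall>i j. (\<Sum>k\<in>UNIV. U $ i $ k * cnj (U $ j $ k)) = (if i = j then 1 else 0))"
  by (simp add: unitary_def vec_eq_iff matrix_matrix_mult_def hadj_def mat_def)

lemma hadj_hadj [simp]: "hadj (hadj A) = A"
  by (simp add: hadj_def vec_eq_iff)

lemma hadj_mult: "hadj (A ** B) = hadj B ** hadj A"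
  by (simp add: hadj_def vec_eq_iff matrix_matrix_mult_def mult.commute)

lemma unitary_left: "unitary U \<Longrightarrow> hadj U ** U = mat 1"
  unfolding unitary_def by (rule matrix_left_right_inverse1)

lemma mtrace_mult_commute: "mtrace (A ** B) = mtrace (B ** A)"
proof -
  have "mtrace (A ** B) = (\<Sum>i\<in>UNIV. \<Sum>k\<in>UNIV. A $ i $ k * B $ k $ i)"
    by (simp add: mtrace_def matrix_matrix_mult_def)
  also have "\<dots> = (\<Sum>k\<in>UNIV. \<Sum>i\<in>UNIV. A $ i $ k * B $ k $ i)" by (rule sum.swap)
  finally show ?thesis by (simp add: mtrace_def matrix_matrix_mult_def mult.commute)
qed

lemma mtrace_uconj: "unitary U \<Longrightarrow> mtrace (uconj U X) = mtrace X"
  by (simp add: mtrace_mult_commute[of "U ** X"] matrix_mul_assoc unitary_left)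

lemma inner_cmat: "A \<bullet> X = (\<Sum>i\<in>UNIV. \<Sum>j\<in>UNIV. Re (cnj (A $ i $ j) * X $ i $ j))"
  by (simp add: inner_vec_def inner_complex_def)

lemma norm_cmat_square: "(norm X)\<^sup>2 = (\<Sum>i\<in>UNIV. \<Sum>j\<in>UNIV. (cmod (X $ i $ j))\<^sup>2)" for X :: "'n::finite cmat"
  by (simp add: power2_norm_eq_inner inner_vec_def)

lemma norm_cmat_eq_mtrace: "complex_of_real ((norm X)\<^sup>2) = mtrace (X ** hadj X)"
  by (simp add: norm_cmat_square mtrace_def matrix_matrix_mult_def hadj_def complex_norm_square del: of_real_power)

lemma norm_uconj: "unitary U \<Longrightarrow> norm (uconj U X) = norm X"
proof -
  assume U: "unitary U"
  have "uconj U X ** hadj (uconj U X) = U ** X ** (hadj U ** U) ** hadj X ** hadj U"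
    by (simp add: hadj_mult matrix_mul_assoc)
  also have "\<dots> = uconj U (X ** hadj X)" by (simp add: unitary_left[OF U] matrix_mul_assoc)
  finally have "complex_of_real ((norm (uconj U X))\<^sup>2) = of_real ((norm X)\<^sup>2)"
    unfolding norm_cmat_eq_mtrace by (simp add: mtrace_uconj[OF U])
  then show ?thesis by (simp only: of_real_eq_iff power2_eq_iff_nonneg norm_ge_zero)
qed

lemma uconj_scaleR: "uconj U (c *\<^sub>R X) = c *\<^sub>R uconj U X"
  by (simp add: vec_eq_iff uconj_component scaleR_sum_right)

lemma measurable_uconj [measurable]: "uconj U \<in> borel_measurable borel"
  by (rule borel_measurable_continuous_onI)
    (auto simp: matrix_matrix_mult_def hadj_def intro!: continuous_intros)

lemma measurable_cmat_component [measurable]: "(\<lambda>X::'n::finite cmat. X $ i $ j) \<in> borel_measurable borel"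
  by (rule borel_measurable_continuous_onI) (intro continuous_intros)

lemma measurable_vec_component [measurable]: "(\<lambda>x::real^'n::finite. x $ i) \<in> borel_measurable borel"
  by (rule borel_measurable_continuous_onI) (intro continuous_intros)

lemma measurable_diag_vec [measurable]: "diag_vec \<in> borel_measurable borel"
  by (rule borel_measurable_continuous_onI) (auto simp: diag_vec_def intro!: continuous_intros)

lemma measurable_perm_vec [measurable]: "perm_vec p \<in> borel_measurable borel"
  by (rule borel_measurable_continuous_onI) (auto simp: perm_vec_def intro!: continuous_intros)

lemma herm_component: "herm X \<Longrightarrow> X $ j $ i = cnj (X $ i $ j)"
  unfolding herm_def hadj_def vec_eq_iff by (metis vec_lambda_beta)

lemma herm_cnj: "herm X \<Longrightarrow> cnj (X $ i $ j) = X $ j $ i"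
  using herm_component[of X j i] by simp

lemma herm_mat1: "herm (mat 1)"
  by (simp add: herm_def hadj_def mat_def vec_eq_iff)

lemma herm_diagm: "herm (diagm v)"
  by (auto simp: herm_def hadj_def diagm_def vec_eq_iff)

text \<open>The real inner product of the matrix type is Re Tr(S* X); for Hermitian S it is the
  trace pairing, which makes \<open>vchar\<close> the matrix characteristic function.\<close>

lemma herm_inner_eq_mtrace:
  assumes "herm S" shows "S \<bullet> X = Re (mtrace (X ** S))"
proof -
  have "mtrace (X ** S) = (\<Sum>i\<in>UNIV. \<Sum>j\<in>UNIV. cnj (S $ i $ j) * X $ i $ j)"
    by (simp add: mtrace_def matrix_matrix_mult_def herm_cnj[OF assms] mult.commute)
  then show ?thesis by (simp add: inner_cmat)
qed

lemma diagm_inner: "diagm s \<bullet> X = s \<bullet> diag_vec X"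
proof -
  have "(\<Sum>j\<in>UNIV. Re (cnj (diagm s $ i $ j) * X $ i $ j)) = s $ i * Re (X $ i $ i)" for i
  proof -
    have "(\<Sum>j\<in>UNIV. Re (cnj (diagm s $ i $ j) * X $ i $ j)) = (\<Sum>j\<in>UNIV. if j = i then s $ i * Re (X $ i $ i) else 0)"
      by (intro sum.cong) (auto simp: diagm_def)
    then show ?thesis by simp
  qed
  then show ?thesis by (simp add: inner_cmat inner_vec_def diag_vec_def)
qed

lemma norm_diagm: "norm (diagm s) = norm s"
proof -
  have "diag_vec (diagm s) = s" by (simp add: diag_vec_def diagm_def vec_eq_iff)
  then show ?thesis by (simp add: norm_eq_sqrt_inner diagm_inner)
qed

lemma mtrace_diagm: "mtrace (diagm s) = of_real (s \<bullet> (\<chi> i. 1))"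
  by (simp add: mtrace_def diagm_def inner_vec_def)

lemma norm_diag_vec_le: "norm (diag_vec X) \<le> norm X"
proof -
  have "norm (diag_vec X) * norm (diag_vec X) = diagm (diag_vec X) \<bullet> X"
    by (simp add: diagm_inner power2_norm_eq_inner flip: power2_eq_square)
  also have "\<dots> \<le> norm (diagm (diag_vec X)) * norm X" by (rule norm_cauchy_schwarz)
  finally show ?thesis by (cases "norm (diag_vec X) = 0") (auto simp: norm_diagm)
qed

lemma mat1_inner: "mat 1 \<bullet> X = Re (mtrace X)"
  by (simp add: herm_inner_eq_mtrace[OF herm_mat1])

text \<open>Both quantities are invariant under conjugation. They are all that the proof uses of the
  spectrum.\<close>

lemma is_eig_vec_norm_trace:
  assumes "is_eig_vec X v"
  shows "norm v = norm X" "v \<bullet> (\<chi> i. 1) = Re (mtrace X)"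
proof -
  from assms obtain U where U: "unitary U" and X: "X = uconj U (diagm v)" by (auto simp: is_eig_vec_def)
  show "norm v = norm X" unfolding X norm_uconj[OF U] norm_diagm ..
  show "v \<bullet> (\<chi> i. 1) = Re (mtrace X)" unfolding X mtrace_uconj[OF U] mtrace_diagm by simp
qed

lemma norm_component_cmat_le: "cmod (X $ i $ j) \<le> norm X" for X :: "'n::finite cmat"
  using order_trans[OF Finite_Cartesian_Product.norm_nth_le[of "X $ i" j] Finite_Cartesian_Product.norm_nth_le[of X i]] .

section \<open>Permutation, phase and two-coordinate rotation matrices\<close>

definition perm_mat :: "('n::finite \<Rightarrow> 'n) \<Rightarrow> 'n cmat" where
  "perm_mat p = (\<chi> i j. if j = p i then 1 else 0)"

lemma sum_if_eq_mult [simp]: "(\<Sum>k\<in>UNIV. (if k = a then 1 else 0) * f k) = (f a :: complex)" for a :: "'n::finite"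
proof -
  have "(\<Sum>k\<in>UNIV. (if k = a then 1 else 0) * f k) = (\<Sum>k\<in>UNIV. if k = a then f a else 0)"
    by (intro sum.cong) auto
  then show ?thesis by simp
qed

lemma unitary_perm_mat: "p permutes UNIV \<Longrightarrow> unitary (perm_mat p)"
  unfolding unitary_iff perm_mat_def by (auto dest: permutes_inj simp: inj_eq)

lemma uconj_perm_mat: "uconj (perm_mat p) X $ i $ j = X $ p i $ p j"
proof -
  have "uconj (perm_mat p) X $ i $ j = (\<Sum>k\<in>UNIV. (if k = p i then 1 else 0) * (\<Sum>l\<in>UNIV. (if l = p j then 1 else 0) * X $ k $ l))"
    unfolding uconj_component perm_mat_def sum_distrib_left by (intro sum.cong refl) auto
  then show ?thesis by simp
qed

definition phase_mat :: "'n::finite \<Rightarrow> 'n cmat" where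
  "phase_mat p = (\<chi> i j. if j = i then if i = p then \<i> else 1 else 0)"

lemma uconj_phase_mat: "uconj (phase_mat p) X $ i $ j = (if i = p then \<i> else 1) * (if j = p then - \<i> else 1) * X $ i $ j"
proof -
  have "uconj (phase_mat p) X $ i $ j = (\<Sum>k\<in>UNIV. (if k = i then 1 else 0) *
      (\<Sum>l\<in>UNIV. (if l = j then 1 else 0) * ((if k = p then \<i> else 1) * (if l = p then - \<i> else 1) * X $ k $ l)))"
    unfolding uconj_component phase_mat_def sum_distrib_left by (intro sum.cong refl) auto
  then show ?thesis by simp
qed

lemma unitary_phase_mat: "unitary (phase_mat p)"
proof -
  have "(\<Sum>k\<in>UNIV. phase_mat p $ i $ k * cnj (phase_mat p $ j $ k)) =
    (\<Sum>k\<in>UNIV. (if k = i then 1 else 0) * (if j = i then 1 else 0))" for i j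
    by (intro sum.cong refl) (auto simp: phase_mat_def)
  then show ?thesis unfolding unitary_iff by auto
qed

text \<open>A normalised rotation in the coordinates i and j with phase w. Conjugation brings Re(cnj
  w X_ij) into the i-th diagonal entry; w = 1 and w = \<i> give the real and the imaginary
  part.\<close>

definition rot_mat :: "'n::finite \<Rightarrow> 'n \<Rightarrow> complex \<Rightarrow> 'n cmat" where
  "rot_mat i j w = (\<chi> k l. if k = i then (if l = i then 1 else if l = j then w else 0) / sqrt 2
     else if k = j then (if l = i then 1 else if l = j then - w else 0) / sqrt 2
     else if l = k then 1 else 0)"

lemma sum_two_points:
  assumes "i \<noteq> j" "\<And>k. k \<noteq> i \<Longrightarrow> k \<noteq> j \<Longrightarrow> f k = 0"
  shows "(\<Sum>k\<in>(UNIV::'n::finite set). f k) = f i + (f j :: 'a::comm_monoid_add)"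
proof -
  have "(\<Sum>k\<in>UNIV. f k) = (\<Sum>k\<in>{i, j}. f k)" by (rule sum.mono_neutral_right) (use assms in auto)
  then show ?thesis using assms(1) by simp
qed

lemma sqrt2_complex: "complex_of_real (sqrt 2) * complex_of_real (sqrt 2) = 2"
  by (simp flip: of_real_mult)

lemma unitary_rot_mat:
  assumes ij: "i \<noteq> j" and w: "w * cnj w = 1"
  shows "unitary (rot_mat i j w)"
  unfolding unitary_iff
proof (intro allI)
  fix k l
  let ?R = "rot_mat i j w"
  show "(\<Sum>m\<in>UNIV. ?R $ k $ m * cnj (?R $ l $ m)) = (if k = l then 1 else 0)"
  proof (cases "k \<in> {i, j} \<or> l \<in> {i, j}")
    case True
    then have "(\<Sum>m\<in>UNIV. ?R $ k $ m * cnj (?R $ l $ m)) = ?R $ k $ i * cnj (?R $ l $ i) + ?R $ k $ j * cnj (?R $ l $ j)"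
      by (intro sum_two_points ij) (auto simp: rot_mat_def)
    also have "\<dots> = (if k = l then 1 else 0)"
      using True ij w sqrt2_complex by (auto simp: rot_mat_def)
    finally show ?thesis .
  next
    case False
    then have "(\<Sum>m\<in>UNIV. ?R $ k $ m * cnj (?R $ l $ m)) = (\<Sum>m\<in>UNIV. (if m = k then 1 else 0) * (if k = l then 1 else 0))"
      by (intro sum.cong refl) (auto simp: rot_mat_def)
    then show ?thesis by simp
  qed
qed

lemma uconj_rot_mat:
  assumes ij: "i \<noteq> j" and w: "w * cnj w = 1" and X: "herm X"
  shows "Re (uconj (rot_mat i j w) X $ i $ i) = (Re (X $ i $ i) + Re (X $ j $ j)) / 2 + Re (cnj w * X $ i $ j)"
proof -
  let ?R = "rot_mat i j w"
  have Rz: "?R $ i $ k = 0" if "k \<noteq> i" "k \<noteq> j" for k using that by (simp add: rot_mat_def)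
  have R: "?R $ i $ i = 1 / sqrt 2" "?R $ i $ j = w / sqrt 2" using ij by (simp_all add: rot_mat_def)
  have "uconj ?R X $ i $ i = (\<Sum>l\<in>UNIV. ?R $ i $ i * X $ i $ l * cnj (?R $ i $ l)) + (\<Sum>l\<in>UNIV. ?R $ i $ j * X $ j $ l * cnj (?R $ i $ l))"
    unfolding uconj_component by (rule sum_two_points[OF ij]) (simp add: Rz)
  also have "\<dots> = (?R $ i $ i * X $ i $ i * cnj (?R $ i $ i) + ?R $ i $ i * X $ i $ j * cnj (?R $ i $ j)) +
     (?R $ i $ j * X $ j $ i * cnj (?R $ i $ i) + ?R $ i $ j * X $ j $ j * cnj (?R $ i $ j))"
    by (intro arg_cong2[where f="(+)"] sum_two_points[OF ij]) (simp_all add: Rz)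
  also have "\<dots> = (X $ i $ i + X $ i $ j * cnj w + w * X $ j $ i + (w * cnj w) * X $ j $ j) / (complex_of_real (sqrt 2) * complex_of_real (sqrt 2))"
    unfolding R by (simp add: field_simps)
  also have "\<dots> = (X $ i $ i + X $ i $ j * cnj w + cnj (X $ i $ j * cnj w) + X $ j $ j) / 2"
    unfolding sqrt2_complex w herm_component[OF X, of j i] by simp
  finally have eq: "uconj ?R X $ i $ i = (X $ i $ i + X $ i $ j * cnj w + cnj (X $ i $ j * cnj w) + X $ j $ j) / 2" .
  show ?thesis unfolding eq by (simp add: field_simps)
qed

text \<open>The transposition of \<open>i\<close> and \<open>k\<close> sends \<open>i\<close> to
  \<open>k\<close>; a second one carries the image of \<open>j\<close> to \<open>l\<close> and fixes
  \<open>k\<close>, since neither that image nor \<open>l\<close> equals \<open>k\<close>.\<close>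

lemma exists_perm_pair:
  assumes "i \<noteq> j" "k \<noteq> l"
  obtains p where "p permutes UNIV" "p i = k" "p j = l"
proof
  let ?p = "Transposition.transpose (Transposition.transpose i k j) l \<circ> Transposition.transpose i k"
  show "?p permutes UNIV" by (intro permutes_compose permutes_swap_id) auto
  show "?p i = k" using assms by (auto simp: Transposition.transpose_def)
  show "?p j = l" by simp
qed

text \<open>Permutations have two orbits on index pairs, the diagonal and its complement. With a
  single index the complement is empty and \<beta> is set to 0.\<close>

lemma exists_pair_const:
  fixes c :: "'n::finite \<Rightarrow> 'n \<Rightarrow> real"
  assumes "\<And>p i j. p permutes UNIV \<Longrightarrow> c (p i) (p j) = c i j"
  shows "\<exists>\<alpha> \<beta>. \<forall>i j. c i j = (if i = j then \<alpha> else \<beta>)"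
proof -
  have d: "c i i = c k k" for i k
    using assms[of "Transposition.transpose i k" i i] by (simp add: permutes_swap_id)
  have o: "c i j = c k l" if "i \<noteq> j" "k \<noteq> l" for i j k l
    using exists_perm_pair[OF that] assms by metis
  show ?thesis
  proof (cases "\<exists>i j::'n. i \<noteq> j")
    case True
    then obtain k l :: 'n where kl: "k \<noteq> l" by auto
    have "c i j = (if i = j then c k k else c k l)" for i j
      using d[of i k] o[OF _ kl, of i j] by (cases "i = j") simp_all
    then show ?thesis by blast
  next
    case False
    then have "c i j = (if i = j then c undefined undefined else 0)" for i j
      using d[of i undefined] by metis
    then show ?thesis by blast
  qed
qed

text \<open>Contraction along the two pairings of the four indices that survive averaging: one
  yields the squared trace of c, the other the trace of c^2. When all four indices coincide both
  terms count.\<close>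

lemma sum_pairings:
  fixes c :: "'n::finite \<Rightarrow> 'n \<Rightarrow> complex"
  shows "(\<Sum>i\<in>UNIV. \<Sum>j\<in>UNIV. \<Sum>k\<in>UNIV. \<Sum>l\<in>UNIV. c i j * c k l *
      ((if i = j \<and> k = l then \<beta> else 0) + (if i = l \<and> k = j then \<gamma> else 0)))
    = \<beta> * (\<Sum>i\<in>UNIV. c i i)\<^sup>2 + \<gamma> * (\<Sum>i\<in>UNIV. \<Sum>j\<in>UNIV. c i j * c j i)"
proof -
  have *: "c i j * c k l * ((if i = j \<and> k = l then \<beta> else 0) + (if i = l \<and> k = j then \<gamma> else 0)) =
     (if l = k then if j = i then \<beta> * (c i j * c k l) else 0 else 0) + (if l = i then if k = j then \<gamma> * (c i j * c k l) else 0 else 0)" for i j k l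
    by (cases "j = i"; cases "l = k"; cases "l = i"; cases "k = j") (simp_all add: algebra_simps)
  have if_sum: "(\<Sum>k\<in>(UNIV::'n set). if P then f k else 0) = (if P then sum f UNIV else 0)" for P and f :: "'n \<Rightarrow> complex"
    by simp
  show ?thesis
    unfolding * sum.distrib power2_eq_square sum_product
    by (simp add: if_sum sum_distrib_left)
qed

lemma mult_swap: "a * b * (c * d) = a * c * (b * d)" for a b c d :: complex
  by (simp only: mult_ac)

section \<open>Second moments of laws on the unit ball\<close>

text \<open>The setting of truncated vectors: functions dominated by a multiple of the norm, and
  products of two of them, are integrable.\<close>

locale bounded_law = prob_space M for M :: "'a::euclidean_space measure" +
  assumes sets_M [measurable_cong]: "sets M = sets borel"
    and bdd: "AE X in M. norm X \<le> 1"
begin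

lemma integrable_bdd1:
  fixes f :: "'a \<Rightarrow> 'b::{real_normed_field, banach, second_countable_topology}"
  assumes [measurable]: "f \<in> borel_measurable borel" and "\<And>X. norm (f X) \<le> c * norm X" "c \<ge> 0"
  shows "integrable M f"
proof (rule integrable_const_bound[where B=c])
  show "AE X in M. norm (f X) \<le> c"
    using bdd
  proof eventually_elim
    case (elim X)
    have "norm (f X) \<le> c * norm X" by fact
    also have "\<dots> \<le> c" using elim assms(3) by (simp add: mult_left_le)
    finally show ?case .
  qed
qed simp

lemma integrable_bdd2:
  fixes f g :: "'a \<Rightarrow> 'b::{real_normed_field, banach, second_countable_topology}"
  assumes [measurable]: "f \<in> borel_measurable borel" "g \<in> borel_measurable borel"
    and "\<And>X. norm (f X) \<le> c * norm X" "\<And>X. norm (g X) \<le> d * norm X" "c \<ge> 0" "d \<ge> 0"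
  shows "integrable M (\<lambda>X. f X * g X)"
proof (rule integrable_const_bound[where B="c * d"])
  show "AE X in M. norm (f X * g X) \<le> c * d"
    using bdd
  proof eventually_elim
    case (elim X)
    have "norm (f X) \<le> c" using assms(3)[of X] elim assms(5) by (meson mult_left_le order_trans)
    moreover have "norm (g X) \<le> d" using assms(4)[of X] elim assms(6) by (meson mult_left_le order_trans)
    ultimately show ?case by (simp add: norm_mult mult_mono')
  qed
qed simp

lemma variance_bdd:
  assumes [measurable]: "f \<in> borel_measurable borel" and "\<And>X. \<bar>f X\<bar> \<le> c * norm X" "c \<ge> 0"
  shows "variance f = expectation (\<lambda>X. (f X)\<^sup>2) - (expectation f)\<^sup>2"
proof (rule variance_eq)
  show "integrable M f" by (rule integrable_bdd1[where c=c]) (use assms in auto)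
  show "integrable M (\<lambda>X. (f X)\<^sup>2)"
    unfolding power2_eq_square by (rule integrable_bdd2[where c=c and d=c]) (use assms in auto)
qed

end

text \<open>Averaging the two hypotheses cancels the cross term E xy.\<close>

lemma (in bounded_law) second_moment_parallelogram:
  fixes x y :: "'a \<Rightarrow> real"
  assumes [measurable]: "x \<in> borel_measurable borel" "y \<in> borel_measurable borel"
    and x: "\<And>X. norm (x X) \<le> 1 * norm X" and y: "\<And>X. norm (y X) \<le> 1 * norm X"
    and plus: "expectation (\<lambda>X. (x X + y X)\<^sup>2) = c" and minus: "expectation (\<lambda>X. (x X - y X)\<^sup>2) = c"
  shows "expectation (\<lambda>X. (y X)\<^sup>2) = c - expectation (\<lambda>X. x X * x X)"
proof -
  have i: "integrable M (\<lambda>X. x X * x X)" "integrable M (\<lambda>X. y X * y X)" "integrable M (\<lambda>X. x X * y X)"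
    by (rule integrable_bdd2[OF _ _ x x] integrable_bdd2[OF _ _ y y] integrable_bdd2[OF _ _ x y]; simp)+
  have "expectation (\<lambda>X. (x X + y X)\<^sup>2) = expectation (\<lambda>X. x X * x X + y X * y X + 2 * (x X * y X))"
    "expectation (\<lambda>X. (x X - y X)\<^sup>2) = expectation (\<lambda>X. x X * x X + y X * y X - 2 * (x X * y X))"
    by (simp_all add: power2_eq_square algebra_simps)
  then show ?thesis using i plus minus by (simp add: power2_eq_square)
qed

text \<open>Exchangeability leaves one mean \<mu>, one second moment \<alpha> and one mixed moment
  \<beta>; a and b are \<alpha> and \<beta> less \<mu>^2. The second conclusion reads off a from the
  norm and the coordinate sum alone, the two quantities that the eigenvalue vector shares with the
  matrix.\<close>

lemma (in bounded_law) exchangeable_variance: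
  fixes F :: "'a \<Rightarrow> real^'n::finite"
  assumes [measurable]: "F \<in> borel_measurable borel" and le: "\<And>X. norm (F X) \<le> norm X"
    and exch: "\<And>p. p permutes UNIV \<Longrightarrow> distr (distr M borel F) borel (perm_vec p) = distr M borel F"
  obtains a b :: real where "\<And>s. variance (\<lambda>X. s \<bullet> F X) = (a - b) * (s \<bullet> s) + b * (s \<bullet> (\<chi> i. 1))\<^sup>2"
    and "expectation (\<lambda>X. (norm (F X))\<^sup>2) - (expectation (\<lambda>X. F X \<bullet> (\<chi> i. 1)))\<^sup>2 / CARD('n) = CARD('n) * a"
proof -
  have inv: "expectation (\<lambda>X. g (perm_vec p (F X))) = expectation (\<lambda>X. g (F X))"
    if "p permutes UNIV" and [measurable]: "g \<in> borel_measurable borel" for p and g :: "real^'n \<Rightarrow> real"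
  proof -
    have "expectation (\<lambda>X. g (perm_vec p (F X))) = integral\<^sup>L (distr (distr M borel F) borel (perm_vec p)) g"
      by (simp add: integral_distr)
    also have "\<dots> = expectation (\<lambda>X. g (F X))" unfolding exch[OF that(1)] by (simp add: integral_distr)
    finally show ?thesis .
  qed
  have comp: "\<bar>F X $ i\<bar> \<le> 1 * norm X" for X i using component_le_norm_cart[of "F X" i] le[of X] by simp
  have i1: "integrable M (\<lambda>X. F X $ i)" for i by (rule integrable_bdd1[where c=1]) (use comp in auto)
  have i2: "integrable M (\<lambda>X. F X $ i * F X $ j)" for i j by (rule integrable_bdd2[where c=1 and d=1]) (use comp in auto)
  define \<mu> where "\<mu> = expectation (\<lambda>X. F X $ undefined)"
  have \<mu>: "expectation (\<lambda>X. F X $ i) = \<mu>" for i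
    using inv[of "Transposition.transpose undefined i" "\<lambda>v. v $ undefined"] by (simp add: permutes_swap_id perm_vec_def \<mu>_def)
  have "expectation (\<lambda>X. F X $ p i * F X $ p j) = expectation (\<lambda>X. F X $ i * F X $ j)" if "p permutes UNIV" for p i j
    using inv[OF that, of "\<lambda>v. v $ i * v $ j"] by (simp add: perm_vec_def)
  then obtain \<alpha> \<beta> where \<alpha>\<beta>: "\<And>i j. expectation (\<lambda>X. F X $ i * F X $ j) = (if i = j then \<alpha> else \<beta>)"
    using exists_pair_const[of "\<lambda>i j. expectation (\<lambda>X. F X $ i * F X $ j)"] by blast
  have E1: "expectation (\<lambda>X. s \<bullet> F X) = \<mu> * (s \<bullet> (\<chi> i. 1))" for s
    using i1 \<mu> by (simp add: inner_vec_def sum_distrib_left mult.commute)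
  have E2: "expectation (\<lambda>X. (s \<bullet> F X)\<^sup>2) = (\<alpha> - \<beta>) * (s \<bullet> s) + \<beta> * (s \<bullet> (\<chi> i. 1))\<^sup>2" for s
  proof -
    have "expectation (\<lambda>X. (s \<bullet> F X)\<^sup>2) = expectation (\<lambda>X. \<Sum>i\<in>UNIV. \<Sum>j\<in>UNIV. (s $ i * s $ j) * (F X $ i * F X $ j))"
      by (simp add: inner_vec_def power2_eq_square sum_product mult_ac)
    also have "\<dots> = (\<Sum>i\<in>UNIV. \<Sum>j\<in>UNIV. (s $ i * s $ j) * (if i = j then \<alpha> else \<beta>))"
      using i2 \<alpha>\<beta> by simp
    also have "\<dots> = (\<Sum>i\<in>UNIV. \<Sum>j\<in>UNIV. (if j = i then (\<alpha> - \<beta>) * (s $ i * s $ i) else 0) + \<beta> * (s $ i * s $ j))"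
      by (intro sum.cong refl) (auto simp: algebra_simps)
    also have "\<dots> = (\<alpha> - \<beta>) * (s \<bullet> s) + \<beta> * (s \<bullet> (\<chi> i. 1))\<^sup>2"
      unfolding sum.distrib inner_vec_def power2_eq_square sum_product by (simp add: sum_distrib_left)
    finally show ?thesis .
  qed
  show thesis
  proof (rule that[of "\<alpha> - \<mu>\<^sup>2" "\<beta> - \<mu>\<^sup>2"])
    fix s
    have "\<bar>s \<bullet> F X\<bar> \<le> norm s * norm X" for X
      using Cauchy_Schwarz_ineq2[of s "F X"] mult_left_mono[OF le[of X], of "norm s"] by simp
    then have "variance (\<lambda>X. s \<bullet> F X) = expectation (\<lambda>X. (s \<bullet> F X)\<^sup>2) - (expectation (\<lambda>X. s \<bullet> F X))\<^sup>2"
      by (intro variance_bdd[where c="norm s"]) auto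
    then show "variance (\<lambda>X. s \<bullet> F X) = ((\<alpha> - \<mu>\<^sup>2) - (\<beta> - \<mu>\<^sup>2)) * (s \<bullet> s) + (\<beta> - \<mu>\<^sup>2) * (s \<bullet> (\<chi> i. 1))\<^sup>2"
      unfolding E1 E2 by (simp add: power2_eq_square algebra_simps)
  next
    have "expectation (\<lambda>X. (norm (F X))\<^sup>2) = (\<Sum>i\<in>UNIV. expectation (\<lambda>X. F X $ i * F X $ i))"
      using i2 by (simp add: power2_norm_eq_inner inner_vec_def)
    also have "\<dots> = CARD('n) * \<alpha>" by (simp add: \<alpha>\<beta>)
    finally have n: "expectation (\<lambda>X. (norm (F X))\<^sup>2) = CARD('n) * \<alpha>" .
    have "expectation (\<lambda>X. F X \<bullet> (\<chi> i. 1)) = CARD('n) * \<mu>"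
      using i1 \<mu> by (simp add: inner_vec_def)
    then show "expectation (\<lambda>X. (norm (F X))\<^sup>2) - (expectation (\<lambda>X. F X \<bullet> (\<chi> i. 1)))\<^sup>2 / CARD('n) = CARD('n) * (\<alpha> - \<mu>\<^sup>2)"
      unfolding n by (simp add: power2_eq_square field_simps)
  qed
qed

lemma invariant_law_integral:
  fixes M :: "'n::finite cmat measure" and g :: "'n cmat \<Rightarrow> 'b::{banach, second_countable_topology}"
  assumes "invariant_law M" "sets M = sets borel" "unitary U" and [measurable]: "g \<in> borel_measurable borel"
  shows "(\<integral>X. g (uconj U X) \<partial>M) = integral\<^sup>L M g"
proof -
  note [measurable_cong] = assms(2)
  have "integral\<^sup>L M g = integral\<^sup>L (distr M borel (uconj U)) g"
    using assms by (simp add: invariant_law_def)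
  also have "\<dots> = (\<integral>X. g (uconj U X) \<partial>M)" by (rule integral_distr) measurable
  finally show ?thesis by simp
qed

text \<open>Conjugation by permutation, phase and two-coordinate rotation matrices determines all second
  moments, so that neither Haar measure nor diagonalisation is needed.\<close>

locale bounded_invariant_law = bounded_law M for M :: "'n::finite cmat measure" +
  assumes inv: "invariant_law M" and herm_AE: "AE X in M. herm X"
begin

lemma entry_integrable: "integrable M (\<lambda>X. X $ i $ j)"
  by (rule integrable_bdd1[where c=1]) (auto simp: norm_component_cmat_le)

lemma entry2_integrable: "integrable M (\<lambda>X. X $ i $ j * X $ k $ l)"
  by (rule integrable_bdd2[where c=1 and d=1]) (auto simp: norm_component_cmat_le)

lemma Re_Im_entry_le: "\<bar>Re (X $ i $ j)\<bar> \<le> 1 * norm X" "\<bar>Im (X $ i $ j)\<bar> \<le> 1 * norm X" for X :: "'n cmat"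
  using abs_Re_le_cmod[of "X $ i $ j"] abs_Im_le_cmod[of "X $ i $ j"] norm_component_cmat_le[of X i j] by auto

text \<open>Conjugation by \<open>phase_mat p\<close> multiplies the product by \<i>^d, where d is
  the number of occurrences of p among the row indices i, k minus that among the column indices j,
  l. As \<bar>d\<bar> \<le> 2, any nonzero d gives a factor other than 1; a phase -1 would miss d =
  2.\<close>

lemma mixed_moment_zero:
  assumes "\<not> (i = j \<and> k = l)" "\<not> (i = l \<and> k = j)"
  shows "expectation (\<lambda>X. X $ i $ j * X $ k $ l) = 0"
proof -
  define ph where "ph p = (if i = p then \<i> else 1) * (if j = p then - \<i> else 1) *
      ((if k = p then \<i> else 1) * (if l = p then - \<i> else (1::complex)))" for p
  have eq: "expectation (\<lambda>X. X $ i $ j * X $ k $ l) = ph p * expectation (\<lambda>X. X $ i $ j * X $ k $ l)" for p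
  proof -
    have "expectation (\<lambda>X. X $ i $ j * X $ k $ l) =
        expectation (\<lambda>X. uconj (phase_mat p) X $ i $ j * uconj (phase_mat p) X $ k $ l)"
      by (rule invariant_law_integral[OF inv sets_M unitary_phase_mat, where g="\<lambda>X. X $ i $ j * X $ k $ l", symmetric]) simp
    also have "\<dots> = expectation (\<lambda>X. ph p * (X $ i $ j * X $ k $ l))"
      unfolding uconj_phase_mat ph_def by (simp add: mult_ac)
    finally show ?thesis by simp
  qed
  \<comment> \<open>If i is matched by no column index, p = i has d equal to 1 or 2. If i is matched
    by one of them, the other column index differs from k by assumption, and p = k has d =
    1.\<close>
  have "\<exists>p. ph p \<noteq> 1"
  proof (cases "i \<noteq> j \<and> i \<noteq> l")
    case True
    then have "ph i \<noteq> 1" by (auto simp: ph_def complex_eq_iff)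
    then show ?thesis ..
  next
    case False
    then have "ph k \<noteq> 1" using assms by (auto simp: ph_def complex_eq_iff)
    then show ?thesis ..
  qed
  then obtain p where "ph p \<noteq> 1" ..
  moreover have "(1 - ph p) * expectation (\<lambda>X. X $ i $ j * X $ k $ l) = 0"
    unfolding left_diff_distrib using eq[of p] by (simp only: mult_1_left right_minus_eq)
  ultimately show ?thesis by (simp only: mult_eq_0_iff) simp
qed

lemma off_diagonal_mean:
  assumes "i \<noteq> j" shows "expectation (\<lambda>X. X $ i $ j) = 0"
proof -
  have "expectation (\<lambda>X. X $ i $ j) = expectation (\<lambda>X. uconj (phase_mat i) X $ i $ j)"
    by (rule invariant_law_integral[OF inv sets_M unitary_phase_mat, where g="\<lambda>X. X $ i $ j", symmetric]) simp
  also have "\<dots> = \<i> * expectation (\<lambda>X. X $ i $ j)" unfolding uconj_phase_mat using assms by simp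
  finally have "(1 - \<i>) * expectation (\<lambda>X. X $ i $ j) = 0" by (simp add: algebra_simps)
  moreover have "1 - \<i> \<noteq> 0" by (simp add: complex_eq_iff)
  ultimately show ?thesis by simp
qed

text \<open>Permutations reduce the diagonal moments to \<alpha> and \<beta>, rotations express
  off-diagonal moments through them as E \<bar>X_ij\<bar>^2 = \<alpha> - \<beta>, and phases kill
  every unpaired product. The second identity counts N centred diagonal variances a and N (N - 1)
  off-diagonal moments a - b.\<close>

theorem invariant_variance:
  obtains a b :: real where
    "\<And>S. herm S \<Longrightarrow> variance (\<lambda>X. S \<bullet> X) = (a - b) * (norm S)\<^sup>2 + b * (Re (mtrace S))\<^sup>2"
    "expectation (\<lambda>X. (norm X)\<^sup>2) - (expectation (\<lambda>X. Re (mtrace X)))\<^sup>2 / CARD('n)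
       = CARD('n) * a + CARD('n) * (real CARD('n) - 1) * (a - b)"
proof -
  let ?d = "\<lambda>X i. Re (X $ i $ i) :: real"
  have perm: "expectation (\<lambda>X. g (\<lambda>i. ?d X (p i))) = expectation (\<lambda>X. g (?d X))"
    if "p permutes UNIV" "(\<lambda>X. g (?d X)) \<in> borel_measurable borel" for p and g :: "('n \<Rightarrow> real) \<Rightarrow> real"
    using invariant_law_integral[OF inv sets_M unitary_perm_mat[OF that(1)] that(2)] by (simp add: uconj_perm_mat)
  define \<mu> where "\<mu> = expectation (\<lambda>X. ?d X undefined)"
  have \<mu>: "expectation (\<lambda>X. ?d X i) = \<mu>" for i
    using perm[of "Transposition.transpose undefined i" "\<lambda>v. v undefined"] by (simp add: permutes_swap_id \<mu>_def)
  have "expectation (\<lambda>X. ?d X (p i) * ?d X (p j)) = expectation (\<lambda>X. ?d X i * ?d X j)" if "p permutes UNIV" for p i j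
    using perm[OF that, of "\<lambda>v. v i * v j"] by simp
  then obtain \<alpha> \<beta> where \<alpha>\<beta>: "\<And>i j. expectation (\<lambda>X. ?d X i * ?d X j) = (if i = j then \<alpha> else \<beta>)"
    using exists_pair_const[of "\<lambda>i j. expectation (\<lambda>X. ?d X i * ?d X j)"] by blast
  have id: "integrable M (\<lambda>X. ?d X i * ?d X j)" for i j
    by (rule integrable_bdd2[where c=1 and d=1]) (use Re_Im_entry_le in auto)
  \<comment> \<open>With x the mean of the two diagonal entries and y = Re(cnj w X_ij), the
    rotations by w and -w turn the diagonal entry into x + y and x - y, both of second moment
    \<alpha>. As E x^2 = (\<alpha> + \<beta>) / 2, the rest is (\<alpha> - \<beta>) / 2.\<close>
  have half: "expectation (\<lambda>X. (Re (cnj w * X $ i $ j))\<^sup>2) = (\<alpha> - \<beta>) / 2" if ij: "i \<noteq> j" and w: "w * cnj w = 1" for i j w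
  proof -
    let ?x = "\<lambda>X. (?d X i + ?d X j) / 2" and ?y = "\<lambda>X. Re (cnj w * X $ i $ j)"
    have cw: "cmod w = 1"
      using w by (metis complex_norm_square mult.commute norm_ge_zero norm_one of_real_eq_1_iff power2_eq_1_iff abs_norm_cancel abs_1 abs_minus_cancel)
    have yle: "norm (?y X) \<le> 1 * norm X" for X
      using abs_Re_le_cmod[of "cnj w * X $ i $ j"] norm_component_cmat_le[of X i j] by (simp add: norm_mult cw)
    have xle: "norm (?x X) \<le> 1 * norm X" for X
      using Re_Im_entry_le(1)[of X i i] Re_Im_entry_le(1)[of X j j] abs_triangle_ineq[of "?d X i" "?d X j"] by simp
    have rot: "expectation (\<lambda>X. (?x X + Re (cnj v * X $ i $ j))\<^sup>2) = \<alpha>" if v: "v * cnj v = 1" for v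
    proof -
      have "\<alpha> = expectation (\<lambda>X. (?d X i)\<^sup>2)" using \<alpha>\<beta>[of i i] by (simp add: power2_eq_square)
      also have "\<dots> = expectation (\<lambda>X. (?d (uconj (rot_mat i j v) X) i)\<^sup>2)"
        by (rule invariant_law_integral[OF inv sets_M unitary_rot_mat[OF ij v], where g="\<lambda>X. (?d X i)\<^sup>2", symmetric]) simp
      also have "\<dots> = expectation (\<lambda>X. (?x X + Re (cnj v * X $ i $ j))\<^sup>2)"
      proof (rule integral_cong_AE)
        show "AE X in M. (?d (uconj (rot_mat i j v) X) i)\<^sup>2 = (?x X + Re (cnj v * X $ i $ j))\<^sup>2"
          using herm_AE by eventually_elim (simp only: uconj_rot_mat[OF ij v])
      qed measurable
      finally show ?thesis by simp
    qed
    have m: "expectation (\<lambda>X. (?x X - ?y X)\<^sup>2) = \<alpha>"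
      using rot[of "- w"] w by (simp only: complex_cnj_minus mult_minus_left mult_minus_right minus_minus uminus_complex.sel add_uminus_conv_diff)
    have "expectation (\<lambda>X. (?y X)\<^sup>2) = \<alpha> - expectation (\<lambda>X. ?x X * ?x X)"
      by (rule second_moment_parallelogram[OF _ _ xle yle rot[OF w] m]) simp_all
    moreover have "expectation (\<lambda>X. ?x X * ?x X) = (\<alpha> + \<beta>) / 2"
    proof -
      have "?x X * ?x X = (?d X i * ?d X i + ?d X j * ?d X j + 2 * (?d X i * ?d X j)) / 4" for X
        by (simp add: field_simps)
      then have "expectation (\<lambda>X. ?x X * ?x X) = expectation (\<lambda>X. (?d X i * ?d X i + ?d X j * ?d X j + 2 * (?d X i * ?d X j)) / 4)" by (simp only:)
      also have "\<dots> = (\<alpha> + \<alpha> + 2 * \<beta>) / 4" using id \<alpha>\<beta> ij by simp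
      finally show ?thesis by simp
    qed
    ultimately show ?thesis by (simp only:) (simp add: field_simps)
  qed
  have off: "expectation (\<lambda>X. (cmod (X $ i $ j))\<^sup>2) = \<alpha> - \<beta>" if ij: "i \<noteq> j" for i j
  proof -
    have "integrable M (\<lambda>X. (Re (X $ i $ j))\<^sup>2)" "integrable M (\<lambda>X. (Im (X $ i $ j))\<^sup>2)"
      unfolding power2_eq_square by (rule integrable_bdd2[where c=1 and d=1]; use Re_Im_entry_le[of _ i j] in simp)+
    then have "expectation (\<lambda>X. (cmod (X $ i $ j))\<^sup>2) = expectation (\<lambda>X. (Re (X $ i $ j))\<^sup>2) + expectation (\<lambda>X. (Im (X $ i $ j))\<^sup>2)"
      by (simp add: cmod_power2)
    also have "\<dots> = \<alpha> - \<beta>" using half[OF ij, of 1] half[OF ij, of \<i>] by simp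
    finally show ?thesis .
  qed
  have real_diag: "AE X in M. X $ i $ i = of_real (?d X i)" for i
    using herm_AE by eventually_elim (metis Reals_cnj_iff herm_cnj of_real_Re)
  have mom: "expectation (\<lambda>X. X $ i $ j * X $ k $ l) =
      (if i = j \<and> k = l then of_real \<beta> else 0) + (if i = l \<and> k = j then of_real (\<alpha> - \<beta>) else 0)" for i j k l
  proof (cases "i = j \<and> k = l")
    case True
    have "expectation (\<lambda>X. X $ i $ j * X $ k $ l) = expectation (\<lambda>X. complex_of_real (?d X i * ?d X k))"
      by (rule integral_cong_AE) (use real_diag[of i] real_diag[of k] True in \<open>auto elim!: eventually_elim2\<close>)
    also have "\<dots> = of_real (if i = k then \<alpha> else \<beta>)" by (simp only: integral_complex_of_real \<alpha>\<beta>)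
    finally have e: "expectation (\<lambda>X. X $ i $ j * X $ k $ l) = of_real (if i = k then \<alpha> else \<beta>)" .
    have ij: "j = i" "l = k" using True by simp_all
    show ?thesis unfolding e unfolding ij by (cases "i = k") simp_all
  next
    case F: False
    show ?thesis
    proof (cases "i = l \<and> k = j")
      case True
      have "expectation (\<lambda>X. X $ i $ j * X $ k $ l) = expectation (\<lambda>X. complex_of_real ((cmod (X $ i $ j))\<^sup>2))"
      proof (rule integral_cong_AE)
        show "AE X in M. X $ i $ j * X $ k $ l = complex_of_real ((cmod (X $ i $ j))\<^sup>2)"
          using herm_AE
        proof eventually_elim
          case (elim X)
          have ij: "k = j" "l = i" using True by simp_all
          show ?case unfolding ij complex_norm_square herm_cnj[OF elim] ..
        qed
      qed measurable
      also have "\<dots> = of_real (\<alpha> - \<beta>)"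
      proof -
        have "i \<noteq> j" using F True by auto
        from off[OF this] show ?thesis by (simp only: integral_complex_of_real)
      qed
      finally have e: "expectation (\<lambda>X. X $ i $ j * X $ k $ l) = of_real (\<alpha> - \<beta>)" .
      have "\<not> (i = j \<and> k = l)" "i = l \<and> k = j" using F True by blast+
      then show ?thesis unfolding e by simp
    next
      case False
      show ?thesis unfolding mixed_moment_zero[OF F False] if_not_P[OF F] if_not_P[OF False] by simp
    qed
  qed
  have E2: "expectation (\<lambda>X. (S \<bullet> X)\<^sup>2) = (\<alpha> - \<beta>) * (norm S)\<^sup>2 + \<beta> * (Re (mtrace S))\<^sup>2" if S: "herm S" for S
  proof -
    \<comment> \<open>For Hermitian S and X the complex sum is already real, so it can be squared
      and expanded without taking real parts.\<close>
    have c: "complex_of_real (S \<bullet> X) = (\<Sum>i\<in>UNIV. \<Sum>j\<in>UNIV. cnj (S $ i $ j) * X $ i $ j)" if X: "herm X" for X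
    proof -
      let ?c = "\<Sum>i\<in>UNIV. \<Sum>j\<in>UNIV. cnj (S $ i $ j) * X $ i $ j"
      have "cnj ?c = (\<Sum>i\<in>UNIV. \<Sum>j\<in>UNIV. cnj (S $ j $ i) * X $ j $ i)"
        by (simp add: herm_cnj[OF S] herm_cnj[OF X])
      also have "\<dots> = ?c" by (rule sum.swap)
      finally have "?c \<in> \<real>" by (simp only: Reals_cnj_iff)
      then have "of_real (Re ?c) = ?c" by (rule of_real_Re)
      moreover have "Re ?c = S \<bullet> X" by (simp add: inner_cmat)
      ultimately show ?thesis by (simp only:)
    qed
    have "complex_of_real (expectation (\<lambda>X. (S \<bullet> X)\<^sup>2)) = expectation (\<lambda>X. complex_of_real ((S \<bullet> X)\<^sup>2))"
      by (simp only: integral_complex_of_real)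
    also have "\<dots> = expectation (\<lambda>X. \<Sum>i\<in>UNIV. \<Sum>j\<in>UNIV. \<Sum>k\<in>UNIV. \<Sum>l\<in>UNIV. cnj (S $ i $ j) * cnj (S $ k $ l) * (X $ i $ j * X $ k $ l))"
    proof (rule integral_cong_AE)
      show "AE X in M. complex_of_real ((S \<bullet> X)\<^sup>2) = (\<Sum>i\<in>UNIV. \<Sum>j\<in>UNIV. \<Sum>k\<in>UNIV. \<Sum>l\<in>UNIV. cnj (S $ i $ j) * cnj (S $ k $ l) * (X $ i $ j * X $ k $ l))"
        using herm_AE
      proof eventually_elim
        case (elim X)
        have "complex_of_real ((S \<bullet> X)\<^sup>2) = (\<Sum>i\<in>UNIV. \<Sum>j\<in>UNIV. cnj (S $ i $ j) * X $ i $ j * (\<Sum>k\<in>UNIV. \<Sum>l\<in>UNIV. cnj (S $ k $ l) * X $ k $ l))"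
          by (simp only: power2_eq_square of_real_mult c[OF elim] sum_distrib_right)
        also have "\<dots> = (\<Sum>i\<in>UNIV. \<Sum>j\<in>UNIV. \<Sum>k\<in>UNIV. \<Sum>l\<in>UNIV. cnj (S $ i $ j) * cnj (S $ k $ l) * (X $ i $ j * X $ k $ l))"
          unfolding sum_distrib_left by (intro sum.cong refl) (rule mult_swap)
        finally show ?case .
      qed
    qed measurable
    also have "\<dots> = (\<Sum>i\<in>UNIV. \<Sum>j\<in>UNIV. \<Sum>k\<in>UNIV. \<Sum>l\<in>UNIV. cnj (S $ i $ j) * cnj (S $ k $ l) * expectation (\<lambda>X. X $ i $ j * X $ k $ l))"
      using entry2_integrable by simp
    also have "\<dots> = of_real \<beta> * (\<Sum>i\<in>UNIV. cnj (S $ i $ i))\<^sup>2 + of_real (\<alpha> - \<beta>) * (\<Sum>i\<in>UNIV. \<Sum>j\<in>UNIV. cnj (S $ i $ j) * cnj (S $ j $ i))"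
      unfolding mom by (rule sum_pairings)
    also have "(\<Sum>i\<in>UNIV. cnj (S $ i $ i)) = of_real (Re (mtrace S))"
    proof -
      have "cnj (S $ i $ i) = of_real (?d S i)" for i
        using herm_cnj[OF S, of i i] by (metis Reals_cnj_iff of_real_Re)
      then show ?thesis by (simp only: mtrace_def Re_sum of_real_sum)
    qed
    also have "(\<Sum>i\<in>UNIV. \<Sum>j\<in>UNIV. cnj (S $ i $ j) * cnj (S $ j $ i)) = of_real ((norm S)\<^sup>2)"
      unfolding norm_cmat_square of_real_sum complex_norm_square herm_cnj[OF S] by (simp only: mult.commute)
    finally have "complex_of_real (expectation (\<lambda>X. (S \<bullet> X)\<^sup>2)) = of_real ((\<alpha> - \<beta>) * (norm S)\<^sup>2 + \<beta> * (Re (mtrace S))\<^sup>2)"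
      by (simp add: add.commute)
    then show ?thesis by (simp only: of_real_eq_iff)
  qed
  have E1: "expectation (\<lambda>X. S \<bullet> X) = \<mu> * Re (mtrace S)" for S :: "'n cmat"
  proof -
    have "expectation (\<lambda>X. S \<bullet> X) = (\<Sum>i\<in>UNIV. \<Sum>j\<in>UNIV. expectation (\<lambda>X. Re (cnj (S $ i $ j) * X $ i $ j)))"
    proof -
      have "integrable M (\<lambda>X. Re (cnj (S $ i $ j) * X $ i $ j))" for i j
        by (rule integrable_Re[OF integrable_mult_right[OF entry_integrable]])
      then show ?thesis unfolding inner_cmat by (simp only: Bochner_Integration.integral_sum Bochner_Integration.integrable_sum)
    qed
    also have "\<dots> = (\<Sum>i\<in>UNIV. \<Sum>j\<in>UNIV. Re (cnj (S $ i $ j) * expectation (\<lambda>X. X $ i $ j)))"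
      by (simp only: integral_Re[OF integrable_mult_right[OF entry_integrable]] integral_mult_right_zero)
    also have "\<dots> = (\<Sum>i\<in>UNIV. \<Sum>j\<in>UNIV. if j = i then \<mu> * ?d S i else 0)"
    proof (intro sum.cong refl)
      fix i j
      have "expectation (\<lambda>X. X $ i $ i) = expectation (\<lambda>X. complex_of_real (?d X i))"
        by (rule integral_cong_AE[OF _ _ real_diag]) simp_all
      also have "\<dots> = of_real \<mu>" by (simp only: integral_complex_of_real \<mu>)
      finally show "Re (cnj (S $ i $ j) * expectation (\<lambda>X. X $ i $ j)) = (if j = i then \<mu> * ?d S i else 0)"
        using off_diagonal_mean[of i j] by (cases "i = j") (simp_all add: mult.commute)
    qed
    also have "\<dots> = \<mu> * Re (mtrace S)" by (simp add: mtrace_def sum_distrib_left)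
    finally show ?thesis .
  qed
  show thesis
  proof (rule that[of "\<alpha> - \<mu>\<^sup>2" "\<beta> - \<mu>\<^sup>2"])
    fix S :: "'n cmat" assume S: "herm S"
    have "variance (\<lambda>X. S \<bullet> X) = expectation (\<lambda>X. (S \<bullet> X)\<^sup>2) - (expectation (\<lambda>X. S \<bullet> X))\<^sup>2"
      by (rule variance_bdd[where c="norm S"]) (auto simp: Cauchy_Schwarz_ineq2)
    then show "variance (\<lambda>X. S \<bullet> X) = ((\<alpha> - \<mu>\<^sup>2) - (\<beta> - \<mu>\<^sup>2)) * (norm S)\<^sup>2 + (\<beta> - \<mu>\<^sup>2) * (Re (mtrace S))\<^sup>2"
      unfolding E1 E2[OF S] by (simp add: power2_eq_square algebra_simps)
  next
    have diag2: "expectation (\<lambda>X. (cmod (X $ i $ i))\<^sup>2) = \<alpha>" for i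
    proof -
      have "expectation (\<lambda>X. (cmod (X $ i $ i))\<^sup>2) = expectation (\<lambda>X. ?d X i * ?d X i)"
      proof (rule integral_cong_AE)
        show "AE X in M. (cmod (X $ i $ i))\<^sup>2 = ?d X i * ?d X i"
          using real_diag[of i] by eventually_elim (metis norm_of_real power2_abs power2_eq_square)
      qed measurable
      then show ?thesis by (simp add: \<alpha>\<beta>)
    qed
    have "integrable M (\<lambda>X. (cmod (X $ i $ j))\<^sup>2)" for i j
      unfolding power2_eq_square by (rule integrable_bdd2[where c=1 and d=1]) (auto simp: norm_component_cmat_le)
    then have "expectation (\<lambda>X. (norm X)\<^sup>2) = (\<Sum>i\<in>UNIV. \<Sum>j\<in>UNIV. expectation (\<lambda>X. (cmod (X $ i $ j))\<^sup>2))"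
      unfolding norm_cmat_square by (simp only: Bochner_Integration.integral_sum Bochner_Integration.integrable_sum)
    also have "\<dots> = (\<Sum>i\<in>(UNIV::'n set). \<Sum>j\<in>(UNIV::'n set). (if j = i then \<beta> else 0) + (\<alpha> - \<beta>))"
      by (intro sum.cong refl) (auto simp: diag2 off)
    also have "\<dots> = CARD('n) * (\<beta> + CARD('n) * (\<alpha> - \<beta>))" by (simp add: sum.distrib)
    finally have n: "expectation (\<lambda>X. (norm X)\<^sup>2) = CARD('n) * (\<beta> + CARD('n) * (\<alpha> - \<beta>))" .
    have "mtrace (mat 1 :: 'n cmat) = of_nat CARD('n)" by (simp add: mtrace_def mat_def)
    then have "expectation (\<lambda>X. Re (mtrace X)) = \<mu> * CARD('n)" using E1[of "mat 1"] by (simp add: mat1_inner)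
    then show "expectation (\<lambda>X. (norm X)\<^sup>2) - (expectation (\<lambda>X. Re (mtrace X)))\<^sup>2 / CARD('n)
       = CARD('n) * (\<alpha> - \<mu>\<^sup>2) + CARD('n) * (real CARD('n) - 1) * ((\<alpha> - \<mu>\<^sup>2) - (\<beta> - \<mu>\<^sup>2))"
      unfolding n by (simp add: power2_eq_square field_simps)
  qed
qed

end

section \<open>Truncation\<close>

text \<open>Cutting off by the norm commutes with every linear isometry, in particular with unitary
  conjugation and coordinate permutations. The division by \<open>R\<close> places the result in the
  unit ball.\<close>

definition trunc :: "real \<Rightarrow> 'a::euclidean_space \<Rightarrow> 'a" where
  "trunc R x = indicator {x. norm x \<le> R} x *\<^sub>R ((1 / R) *\<^sub>R x)"

lemma measurable_trunc [measurable]: "trunc R \<in> borel_measurable borel"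
  unfolding trunc_def[abs_def] by measurable

lemma norm_trunc_le: "R > 0 \<Longrightarrow> norm (trunc R x) \<le> 1"
  by (auto simp: trunc_def divide_simps split: split_indicator)

lemma variance_distr:
  fixes f :: "'b \<Rightarrow> real"
  assumes [measurable]: "F \<in> measurable M N" "f \<in> borel_measurable N"
  shows "prob_space.variance (distr M N F) f = prob_space.variance M (\<lambda>x. f (F x))"
  by (simp add: integral_distr)

text \<open>One norm event serves every \<open>f\<close> that does not increase the norm; the
  instances are the identity and \<open>diag_vec\<close>.\<close>

lemma truncation_self:
  fixes M :: "'a::euclidean_space measure"
  assumes "prob_space M" and sM: "sets M = sets borel" and [measurable]: "f \<in> borel_measurable M"
    and le: "\<And>x. norm (f x) \<le> norm x" and B: "\<And>m. B m > 0"
    and n: "null_array M (\<lambda>m x. (1 / B m) *\<^sub>R x)"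
  shows "truncation M f B (\<lambda>m. {x. norm x \<le> B m})"
proof -
  interpret prob_space M by fact
  note [measurable_cong] = sM
  have sp: "space M = UNIV" using sets_eq_imp_space_eq[OF sM] by simp
  show ?thesis
  proof
    show "{x. norm x \<le> B m} \<in> sets M" for m unfolding sM by measurable
    show "norm (f x) \<le> B m" if "x \<in> {x. norm x \<le> B m}" for m x using that le[of x] by simp
    have lim: "(\<lambda>m. real m * prob {x \<in> space M. norm ((1 / B m) *\<^sub>R x) > 1 / 2}) \<longlonglongrightarrow> 0"
      by (rule n[unfolded null_array_def, rule_format]) simp
    show "(\<lambda>m. real m * prob (space M - {x. norm x \<le> B m})) \<longlonglongrightarrow> 0"
    proof (rule tendsto_sandwich[OF _ _ tendsto_const lim])
      show "eventually (\<lambda>m. real m * prob (space M - {x. norm x \<le> B m}) \<le> real m * prob {x \<in> space M. norm ((1 / B m) *\<^sub>R x) > 1 / 2}) sequentially"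
      proof (rule always_eventually, rule allI, intro mult_left_mono finite_measure_mono)
        fix m
        show "space M - {x. norm x \<le> B m} \<subseteq> {x \<in> space M. norm ((1 / B m) *\<^sub>R x) > 1 / 2}"
          using B[of m] by (auto simp: field_simps)
      qed auto
    qed auto
    show "null_array M (\<lambda>m x. (1 / B m) *\<^sub>R f x)"
    proof (rule null_array_mono_AE[OF prob_space_axioms n, where c=1])
      show "AE x in M. norm ((1 / B m) *\<^sub>R f x) \<le> 1 * norm ((1 / B m) *\<^sub>R x)" for m
        using le B[of m] by (auto simp: divide_right_mono)
    qed auto
  qed (use B in auto)
qed

lemma uconj_trunc: "unitary U \<Longrightarrow> uconj U (trunc R X) = trunc R (uconj U X)"
  by (simp add: trunc_def norm_uconj uconj_scaleR indicator_def)

lemma continuous_on_hadj: "continuous_on UNIV (hadj :: 'n::finite cmat \<Rightarrow> 'n cmat)"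
  unfolding hadj_def[abs_def] by (intro continuous_intros)

lemma measurable_herm [measurable]: "Measurable.pred borel herm"
proof -
  have "closed {X :: 'n::finite cmat. hadj X = X}"
    by (intro closed_Collect_eq continuous_on_hadj continuous_on_id)
  from borel_closed[OF this] show ?thesis unfolding herm_def[abs_def] by (simp add: pred_def)
qed

lemma hadj_scaleR: "hadj (c *\<^sub>R X) = c *\<^sub>R hadj X"
  by (simp add: hadj_def vec_eq_iff)

lemma herm_trunc: "herm X \<Longrightarrow> herm (trunc R X)"
  by (simp add: herm_def trunc_def hadj_scaleR)

lemma bounded_invariant_law_trunc:
  fixes M :: "'n::finite cmat measure"
  assumes M: "herm_law M" "invariant_law M" and R: "R > 0"
  shows "bounded_invariant_law (distr M borel (trunc R))"
proof -
  interpret prob_space M using M by (simp add: herm_law_def)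
  have sM [measurable_cong]: "sets M = sets borel" using M by (simp add: herm_law_def)
  interpret T: prob_space "distr M borel (trunc R)" by (rule prob_space_distr) simp
  show ?thesis
  proof
    show "AE X in distr M borel (trunc R). norm X \<le> 1"
      by (subst AE_distr_iff) (use norm_trunc_le[OF R] in auto)
    show "AE X in distr M borel (trunc R). herm X"
    proof (subst AE_distr_iff)
      show "AE X in M. herm (trunc R X)"
        using M(1) unfolding herm_law_def by (auto elim!: eventually_mono intro: herm_trunc)
    qed auto
    show "invariant_law (distr M borel (trunc R))"
      unfolding invariant_law_def
    proof (intro allI impI)
      fix U :: "'n cmat" assume U: "unitary U"
      have "distr (distr M borel (trunc R)) borel (uconj U) = distr M borel (uconj U \<circ> trunc R)"
        by (rule distr_distr) measurable
      also have "uconj U \<circ> trunc R = trunc R \<circ> uconj U" using uconj_trunc[OF U] by (auto simp: fun_eq_iff)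
      also have "distr M borel (trunc R \<circ> uconj U) = distr (distr M borel (uconj U)) borel (trunc R)"
        by (rule distr_distr[symmetric]) measurable
      also have "distr M borel (uconj U) = M" using M(2) U by (simp only: invariant_law_def)
      finally show "distr (distr M borel (trunc R)) borel (uconj U) = distr M borel (trunc R)" .
    qed
  qed simp
qed

lemma null_array_uconj:
  fixes D :: "nat \<Rightarrow> 'n::finite cmat \<Rightarrow> 'b::euclidean_space"
  assumes "invariant_law M" "sets M = sets borel" "unitary U"
    and [measurable]: "\<And>m. D m \<in> borel_measurable borel" and n: "null_array M D"
  shows "null_array M (\<lambda>m X. D m (uconj U X))"
proof -
  note [measurable_cong] = assms(2)
  have "distr M borel (uconj U) = M" using assms(1,3) by (simp only: invariant_law_def)
  with n have "null_array (distr M borel (uconj U)) D" by (simp only:)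
  then show ?thesis by (subst (asm) null_array_distr) simp_all
qed

lemma norm_vec_le_sum: "norm v \<le> (\<Sum>i\<in>UNIV. norm (v $ i))" for v :: "'c::real_normed_vector^'n::finite"
  by (simp add: norm_vec_def L2_set_le_sum)

text \<open>Every entry of a Hermitian matrix is a linear combination of diagonal entries of unitary
  conjugates, so the tails of the diagonal control those of the whole matrix.\<close>

lemma null_array_diag_imp:
  fixes M :: "'n::finite cmat measure" and B :: "nat \<Rightarrow> real"
  assumes M: "herm_law M" "invariant_law M" and B: "\<And>m. B m > 0"
    and n: "null_array M (\<lambda>m X. (1 / B m) *\<^sub>R diag_vec X)"
  shows "null_array M (\<lambda>m X. (1 / B m) *\<^sub>R X)"
proof -
  have P: "prob_space M" and sM [measurable_cong]: "sets M = sets borel" and hM: "AE X in M. herm X"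
    using M by (auto simp: herm_law_def)
  interpret prob_space M by fact
  have d: "null_array M (\<lambda>m X. c * Re (X $ i $ i) / B m)" for i and c :: real
  proof (rule null_array_mono_AE[OF P n, where c="\<bar>c\<bar> + 1"])
    show "AE X in M. norm (c * Re (X $ i $ i) / B m) \<le> (\<bar>c\<bar> + 1) * norm ((1 / B m) *\<^sub>R diag_vec X)" for m
    proof (rule AE_I2)
      fix X
      have "\<bar>Re (X $ i $ i)\<bar> \<le> norm (diag_vec X)" using component_le_norm_cart[of "diag_vec X" i] by (simp add: diag_vec_def)
      then have "\<bar>c\<bar> * \<bar>Re (X $ i $ i)\<bar> \<le> (\<bar>c\<bar> + 1) * norm (diag_vec X)" by (intro mult_mono) auto
      then have "\<bar>c\<bar> * \<bar>Re (X $ i $ i)\<bar> / B m \<le> (\<bar>c\<bar> + 1) * norm (diag_vec X) / B m" using B[of m] by (intro divide_right_mono) auto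
      then show "norm (c * Re (X $ i $ i) / B m) \<le> (\<bar>c\<bar> + 1) * norm ((1 / B m) *\<^sub>R diag_vec X)"
        using B[of m] by (simp add: abs_mult abs_divide)
    qed
  qed auto
  \<comment> \<open>The rotated diagonal entry minus half of each of the two original ones is Re(cnj
    w X_ij); by invariance the rotated entry has the same tails as the original one.\<close>
  have off: "null_array M (\<lambda>m X. Re (cnj w * X $ i $ j) / B m)" if ij: "i \<noteq> j" and w: "w * cnj w = 1" for i j w
  proof -
    let ?U = "rot_mat i j w"
    have a: "null_array M (\<lambda>m X. 1 * Re (uconj ?U X $ i $ i) / B m)"
      by (rule null_array_uconj[OF M(2) sM unitary_rot_mat[OF ij w] _ d]) measurable
    have b: "null_array M (\<lambda>m X. 1 * Re (uconj ?U X $ i $ i) / B m + (- 1 / 2) * Re (X $ i $ i) / B m)"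
      by (rule null_array_add[OF P a d]) measurable
    have c: "null_array M (\<lambda>m X. (1 * Re (uconj ?U X $ i $ i) / B m + (- 1 / 2) * Re (X $ i $ i) / B m) + (- 1 / 2) * Re (X $ j $ j) / B m)"
      by (rule null_array_add[OF P b d]) measurable
    show ?thesis
    proof (rule null_array_mono_AE[OF P c, where c=1])
      show "AE X in M. norm (Re (cnj w * X $ i $ j) / B m) \<le> 1 *
        norm ((1 * Re (uconj ?U X $ i $ i) / B m + (- 1 / 2) * Re (X $ i $ i) / B m) + (- 1 / 2) * Re (X $ j $ j) / B m)" for m
        using hM
      proof eventually_elim
        case (elim X)
        have "Re (cnj w * X $ i $ j) / B m = (1 * Re (uconj ?U X $ i $ i) / B m + (- 1 / 2) * Re (X $ i $ i) / B m) + (- 1 / 2) * Re (X $ j $ j) / B m"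
          unfolding uconj_rot_mat[OF ij w elim] by (simp add: add_divide_distrib)
        then show ?case by (simp only: mult_1_left order_refl)
      qed
    qed simp_all
  qed
  have entry: "null_array M (\<lambda>m X. cmod (X $ i $ j) / B m)" for i j
  proof -
    have abs: "null_array M (\<lambda>m X. norm (D m X))" if "null_array M D" for D :: "nat \<Rightarrow> 'n cmat \<Rightarrow> real"
      using that by (simp add: null_array_def)
    show ?thesis
    proof (cases "i = j")
      case True
      have d1: "null_array M (\<lambda>m X. 1 * Re (X $ i $ i) / B m)" by (rule d)
      show ?thesis
      proof (rule null_array_mono_AE[OF P d1, where c=1])
        show "AE X in M. norm (cmod (X $ i $ j) / B m) \<le> 1 * norm (1 * Re (X $ i $ i) / B m)" for m
          using hM
        proof eventually_elim
          case (elim X)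
          have "Im (X $ i $ i) = 0" using herm_cnj[OF elim, of i i] by (simp only: Reals_cnj_iff[symmetric] complex_is_Real_iff)
          then have "cmod (X $ i $ i) = \<bar>Re (X $ i $ i)\<bar>" by (simp add: cmod_eq_Re)
          then show ?case using True by (simp add: abs_divide)
        qed
      qed auto
    next
      case False
      have s: "null_array M (\<lambda>m X. norm (Re (cnj 1 * X $ i $ j) / B m) + norm (Re (cnj \<i> * X $ i $ j) / B m))"
        by (rule null_array_add[OF P abs[OF off[OF False]] abs[OF off[OF False]]]) simp_all
      show ?thesis
      proof (rule null_array_mono_AE[OF P s, where c=1])
        show "AE X in M. norm (cmod (X $ i $ j) / B m) \<le> 1 * norm (norm (Re (cnj 1 * X $ i $ j) / B m) + norm (Re (cnj \<i> * X $ i $ j) / B m))" for m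
        proof (rule AE_I2)
          fix X :: "'n cmat"
          have "cmod (X $ i $ j) / B m \<le> (\<bar>Re (X $ i $ j)\<bar> + \<bar>Im (X $ i $ j)\<bar>) / B m"
            using cmod_le[of "X $ i $ j"] B[of m] by (intro divide_right_mono) auto
          then show "norm (cmod (X $ i $ j) / B m) \<le> 1 * norm (norm (Re (cnj 1 * X $ i $ j) / B m) + norm (Re (cnj \<i> * X $ i $ j) / B m))"
            using B[of m] by (simp add: abs_divide add_divide_distrib)
        qed
      qed auto
    qed
  qed
  have "null_array M (\<lambda>m X. \<Sum>i\<in>UNIV. \<Sum>j\<in>UNIV. cmod (X $ i $ j) / B m)"
    by (intro null_array_sum[OF P] entry) auto
  then show ?thesis
  proof (rule null_array_mono_AE[OF P, where c=1])
    show "AE X in M. norm ((1 / B m) *\<^sub>R X) \<le> 1 * norm (\<Sum>i\<in>UNIV. \<Sum>j\<in>UNIV. cmod (X $ i $ j) / B m)" for m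
    proof (rule AE_I2)
      fix X :: "'n cmat"
      have "norm X \<le> (\<Sum>i\<in>UNIV. \<Sum>j\<in>UNIV. cmod (X $ i $ j))"
        by (rule order_trans[OF norm_vec_le_sum sum_mono[OF norm_vec_le_sum]])
      then have "norm X / B m \<le> (\<Sum>i\<in>UNIV. \<Sum>j\<in>UNIV. cmod (X $ i $ j)) / B m"
        using B[of m] by (intro divide_right_mono) auto
      also have "\<dots> = (\<Sum>i\<in>UNIV. \<Sum>j\<in>UNIV. cmod (X $ i $ j) / B m)" by (simp add: sum_divide_distrib)
      finally have "norm X / B m \<le> (\<Sum>i\<in>UNIV. \<Sum>j\<in>UNIV. cmod (X $ i $ j) / B m)" .
      then show "norm ((1 / B m) *\<^sub>R X) \<le> 1 * norm (\<Sum>i\<in>UNIV. \<Sum>j\<in>UNIV. cmod (X $ i $ j) / B m)"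
        using B[of m] by simp
    qed
  qed auto
qed

section \<open>The two variance parameters and their recovery from limits\<close>

lemma card_1_sum: "CARD('n::finite) = 1 \<Longrightarrow> sum f (UNIV::'n set) = f i"
proof -
  assume "CARD('n) = 1"
  then obtain a where a: "(UNIV :: 'n set) = {a}" by (rule card_1_singletonE)
  then have "i = a" by (metis UNIV_I singletonD)
  then show ?thesis unfolding a by simp
qed

text \<open>In dimension one \<open>s \<bullet> s = (s \<bullet> ones)\<^sup>2\<close>, so only the sum of the two parameters is determined.\<close>

definition params_tendsto :: "'n::finite itself \<Rightarrow> (nat \<Rightarrow> real) \<Rightarrow> (nat \<Rightarrow> real) \<Rightarrow> real \<Rightarrow> real \<Rightarrow> bool" where
  "params_tendsto _ x y u v \<longleftrightarrow> (if CARD('n) = 1 then (\<lambda>m. x m + y m) \<longlonglongrightarrow> u + v else x \<longlonglongrightarrow> u \<and> y \<longlonglongrightarrow> v)"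

text \<open>Here p and q are the values of the two basic quadratic forms; they coincide in dimension
  one, where only the sum of the coefficients converges.\<close>

lemma params_tendsto_imp:
  assumes "params_tendsto TYPE('n::finite) x y u v" "CARD('n) = 1 \<Longrightarrow> q = (p::real)"
  shows "(\<lambda>m. x m * p + y m * q) \<longlonglongrightarrow> u * p + v * q"
proof (cases "CARD('n) = 1")
  case True
  then have "(\<lambda>m. (x m + y m) * p) \<longlonglongrightarrow> (u + v) * p" using assms(1) by (intro tendsto_mult_right) (simp add: params_tendsto_def)
  then show ?thesis using assms(2)[OF True] by (simp add: algebra_simps)
next
  case False
  then show ?thesis using assms(1) by (intro tendsto_intros) (simp_all add: params_tendsto_def)
qed

abbreviation ones :: "real^'n::finite" where "ones \<equiv> (\<chi> i. 1)"

lemma inner_ones: "(ones :: real^'n::finite) \<bullet> ones = real CARD('n)"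
  by (simp add: inner_vec_def)

section \<open>The law of the eigenvalue vector\<close>

text \<open>A coordinate vector tests x + y and the vector of ones tests N x + N^2 y. The
  determinant N (N - 1) vanishes exactly for N = 1.\<close>

lemma params_tendsto_diag:
  fixes x y :: "nat \<Rightarrow> real"
  assumes lim: "\<And>s::real^'n::finite. (\<lambda>m. x m * (s \<bullet> s) + y m * (s \<bullet> ones)\<^sup>2) \<longlonglongrightarrow> u * (s \<bullet> s) + v * (s \<bullet> ones)\<^sup>2"
  shows "params_tendsto TYPE('n) x y u v"
proof -
  define n where "n = real CARD('n)"
  have ax: "(axis (undefined::'n) (1::real)) \<bullet> ones = 1" by (simp add: inner_axis')
  have 1: "(\<lambda>m. x m + y m) \<longlonglongrightarrow> u + v"
    using lim[of "axis undefined 1"] by (simp add: ax inner_axis_axis)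
  have 2: "(\<lambda>m. n * x m + n\<^sup>2 * y m) \<longlonglongrightarrow> n * u + n\<^sup>2 * v"
    using lim[of ones] by (simp add: inner_ones n_def mult.commute)
  show ?thesis
  proof (cases "CARD('n) = 1")
    case False
    then have n1: "n \<noteq> 1" "n > 0" by (auto simp: n_def)
    have "(\<lambda>m. ((n * x m + n\<^sup>2 * y m) - n * (x m + y m)) / (n * (n - 1))) \<longlonglongrightarrow> ((n * u + n\<^sup>2 * v) - n * (u + v)) / (n * (n - 1))"
      using n1 by (intro tendsto_intros 1 2) auto
    moreover have "((n * p + n\<^sup>2 * q) - n * (p + q)) / (n * (n - 1)) = q" for p q
      using n1 by (simp add: field_simps power2_eq_square)
    ultimately have y: "y \<longlonglongrightarrow> v" by simp
    from tendsto_diff[OF 1 y] have "x \<longlonglongrightarrow> u" by simp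
    with y False show ?thesis by (simp add: params_tendsto_def)
  qed (use 1 in \<open>simp add: params_tendsto_def\<close>)
qed

text \<open>A coordinate vector now tests N x + y, while the vector of ones again tests N x + N^2 y;
  subtraction isolates (N^2 - 1) y.\<close>

lemma params_tendsto_eig:
  fixes x y :: "nat \<Rightarrow> real"
  assumes lim: "\<And>s::real^'n::finite. (\<lambda>m. (real CARD('n) + 1) * x m * (s \<bullet> s) + (y m - x m) * (s \<bullet> ones)\<^sup>2)
      \<longlonglongrightarrow> (real CARD('n) + 1) * u * (s \<bullet> s) + (v - u) * (s \<bullet> ones)\<^sup>2"
  shows "params_tendsto TYPE('n) x y u v"
proof -
  define n where "n = real CARD('n)"
  have n0: "n > 0" by (simp add: n_def)
  have ax: "(axis (undefined::'n) (1::real)) \<bullet> ones = 1" by (simp add: inner_axis')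
  have 1: "(\<lambda>m. n * x m + y m) \<longlonglongrightarrow> n * u + v"
    using lim[of "axis undefined 1"] by (simp add: ax inner_axis_axis n_def algebra_simps)
  have 2: "(\<lambda>m. n * x m + n\<^sup>2 * y m) \<longlonglongrightarrow> n * u + n\<^sup>2 * v"
  proof -
    have "(n + 1) * p * n + (q - p) * n\<^sup>2 = n * p + n\<^sup>2 * q" for p q by (simp add: algebra_simps power2_eq_square)
    then show ?thesis using lim[of ones] unfolding inner_ones n_def[symmetric] by simp
  qed
  show ?thesis
  proof (cases "CARD('n) = 1")
    case False
    moreover have "CARD('n) > 0" by (rule zero_less_card_finite)
    ultimately have "CARD('n) > 1" by linarith
    then have n1: "n > 1" by (simp add: n_def)
    then have d: "n\<^sup>2 - 1 > 0" by (simp add: power2_eq_square less_1_mult)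
    have "(\<lambda>m. ((n * x m + n\<^sup>2 * y m) - (n * x m + y m)) / (n\<^sup>2 - 1)) \<longlonglongrightarrow> ((n * u + n\<^sup>2 * v) - (n * u + v)) / (n\<^sup>2 - 1)"
      using d by (intro tendsto_intros 1 2) auto
    moreover have "((n * p + n\<^sup>2 * q) - (n * p + q)) / (n\<^sup>2 - 1) = q" for p q
      using d by (simp add: field_simps)
    ultimately have y: "y \<longlonglongrightarrow> v" by simp
    have "(\<lambda>m. (n * x m + y m - y m) / n) \<longlonglongrightarrow> (n * u + v - v) / n" using n0 by (intro tendsto_intros 1 y) auto
    with n0 have "x \<longlonglongrightarrow> u" by simp
    with y False show ?thesis by (simp add: params_tendsto_def)
  next
    case True
    then have "n = 1" by (simp add: n_def)
    with 1 True show ?thesis by (simp add: params_tendsto_def)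
  qed
qed

lemma norm_perm_vec: "p permutes UNIV \<Longrightarrow> norm (perm_vec p v) = norm v"
  using sum.permute[of p UNIV "\<lambda>i. (v $ i)\<^sup>2"] by (simp add: norm_vec_def L2_set_def perm_vec_def comp_def)

lemma perm_vec_inner_ones: "p permutes UNIV \<Longrightarrow> perm_vec p v \<bullet> ones = v \<bullet> ones"
  using sum.permute[of p UNIV "\<lambda>i. v $ i"] by (simp add: inner_vec_def perm_vec_def comp_def)

lemma trunc_perm_vec: "p permutes UNIV \<Longrightarrow> perm_vec p (trunc R v) = trunc R (perm_vec p v)"
  by (simp add: trunc_def norm_perm_vec indicator_def) (simp add: perm_vec_def vec_eq_iff)

section \<open>Uniformly random permutations and exchangeability\<close>

abbreviation perms :: "('n::finite \<Rightarrow> 'n) measure" where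
  "perms \<equiv> uniform_count_measure {p. p permutes UNIV}"

lemma finite_perms: "finite {p :: 'n::finite \<Rightarrow> 'n. p permutes UNIV}"
  by simp

lemma perms_nonempty: "{p :: 'n::finite \<Rightarrow> 'n. p permutes UNIV} \<noteq> {}"
  using permutes_id by blast

lemma prob_space_perms: "prob_space (perms :: ('n::finite \<Rightarrow> 'n) measure)"
  by (rule prob_space_uniform_count_measure[OF finite_perms perms_nonempty])

text \<open>Right translation is a bijection of the finite group, so it preserves the uniform
  measure.\<close>

lemma distr_perms:
  fixes q :: "'n::finite \<Rightarrow> 'n"
  assumes q: "q permutes UNIV"
  shows "distr perms perms (\<lambda>p. p \<circ> q) = perms"
proof (rule measure_eqI)
  fix A assume "A \<in> sets (distr perms perms (\<lambda>p. p \<circ> q))"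
  then have A: "A \<subseteq> {p. p permutes UNIV}" by (simp add: sets_uniform_count_measure)
  have m: "(\<lambda>p. p \<circ> q) \<in> measurable perms perms"
    using q by (auto simp: measurable_def space_uniform_count_measure sets_uniform_count_measure intro: permutes_compose)
  have eq: "(\<lambda>p. p \<circ> q) -` A \<inter> space perms = (\<lambda>p. p \<circ> inv q) ` A"
  proof (intro equalityI subsetI)
    fix p assume "p \<in> (\<lambda>p. p \<circ> q) -` A \<inter> space perms"
    then have "p \<circ> q \<in> A" by simp
    moreover have "p = (p \<circ> q) \<circ> inv q" using permutes_inv_o(1)[OF q] by (simp add: comp_assoc)
    ultimately show "p \<in> (\<lambda>p. p \<circ> inv q) ` A" by (rule rev_image_eqI[where f="\<lambda>p. p \<circ> inv q" and x="p \<circ> q"])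
  next
    fix p assume "p \<in> (\<lambda>p. p \<circ> inv q) ` A"
    then obtain r where r: "r \<in> A" "p = r \<circ> inv q" by blast
    have "p \<circ> q = r" unfolding r(2) using permutes_inv_o(2)[OF q] by (simp add: comp_assoc)
    moreover have "p permutes UNIV"
      unfolding r(2) using r(1) A permutes_inv[OF q] by (intro permutes_compose) auto
    ultimately show "p \<in> (\<lambda>p. p \<circ> q) -` A \<inter> space perms"
      using r(1) by (simp add: space_uniform_count_measure)
  qed
  have inj: "inj_on (\<lambda>p. p \<circ> inv q) A"
  proof (rule inj_onI)
    fix p p' :: "'n \<Rightarrow> 'n" assume "p \<circ> inv q = p' \<circ> inv q"
    then have "p \<circ> inv q \<circ> q = p' \<circ> inv q \<circ> q" by simp
    then show "p = p'" using permutes_inv_o(2)[OF q] by (simp add: comp_assoc)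
  qed
  have sub: "(\<lambda>p. p \<circ> inv q) ` A \<subseteq> {p. p permutes UNIV}"
    using A permutes_inv[OF q] by (auto intro: permutes_compose)
  have "emeasure (distr perms perms (\<lambda>p. p \<circ> q)) A = emeasure perms ((\<lambda>p. p \<circ> inv q) ` A)"
    by (subst emeasure_distr[OF m]) (use A eq in \<open>auto simp: sets_uniform_count_measure\<close>)
  also have "\<dots> = emeasure perms A"
    by (simp only: emeasure_uniform_count_measure[OF finite_perms sub] emeasure_uniform_count_measure[OF finite_perms A] card_image[OF inj])
  finally show "emeasure (distr perms perms (\<lambda>p. p \<circ> q)) A = emeasure perms A" .
qed simp

text \<open>The selector \<open>eig\<close> may list the eigenvalues in any measurable order; the
  random permutation in \<open>eig_distr\<close> erases that choice.\<close>

locale eig_setup =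
  fixes M :: "'n::finite cmat measure" and eig :: "'n cmat \<Rightarrow> real^'n"
  assumes law: "herm_law M" and inv: "invariant_law M"
    and eig_meas [measurable]: "eig \<in> borel_measurable borel"
    and eig_ok: "AE X in M. is_eig_vec X (eig X)"
begin

lemma prob_M: "prob_space M" and sets_M [measurable_cong]: "sets M = sets borel" and herm_AE: "AE X in M. herm X"
  using law by (auto simp: herm_law_def)

lemma space_M: "space M = UNIV"
  using sets_eq_imp_space_eq[OF sets_M] by simp

lemma measurable_eig_perm [measurable]: "(\<lambda>(X, p). perm_vec p (eig X)) \<in> borel_measurable (M \<Otimes>\<^sub>M perms)"
proof -
  have "(\<lambda>(X, p). perm_vec p (eig X)) \<in> borel_measurable (M \<Otimes>\<^sub>M count_space {p. p permutes UNIV})"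
  proof -
    have "(\<lambda>(p, X). perm_vec p (eig X)) \<in> borel_measurable (count_space {p. p permutes UNIV} \<Otimes>\<^sub>M M)"
      by (rule measurable_pair_measure_countable1) (auto intro!: countable_finite)
    from measurable_compose[OF measurable_pair_swap' this] show ?thesis
      by (simp add: case_prod_beta')
  qed
  then show ?thesis
    by (subst measurable_cong_sets[OF sets_pair_measure_cong[OF refl sets_uniform_count_measure_count_space] refl])
qed

lemma prob_eig: "prob_space (eig_distr M eig)" and sets_eig [measurable_cong]: "sets (eig_distr M eig) = sets borel"
proof -
  interpret M: prob_space M by (rule prob_M)
  interpret P: prob_space "perms :: ('n \<Rightarrow> 'n) measure" by (rule prob_space_perms)
  interpret MP: pair_prob_space M "perms :: ('n \<Rightarrow> 'n) measure" ..
  show "prob_space (eig_distr M eig)" unfolding eig_distr_def by (rule MP.prob_space_distr) measurable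
qed (simp add: eig_distr_def)

text \<open>Applying q after the random p amounts to using p \<circ> q, which is again uniform and
  independent of the matrix.\<close>

lemma eig_exchangeable:
  assumes q: "q permutes UNIV"
  shows "distr (eig_distr M eig) borel (perm_vec q) = eig_distr M eig"
proof -
  interpret M: prob_space M by (rule prob_M)
  interpret P: prob_space "perms :: ('n \<Rightarrow> 'n) measure" by (rule prob_space_perms)
  have [measurable]: "(\<lambda>p. p \<circ> q) \<in> measurable perms perms"
    using q by (auto simp: measurable_def space_uniform_count_measure sets_uniform_count_measure intro: permutes_compose)
  have pr: "distr (M \<Otimes>\<^sub>M perms) (M \<Otimes>\<^sub>M perms) (\<lambda>(X, p). (X, p \<circ> q)) = M \<Otimes>\<^sub>M perms"
  proof -
    have "distr M M (\<lambda>X. X) \<Otimes>\<^sub>M distr perms perms (\<lambda>p. p \<circ> q) = distr (M \<Otimes>\<^sub>M perms) (M \<Otimes>\<^sub>M perms) (\<lambda>(X, p). (X, p \<circ> q))"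
      by (rule pair_measure_distr) (auto simp: distr_perms[OF q] P.sigma_finite_measure_axioms)
    then show ?thesis by (simp add: distr_perms[OF q])
  qed
  have "distr (eig_distr M eig) borel (perm_vec q) = distr (M \<Otimes>\<^sub>M perms) borel (perm_vec q \<circ> (\<lambda>(X, p). perm_vec p (eig X)))"
    unfolding eig_distr_def by (rule distr_distr) measurable
  also have "perm_vec q \<circ> (\<lambda>(X, p). perm_vec p (eig X)) = (\<lambda>(X, p). perm_vec p (eig X)) \<circ> (\<lambda>(X, p). (X, p \<circ> q))"
    by (auto simp: fun_eq_iff perm_vec_def)
  also have "distr (M \<Otimes>\<^sub>M perms) borel \<dots> =
      distr (distr (M \<Otimes>\<^sub>M perms) (M \<Otimes>\<^sub>M perms) (\<lambda>(X, p). (X, p \<circ> q))) borel (\<lambda>(X, p). perm_vec p (eig X))"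
    by (rule distr_distr[symmetric]) measurable
  also have "\<dots> = eig_distr M eig" unfolding pr eig_distr_def ..
  finally show ?thesis .
qed

text \<open>Norm and coordinate sum do not depend on the order, and almost surely they are the norm
  and the trace of the matrix. The joint law is needed because truncation couples the trace to the
  norm.\<close>

lemma eig_joint_integral:
  fixes g :: "real \<times> real \<Rightarrow> real"
  assumes [measurable]: "g \<in> borel_measurable borel"
  shows "(\<integral>v. g (norm v, v \<bullet> ones) \<partial>eig_distr M eig) = (\<integral>X. g (norm X, Re (mtrace X)) \<partial>M)"
proof -
  interpret M: prob_space M by (rule prob_M)
  interpret P: prob_space "perms :: ('n \<Rightarrow> 'n) measure" by (rule prob_space_perms)
  have tr [measurable]: "(\<lambda>X::'n cmat. Re (mtrace X)) \<in> borel_measurable borel"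
    unfolding mtrace_def by measurable
  have gm: "(\<lambda>v::real^'n. g (norm v, v \<bullet> ones)) \<in> borel_measurable borel"
    by (rule measurable_compose[OF _ assms]) (simp add: borel_prod[symmetric])
  have gm': "(\<lambda>X. g (norm X, Re (mtrace X))) \<in> borel_measurable M"
    by (rule measurable_compose[OF _ assms]) (simp add: borel_prod[symmetric])
  have "(\<integral>v. g (norm v, v \<bullet> ones) \<partial>eig_distr M eig) =
      (\<integral>z. g (norm ((\<lambda>(X, p). perm_vec p (eig X)) z), ((\<lambda>(X, p). perm_vec p (eig X)) z) \<bullet> ones) \<partial>(M \<Otimes>\<^sub>M (perms :: ('n \<Rightarrow> 'n) measure)))"
    unfolding eig_distr_def by (rule integral_distr[OF measurable_eig_perm gm])
  also have "\<dots> = (\<integral>z. g (norm (eig (fst z)), eig (fst z) \<bullet> ones) \<partial>(M \<Otimes>\<^sub>M (perms :: ('n \<Rightarrow> 'n) measure)))"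
    by (rule Bochner_Integration.integral_cong)
      (auto simp: space_pair_measure space_uniform_count_measure norm_perm_vec perm_vec_inner_ones)
  also have "\<dots> = integral\<^sup>L (distr (M \<Otimes>\<^sub>M (perms :: ('n \<Rightarrow> 'n) measure)) M fst) (\<lambda>X. g (norm (eig X), eig X \<bullet> ones))"
    by (rule integral_distr[symmetric]) (auto intro!: measurable_compose[OF eig_meas gm])
  also have "\<dots> = (\<integral>X. g (norm (eig X), eig X \<bullet> ones) \<partial>M)" by (simp only: P.distr_pair_fst)
  also have "\<dots> = (\<integral>X. g (norm X, Re (mtrace X)) \<partial>M)"
  proof (rule integral_cong_AE)
    show "AE X in M. g (norm (eig X), eig X \<bullet> ones) = g (norm X, Re (mtrace X))"
      using eig_ok by eventually_elim (simp only: is_eig_vec_norm_trace)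
    show "(\<lambda>X. g (norm (eig X), eig X \<bullet> ones)) \<in> borel_measurable M"
      using measurable_compose[OF eig_meas gm] by simp
  qed (rule gm')
  finally show ?thesis .
qed

lemma null_array_eig_iff:
  "null_array (eig_distr M eig) (\<lambda>m v. (1 / B m) *\<^sub>R v) \<longleftrightarrow> null_array M (\<lambda>m X. (1 / B m) *\<^sub>R X)"
proof -
  have spe: "space (eig_distr M eig) = UNIV" using sets_eq_imp_space_eq[OF sets_eig] by simp
  have "measure (eig_distr M eig) {v \<in> space (eig_distr M eig). norm ((1 / B m) *\<^sub>R v) > \<epsilon>} =
      measure M {X \<in> space M. norm ((1 / B m) *\<^sub>R X) > \<epsilon>}" for m \<epsilon>
  proof -
    let ?g = "\<lambda>z::real \<times> real. indicator {r. \<bar>1 / B m\<bar> * r > \<epsilon>} (fst z) :: real"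
    have "(\<integral>v. ?g (norm v, v \<bullet> ones) \<partial>eig_distr M eig) = (\<integral>X. ?g (norm X, Re (mtrace X)) \<partial>M)"
      by (rule eig_joint_integral) (unfold borel_prod[symmetric], measurable)
    moreover have "(\<lambda>v::real^'n. ?g (norm v, v \<bullet> ones)) = indicator {v. norm ((1 / B m) *\<^sub>R v) > \<epsilon>}"
      "(\<lambda>X::'n cmat. ?g (norm X, Re (mtrace X))) = indicator {X. norm ((1 / B m) *\<^sub>R X) > \<epsilon>}"
      by (auto simp: fun_eq_iff indicator_def)
    ultimately have "(\<integral>v. indicator {v. norm ((1 / B m) *\<^sub>R v) > \<epsilon>} v \<partial>eig_distr M eig) =
        (\<integral>X. (indicator {X. norm ((1 / B m) *\<^sub>R X) > \<epsilon>} X :: real) \<partial>M)" by (simp only:)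
    then show ?thesis by (simp add: spe space_M)
  qed
  then show ?thesis by (simp only: null_array_def)
qed

text \<open>The eigenvalue law has two parameters a', b' of its own. The mean square norm reduced by
  the squared mean trace over N gives a' = a + (N - 1) (a - b); the variance of the trace gives a' +
  (N - 1) b' = a + (N - 1) b.\<close>

lemma trunc_variances:
  assumes R: "R > 0"
  obtains a b where
    "\<And>S. herm S \<Longrightarrow> prob_space.variance M (\<lambda>X. S \<bullet> trunc R X) = (a - b) * (norm S)\<^sup>2 + b * (Re (mtrace S))\<^sup>2"
    "\<And>s. prob_space.variance (eig_distr M eig) (\<lambda>v. s \<bullet> trunc R v) =
        (real CARD('n) + 1) * (a - b) * (s \<bullet> s) + (2 * b - a) * (s \<bullet> ones)\<^sup>2"
proof -
  let ?N = "eig_distr M eig"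
  interpret T: bounded_invariant_law "distr M borel (trunc R)" by (rule bounded_invariant_law_trunc[OF law inv R])
  interpret N: prob_space ?N by (rule prob_eig)
  interpret NT: prob_space "distr ?N borel (trunc R)" by (rule N.prob_space_distr) simp
  interpret NT: bounded_law "distr ?N borel (trunc R)"
  proof
    show "AE v in distr ?N borel (trunc R). norm v \<le> 1"
      by (subst AE_distr_iff) (use norm_trunc_le[OF R] in auto)
  qed simp
  \<comment> \<open>The image under the identity is kept explicit because
    \<open>exchangeable_variance\<close> is applied with the identity as its map.\<close>
  have exch: "distr (distr (distr ?N borel (trunc R)) borel (\<lambda>v. v)) borel (perm_vec p) = distr (distr ?N borel (trunc R)) borel (\<lambda>v. v)"
    if p: "p permutes UNIV" for p
  proof -
    have id: "distr (distr ?N borel (trunc R)) borel (\<lambda>v. v) = distr ?N borel (trunc R)" by (rule distr_id2) simp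
    have "distr (distr ?N borel (trunc R)) borel (perm_vec p) = distr ?N borel (perm_vec p \<circ> trunc R)"
      by (rule distr_distr) measurable
    also have "perm_vec p \<circ> trunc R = trunc R \<circ> perm_vec p" using trunc_perm_vec[OF p] by (auto simp: fun_eq_iff)
    also have "distr ?N borel (trunc R \<circ> perm_vec p) = distr (distr ?N borel (perm_vec p)) borel (trunc R)"
      by (rule distr_distr[symmetric]) measurable
    also have "\<dots> = distr ?N borel (trunc R)" by (simp only: eig_exchangeable[OF p])
    finally show ?thesis unfolding id .
  qed
  obtain a b :: real where
    ab1: "\<And>S. herm S \<Longrightarrow> prob_space.variance (distr M borel (trunc R)) (\<lambda>X. S \<bullet> X) = (a - b) * (norm S)\<^sup>2 + b * (Re (mtrace S))\<^sup>2"
    and ab2: "(\<integral>X. (norm X)\<^sup>2 \<partial>distr M borel (trunc R)) - (\<integral>X. Re (mtrace X) \<partial>distr M borel (trunc R))\<^sup>2 / CARD('n)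
       = CARD('n) * a + CARD('n) * (real CARD('n) - 1) * (a - b)"
    using T.invariant_variance by blast
  have idm: "(\<lambda>v::real^'n. v) \<in> borel_measurable borel" and idn: "\<And>v::real^'n. norm v \<le> norm v" by simp_all
  obtain a' b' :: real where
    ab1': "\<And>s. prob_space.variance (distr ?N borel (trunc R)) (\<lambda>v. s \<bullet> v) = (a' - b') * (s \<bullet> s) + b' * (s \<bullet> ones)\<^sup>2"
    and ab2': "(\<integral>v. (norm v)\<^sup>2 \<partial>distr ?N borel (trunc R)) - (\<integral>v. v \<bullet> ones \<partial>distr ?N borel (trunc R))\<^sup>2 / CARD('n) = CARD('n) * a'"
  proof (rule NT.exchangeable_variance[OF idm idn exch])
    fix c d :: real
    assume "\<And>s. prob_space.variance (distr ?N borel (trunc R)) (\<lambda>v. s \<bullet> v) = (c - d) * (s \<bullet> s) + d * (s \<bullet> ones)\<^sup>2"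
      and "(\<integral>v. (norm v)\<^sup>2 \<partial>distr ?N borel (trunc R)) - (\<integral>v. v \<bullet> ones \<partial>distr ?N borel (trunc R))\<^sup>2 / CARD('n) = CARD('n) * c"
    then show thesis by (rule that)
  qed
  have tr [measurable]: "(\<lambda>X::'n cmat. Re (mtrace X)) \<in> borel_measurable borel"
    unfolding mtrace_def by measurable
  \<comment> \<open>\<open>g1\<close> and \<open>g2\<close> express the truncated square norm and
    the truncated trace through the pair (norm, trace), which makes both sides accessible to
    \<open>eig_joint_integral\<close>.\<close>
  define g1 where "g1 z = indicator {..R} (fst z) * (fst z / R)\<^sup>2" for z :: "real \<times> real"
  define g2 where "g2 z = indicator {..R} (fst z) * (snd z / R)" for z :: "real \<times> real"
  have g [measurable]: "g1 \<in> borel_measurable borel" "g2 \<in> borel_measurable borel"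
    unfolding g1_def[abs_def] g2_def[abs_def] borel_prod[symmetric] by measurable
  have g1v: "(norm (trunc R v))\<^sup>2 = g1 (norm v, v \<bullet> ones)" for v :: "real^'n"
    using R by (simp add: trunc_def g1_def power_mult_distrib indicator_def)
  have g1X: "(norm (trunc R X))\<^sup>2 = g1 (norm X, Re (mtrace X))" for X :: "'n cmat"
    using R by (simp add: trunc_def g1_def power_mult_distrib indicator_def)
  have g2v: "trunc R v \<bullet> ones = g2 (norm v, v \<bullet> ones)" for v :: "real^'n"
    by (simp add: trunc_def g2_def indicator_def)
  have g2X: "Re (mtrace (trunc R X)) = g2 (norm X, Re (mtrace X))" for X :: "'n cmat"
    by (simp add: trunc_def g2_def indicator_def mat1_inner[symmetric])
  have e1: "(\<integral>v. (norm v)\<^sup>2 \<partial>distr ?N borel (trunc R)) = (\<integral>X. (norm X)\<^sup>2 \<partial>distr M borel (trunc R))"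
  proof -
    have "(\<integral>v. (norm v)\<^sup>2 \<partial>distr ?N borel (trunc R)) = (\<integral>v. g1 (norm v, v \<bullet> ones) \<partial>?N)"
      by (subst integral_distr) (auto simp: g1v)
    also have "\<dots> = (\<integral>X. g1 (norm X, Re (mtrace X)) \<partial>M)" by (rule eig_joint_integral) simp
    also have "\<dots> = (\<integral>X. (norm X)\<^sup>2 \<partial>distr M borel (trunc R))"
      by (subst integral_distr) (auto simp: g1X)
    finally show ?thesis .
  qed
  have e2: "(\<integral>v. v \<bullet> ones \<partial>distr ?N borel (trunc R)) = (\<integral>X. Re (mtrace X) \<partial>distr M borel (trunc R))"
  proof -
    have "(\<integral>v. v \<bullet> ones \<partial>distr ?N borel (trunc R)) = (\<integral>v. g2 (norm v, v \<bullet> ones) \<partial>?N)"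
      by (subst integral_distr) (auto simp: g2v)
    also have "\<dots> = (\<integral>X. g2 (norm X, Re (mtrace X)) \<partial>M)" by (rule eig_joint_integral) simp
    also have "\<dots> = (\<integral>X. Re (mtrace X) \<partial>distr M borel (trunc R))"
      by (subst integral_distr) (auto simp: g2X)
    finally show ?thesis .
  qed
  have e3: "prob_space.variance (distr ?N borel (trunc R)) (\<lambda>v. ones \<bullet> v) = prob_space.variance (distr M borel (trunc R)) (\<lambda>X. mat 1 \<bullet> X)"
  proof -
    define c where "c = (\<integral>X. Re (mtrace X) \<partial>distr M borel (trunc R))"
    have "prob_space.variance (distr ?N borel (trunc R)) (\<lambda>v. ones \<bullet> v) = (\<integral>v. (v \<bullet> ones - c)\<^sup>2 \<partial>distr ?N borel (trunc R))"
      unfolding c_def e2[symmetric] by (simp only: inner_commute)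
    also have "\<dots> = (\<integral>v. (g2 (norm v, v \<bullet> ones) - c)\<^sup>2 \<partial>?N)"
      by (subst integral_distr) (auto simp: g2v)
    also have "\<dots> = (\<integral>X. (g2 (norm X, Re (mtrace X)) - c)\<^sup>2 \<partial>M)"
      by (rule eig_joint_integral[of "\<lambda>z. (g2 z - c)\<^sup>2"]) simp
    also have "\<dots> = (\<integral>X. (Re (mtrace X) - c)\<^sup>2 \<partial>distr M borel (trunc R))"
      by (subst integral_distr) (auto simp: g2X)
    also have "\<dots> = prob_space.variance (distr M borel (trunc R)) (\<lambda>X. mat 1 \<bullet> X)"
      unfolding c_def by (simp only: mat1_inner)
    finally show ?thesis .
  qed
  define n where "n = real CARD('n)"
  have n0: "n > 0" by (simp add: n_def)
  have mt: "mtrace (mat 1 :: 'n cmat) = of_nat CARD('n)" by (simp add: mtrace_def mat_def)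
  have nm: "(norm (mat 1 :: 'n cmat))\<^sup>2 = n" unfolding power2_norm_eq_inner mat1_inner mt by (simp add: n_def)
  have i: "a' = a + (n - 1) * (a - b)"
  proof -
    have "n * a' = n * a + n * (n - 1) * (a - b)" using ab2 ab2' unfolding e1 e2 n_def by linarith
    then have "n * a' = n * (a + (n - 1) * (a - b))" by (simp add: algebra_simps)
    then show ?thesis using n0 by simp
  qed
  \<comment> \<open>The factor n - 1 cannot be cancelled in dimension one, where b' is undetermined;
    there the two quadratic forms agree and b' drops out of \<open>key\<close>.\<close>
  have ii: "(n - 1) * b' = (n - 1) * (2 * b - a)"
  proof -
    have "(a' - b') * n + b' * n\<^sup>2 = (a - b) * n + b * n\<^sup>2"
      using e3 unfolding ab1' ab1[OF herm_mat1] nm inner_ones mt n_def by simp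
    then have "n * ((a' - b') + b' * n) = n * ((a - b) + b * n)" by (simp add: algebra_simps power2_eq_square)
    then have "(a' - b') + b' * n = (a - b) + b * n" using n0 by simp
    then show ?thesis unfolding i by (simp add: algebra_simps)
  qed
  have key: "(a' - b') * (s \<bullet> s) + b' * (s \<bullet> ones)\<^sup>2 = (n + 1) * (a - b) * (s \<bullet> s) + (2 * b - a) * (s \<bullet> ones)\<^sup>2" for s :: "real^'n"
  proof (cases "CARD('n) = 1")
    case True
    have s: "s \<bullet> s = (s \<bullet> ones)\<^sup>2"
      unfolding inner_vec_def card_1_sum[OF True, of _ undefined] by (simp add: power2_eq_square)
    have "n = 1" using True by (simp add: n_def)
    then show ?thesis unfolding s i by (simp add: algebra_simps)
  next
    case False
    then have "n \<noteq> 1" by (simp add: n_def)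
    with ii have b': "b' = 2 * b - a" by simp
    show ?thesis unfolding i b' by (simp add: algebra_simps)
  qed
  show thesis
  proof (rule that[of a b])
    show "prob_space.variance M (\<lambda>X. S \<bullet> trunc R X) = (a - b) * (norm S)\<^sup>2 + b * (Re (mtrace S))\<^sup>2" if "herm S" for S
      using ab1[OF that] by (subst (asm) variance_distr) simp_all
    show "prob_space.variance ?N (\<lambda>v. s \<bullet> trunc R v) = (real CARD('n) + 1) * (a - b) * (s \<bullet> s) + (2 * b - a) * (s \<bullet> ones)\<^sup>2" for s
      using ab1'[of s] unfolding key n_def by (subst (asm) variance_distr) simp_all
  qed
qed

end

section \<open>The equivalence\<close>

text \<open>The orthogonal projection onto Hermitian matrices; it describes the limiting form at
  arbitrary complex test matrices.\<close>

definition herm_part :: "'n::finite cmat \<Rightarrow> 'n cmat" where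
  "herm_part S = (1 / 2) *\<^sub>R (S + hadj S)"

lemma hadj_add: "hadj (A + B) = hadj A + hadj B"
  by (simp add: hadj_def vec_eq_iff)

lemma herm_herm_part: "herm (herm_part S)"
  by (simp add: herm_def herm_part_def hadj_scaleR hadj_add add.commute)

lemma herm_part_herm: "herm S \<Longrightarrow> herm_part S = S"
  by (simp add: herm_def herm_part_def scaleR_2[symmetric])

lemma herm_part_scaleR: "herm_part (c *\<^sub>R S) = c *\<^sub>R herm_part S"
  by (simp add: herm_part_def hadj_scaleR scaleR_add_right[symmetric])

lemma inner_hadj: "hadj S \<bullet> hadj X = S \<bullet> X"
proof -
  have "hadj S \<bullet> hadj X = (\<Sum>i\<in>UNIV. \<Sum>j\<in>UNIV. Re (cnj (S $ j $ i) * X $ j $ i))"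
    by (simp add: inner_cmat hadj_def)
  also have "\<dots> = S \<bullet> X" unfolding inner_cmat by (rule sum.swap)
  finally show ?thesis .
qed

lemma inner_herm_part: "herm X \<Longrightarrow> herm_part S \<bullet> X = S \<bullet> X"
  using inner_hadj[of S X] by (simp add: herm_def herm_part_def inner_add_left)

lemma Re_mtrace_herm_part: "Re (mtrace (herm_part S)) = Re (mtrace S)"
proof -
  have "mat 1 \<bullet> herm_part S = herm_part S \<bullet> mat 1" by (rule inner_commute)
  also have "\<dots> = mat 1 \<bullet> S" unfolding inner_herm_part[OF herm_mat1] by (rule inner_commute)
  finally show ?thesis by (simp only: mat1_inner)
qed

lemma norm_herm_card_1:
  fixes S :: "'n::finite cmat"
  assumes "CARD('n) = 1" "herm S"
  shows "(Re (mtrace S))\<^sup>2 = (norm S)\<^sup>2"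
proof -
  have "Im (S $ undefined $ undefined) = 0"
    using herm_cnj[OF assms(2), of undefined undefined] by (simp only: Reals_cnj_iff[symmetric] complex_is_Real_iff)
  then show ?thesis
    unfolding norm_cmat_square mtrace_def card_1_sum[OF assms(1), of _ undefined] by (simp add: cmod_power2)
qed

lemma trunc_alt: "indicator {x. norm x \<le> R} x *\<^sub>R (1 / R) *\<^sub>R x = trunc R x"
  by (simp add: trunc_def)

lemma diag_vec_trunc: "indicator {x. norm x \<le> R} X *\<^sub>R (1 / R) *\<^sub>R diag_vec X = diag_vec (trunc R X)"
  by (simp add: trunc_def diag_vec_def vec_eq_iff)

section \<open>A common criterion for the three laws\<close>

context eig_setup
begin

text \<open>With the a and b of \<open>trunc_variances\<close> at level \<open>B m\<close>, the
  sequences are x = m (a - b) and y = m b, so that 2 b - a becomes y - x.\<close>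

lemma trunc_params:
  assumes B: "\<And>m::nat. B m > 0"
  obtains x y :: "nat \<Rightarrow> real" where
    "\<And>S m. herm S \<Longrightarrow> real m * prob_space.variance M (\<lambda>X. S \<bullet> trunc (B m) X) = x m * (norm S)\<^sup>2 + y m * (Re (mtrace S))\<^sup>2"
    "\<And>s m. real m * prob_space.variance (eig_distr M eig) (\<lambda>v. s \<bullet> trunc (B m) v) =
        (real CARD('n) + 1) * x m * (s \<bullet> s) + (y m - x m) * (s \<bullet> ones)\<^sup>2"
proof -
  have "\<exists>a b. (\<forall>S. herm S \<longrightarrow> prob_space.variance M (\<lambda>X. S \<bullet> trunc (B m) X) = (a - b) * (norm S)\<^sup>2 + b * (Re (mtrace S))\<^sup>2) \<and>
    (\<forall>s. prob_space.variance (eig_distr M eig) (\<lambda>v. s \<bullet> trunc (B m) v) =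
        (real CARD('n) + 1) * (a - b) * (s \<bullet> s) + (2 * b - a) * (s \<bullet> ones)\<^sup>2)" for m
    by (rule trunc_variances[OF B[of m]]) blast
  then obtain a b where
    1: "\<And>S m. herm S \<Longrightarrow> prob_space.variance M (\<lambda>X. S \<bullet> trunc (B m) X) = (a m - b m) * (norm S)\<^sup>2 + b m * (Re (mtrace S))\<^sup>2"
    and 2: "\<And>s m. prob_space.variance (eig_distr M eig) (\<lambda>v. s \<bullet> trunc (B m) v) =
        (real CARD('n) + 1) * (a m - b m) * (s \<bullet> s) + (2 * b m - a m) * (s \<bullet> ones)\<^sup>2"
    by metis
  show thesis
  proof (rule that[of "\<lambda>m. real m * (a m - b m)" "\<lambda>m. real m * b m"])
    show "real m * prob_space.variance M (\<lambda>X. S \<bullet> trunc (B m) X) = real m * (a m - b m) * (norm S)\<^sup>2 + real m * b m * (Re (mtrace S))\<^sup>2"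
      if "herm S" for S m unfolding 1[OF that] by (simp add: algebra_simps)
    show "real m * prob_space.variance (eig_distr M eig) (\<lambda>v. s \<bullet> trunc (B m) v) =
        (real CARD('n) + 1) * (real m * (a m - b m)) * (s \<bullet> s) + (real m * b m - real m * (a m - b m)) * (s \<bullet> ones)\<^sup>2" for s m
      unfolding 2 by (simp add: algebra_simps)
  qed
qed

text \<open>The variance criterion stated for the matrix alone; each of the three laws is shown
  equivalent to it. The values used are u = \<sigma>^2 and v = \<kappa>.\<close>

definition gauss_cond :: "(nat \<Rightarrow> real) \<Rightarrow> real \<Rightarrow> real \<Rightarrow> bool" where
  "gauss_cond B u v \<longleftrightarrow> null_array M (\<lambda>m X. (1 / B m) *\<^sub>R X) \<and>
    (\<forall>S. herm S \<longrightarrow> (\<lambda>m. real m * prob_space.variance M (\<lambda>X. S \<bullet> trunc (B m) X)) \<longlonglongrightarrow> u * (norm S)\<^sup>2 + v * (Re (mtrace S))\<^sup>2)"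

lemma herm_limits_if:
  fixes x y :: "nat \<Rightarrow> real"
  assumes p: "params_tendsto TYPE('n) x y u v"
    and x: "\<And>S m. herm S \<Longrightarrow> real m * prob_space.variance M (\<lambda>X. S \<bullet> trunc (B m) X) = x m * (norm S)\<^sup>2 + y m * (Re (mtrace S))\<^sup>2"
    and S: "herm S"
  shows "(\<lambda>m. real m * prob_space.variance M (\<lambda>X. S \<bullet> trunc (B m) X)) \<longlonglongrightarrow> u * (norm S)\<^sup>2 + v * (Re (mtrace S))\<^sup>2"
  unfolding x[OF S] by (rule params_tendsto_imp[OF p norm_herm_card_1[OF _ S]])

text \<open>Diagonal test matrices \<open>diagm s\<close> give one direction. Conversely they
  already determine the limits of the parameters (of their sum if N = 1), and these control every
  Hermitian test matrix.\<close>

lemma diag_limits_iff: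
  assumes B: "\<And>m. B m > 0"
  shows "(\<forall>s. (\<lambda>m. real m * prob_space.variance M (\<lambda>X. s \<bullet> diag_vec (trunc (B m) X))) \<longlonglongrightarrow> u * (s \<bullet> s) + v * (s \<bullet> ones)\<^sup>2) \<longleftrightarrow>
    (\<forall>S. herm S \<longrightarrow> (\<lambda>m. real m * prob_space.variance M (\<lambda>X. S \<bullet> trunc (B m) X)) \<longlonglongrightarrow> u * (norm S)\<^sup>2 + v * (Re (mtrace S))\<^sup>2)"
    (is "?L \<longleftrightarrow> ?R")
proof -
  obtain x y where
    x: "\<And>S m. herm S \<Longrightarrow> real m * prob_space.variance M (\<lambda>X. S \<bullet> trunc (B m) X) = x m * (norm S)\<^sup>2 + y m * (Re (mtrace S))\<^sup>2"
    using trunc_params[where B=B, OF B] by metis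
  have ns: "(norm (diagm s))\<^sup>2 = s \<bullet> s" "Re (mtrace (diagm s)) = s \<bullet> ones" for s :: "real^'n"
    by (simp_all add: norm_diagm power2_norm_eq_inner mtrace_diagm)
  show ?thesis
  proof
    assume R: ?R
    show ?L
    proof
      fix s :: "real^'n"
      show "(\<lambda>m. real m * prob_space.variance M (\<lambda>X. s \<bullet> diag_vec (trunc (B m) X))) \<longlonglongrightarrow> u * (s \<bullet> s) + v * (s \<bullet> ones)\<^sup>2"
        using R[rule_format, OF herm_diagm[of s]] unfolding ns diagm_inner .
    qed
  next
    assume L: ?L
    have "(\<lambda>m. x m * (s \<bullet> s) + y m * (s \<bullet> ones)\<^sup>2) \<longlonglongrightarrow> u * (s \<bullet> s) + v * (s \<bullet> ones)\<^sup>2" for s :: "real^'n"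
      using L[rule_format, of s] x[OF herm_diagm[of s]] unfolding ns diagm_inner by (simp only:)
    then have "params_tendsto TYPE('n) x y u v" by (rule params_tendsto_diag)
    then show ?R using herm_limits_if[where B=B, OF _ x] by blast
  qed
qed

lemma eig_limits_iff:
  assumes B: "\<And>m. B m > 0"
  shows "(\<forall>s. (\<lambda>m. real m * prob_space.variance (eig_distr M eig) (\<lambda>w. s \<bullet> trunc (B m) w)) \<longlonglongrightarrow>
      (real CARD('n) + 1) * u * (s \<bullet> s) + (v - u) * (s \<bullet> ones)\<^sup>2) \<longleftrightarrow>
    (\<forall>S. herm S \<longrightarrow> (\<lambda>m. real m * prob_space.variance M (\<lambda>X. S \<bullet> trunc (B m) X)) \<longlonglongrightarrow> u * (norm S)\<^sup>2 + v * (Re (mtrace S))\<^sup>2)"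
    (is "?L \<longleftrightarrow> ?R")
proof -
  obtain x y where
    x: "\<And>S m. herm S \<Longrightarrow> real m * prob_space.variance M (\<lambda>X. S \<bullet> trunc (B m) X) = x m * (norm S)\<^sup>2 + y m * (Re (mtrace S))\<^sup>2"
    and y: "\<And>s m. real m * prob_space.variance (eig_distr M eig) (\<lambda>v. s \<bullet> trunc (B m) v) =
        (real CARD('n) + 1) * x m * (s \<bullet> s) + (y m - x m) * (s \<bullet> ones)\<^sup>2"
    using trunc_params[where B=B, OF B] by metis
  have ns: "(norm (diagm s))\<^sup>2 = s \<bullet> s" "Re (mtrace (diagm s)) = s \<bullet> ones" for s :: "real^'n"
    by (simp_all add: norm_diagm power2_norm_eq_inner mtrace_diagm)
  show ?thesis
  proof
    assume L: ?L
    then have "params_tendsto TYPE('n) x y u v" unfolding y by (intro params_tendsto_eig) blast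
    then show ?R using herm_limits_if[where B=B, OF _ x] by blast
  next
    assume R: ?R
    have "(\<lambda>m. x m * (s \<bullet> s) + y m * (s \<bullet> ones)\<^sup>2) \<longlonglongrightarrow> u * (s \<bullet> s) + v * (s \<bullet> ones)\<^sup>2" for s :: "real^'n"
      using R[rule_format, OF herm_diagm[of s]] unfolding x[OF herm_diagm] ns .
    then have p: "params_tendsto TYPE('n) x y u v" by (rule params_tendsto_diag)
    show ?L
    proof
      fix s :: "real^'n"
      \<comment> \<open>Regrouped by the parameters x and y instead of by the two forms; for N = 1
        both coefficients equal (s \<bullet> ones)^2, as \<open>params_tendsto_imp\<close>
        requires.\<close>
      have "(\<lambda>m. x m * ((real CARD('n) + 1) * (s \<bullet> s) - (s \<bullet> ones)\<^sup>2) + y m * (s \<bullet> ones)\<^sup>2)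
          \<longlonglongrightarrow> u * ((real CARD('n) + 1) * (s \<bullet> s) - (s \<bullet> ones)\<^sup>2) + v * (s \<bullet> ones)\<^sup>2"
      proof (rule params_tendsto_imp[OF p])
        assume 1: "CARD('n) = 1"
        have "s \<bullet> s = (s \<bullet> ones)\<^sup>2"
          unfolding inner_vec_def card_1_sum[OF 1, of _ undefined] by (simp add: power2_eq_square)
        then show "(s \<bullet> ones)\<^sup>2 = (real CARD('n) + 1) * (s \<bullet> s) - (s \<bullet> ones)\<^sup>2" unfolding 1 by simp
      qed
      then show "(\<lambda>m. real m * prob_space.variance (eig_distr M eig) (\<lambda>w. s \<bullet> trunc (B m) w)) \<longlonglongrightarrow>
        (real CARD('n) + 1) * u * (s \<bullet> s) + (v - u) * (s \<bullet> ones)\<^sup>2"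
        unfolding y by (simp add: algebra_simps)
    qed
  qed
qed

text \<open>Beyond the general criterion, two points need care: the limiting form must be known at
  non-Hermitian S, and the centring constants must be Hermitian. \<open>pos\<close> is the value of
  the form at the identity matrix.\<close>

lemma gauss_cond_iff_matrix:
  fixes L :: "'n cmat measure"
  assumes B: "\<And>m. B m > 0" and L: "prob_space L" "sets L = sets borel"
    and Lchar: "\<And>S. vchar L S = of_real (exp (- ((u * (norm (herm_part S))\<^sup>2 + v * (Re (mtrace S))\<^sup>2) / 2)))"
    and pos: "u * CARD('n) + v * (real CARD('n))\<^sup>2 > 0"
  shows "(\<exists>A. (\<forall>m. herm (A m)) \<and> conv_distr (\<lambda>m. normalized_sum_distr M m (B m) (A m)) L) \<longleftrightarrow> gauss_cond B u v"
proof -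
  let ?Q = "\<lambda>S::'n cmat. u * (norm (herm_part S))\<^sup>2 + v * (Re (mtrace S))\<^sup>2"
  interpret M: prob_space M by (rule prob_M)
  have id: "distr M borel (\<lambda>X. X) = M" by (rule distr_id2) (simp add: sets_M)
  have tr: "truncation M (\<lambda>X. X) B (\<lambda>m. {x. norm x \<le> B m})" if "null_array M (\<lambda>m X. (1 / B m) *\<^sub>R X)"
    by (rule truncation_self[OF prob_M sets_M _ _ B that]) simp_all
  show ?thesis
  proof
    assume "\<exists>A. (\<forall>m. herm (A m)) \<and> conv_distr (\<lambda>m. normalized_sum_distr M m (B m) (A m)) L"
    then obtain A where conv: "conv_distr (\<lambda>m. normalized_sum_distr M m (B m) (A m)) L" by blast
    have "mtrace (mat 1 :: 'n cmat) = of_nat CARD('n)" by (simp add: mtrace_def mat_def)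
    then have "?Q (mat 1) = u * CARD('n) + v * (real CARD('n))\<^sup>2"
      by (simp add: herm_part_herm[OF herm_mat1] power2_norm_eq_inner mat1_inner)
    then have Qpos: "?Q (mat 1) > 0" using pos by simp
    have scale: "?Q (t *\<^sub>R S) = t\<^sup>2 * ?Q S" for t S
      by (simp add: herm_part_scaleR mat1_inner[symmetric] power_mult_distrib algebra_simps)
    have null: "null_array M (\<lambda>m X. (1 / B m) *\<^sub>R X)"
      by (rule attraction_imp_null_array[where Q="?Q" and e="mat 1", OF prob_M sets_M L Lchar scale Qpos B conv])
    have lim: "(\<lambda>m. real m * M.variance (\<lambda>X. S \<bullet> trunc (B m) X)) \<longlonglongrightarrow> ?Q S" for S
      using truncation.attraction_imp_variance_tendsto[where Q="?Q" and s=S, OF tr[OF null] L Lchar, unfolded id trunc_alt, OF conv] .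
    show "gauss_cond B u v"
      unfolding gauss_cond_def
    proof (intro conjI allI impI null)
      fix S :: "'n cmat" assume "herm S"
      from lim[of S, unfolded herm_part_herm[OF this]]
      show "(\<lambda>m. real m * M.variance (\<lambda>X. S \<bullet> trunc (B m) X)) \<longlonglongrightarrow> u * (norm S)\<^sup>2 + v * (Re (mtrace S))\<^sup>2" .
    qed
  next
    assume c: "gauss_cond B u v"
    then have null: "null_array M (\<lambda>m X. (1 / B m) *\<^sub>R X)" by (simp only: gauss_cond_def)
    have lim: "(\<lambda>m. real m * M.variance (\<lambda>X. S \<bullet> trunc (B m) X)) \<longlonglongrightarrow> ?Q S" for S
    proof -
      \<comment> \<open>The truncated matrix is almost surely Hermitian and so does not distinguish
        S from its Hermitian part.\<close>
      have AE: "AE X in M. S \<bullet> trunc (B m) X = herm_part S \<bullet> trunc (B m) X" for m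
        using herm_AE by eventually_elim (simp only: inner_herm_part[OF herm_trunc])
      have e: "M.expectation (\<lambda>X. S \<bullet> trunc (B m) X) = M.expectation (\<lambda>X. herm_part S \<bullet> trunc (B m) X)" for m
        by (rule integral_cong_AE[OF _ _ AE]) simp_all
      have "M.variance (\<lambda>X. S \<bullet> trunc (B m) X) = M.variance (\<lambda>X. herm_part S \<bullet> trunc (B m) X)" for m
        unfolding e
      proof (rule integral_cong_AE)
        show "AE X in M. (S \<bullet> trunc (B m) X - M.expectation (\<lambda>X. herm_part S \<bullet> trunc (B m) X))\<^sup>2 =
          (herm_part S \<bullet> trunc (B m) X - M.expectation (\<lambda>X. herm_part S \<bullet> trunc (B m) X))\<^sup>2"
          using AE[of m] by eventually_elim (simp only:)
      qed simp_all
      moreover have "(\<lambda>m. real m * M.variance (\<lambda>X. herm_part S \<bullet> trunc (B m) X)) \<longlonglongrightarrow> u * (norm (herm_part S))\<^sup>2 + v * (Re (mtrace (herm_part S)))\<^sup>2"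
        using c herm_herm_part unfolding gauss_cond_def by blast
      ultimately show ?thesis by (simp only: Re_mtrace_herm_part)
    qed
    have conv: "conv_distr (\<lambda>m. normalized_sum_distr M m (B m) (real m *\<^sub>R M.expectation (trunc (B m)))) L"
      by (rule truncation.variance_tendsto_imp_attraction[where Q="?Q", OF tr[OF null] L Lchar, unfolded id trunc_alt, OF lim])
    have int: "integrable M (trunc (B m))" for m
      by (rule M.integrable_const_bound[where B=1]) (use norm_trunc_le[OF B] in auto)
    have "herm (real m *\<^sub>R M.expectation (trunc (B m)))" for m
    proof -
      \<comment> \<open>The adjoint is conjugate-linear, but linear over the reals, which is enough
        to exchange it with the expectation.\<close>
      have bl: "bounded_linear (hadj :: 'n cmat \<Rightarrow> 'n cmat)"
        by (rule linear_conv_bounded_linear[THEN iffD1]) (auto intro!: linearI simp: hadj_add hadj_scaleR)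
      have "hadj (M.expectation (trunc (B m))) = M.expectation (\<lambda>X. hadj (trunc (B m) X))"
        by (rule integral_bounded_linear[OF bl int, symmetric])
      also have "\<dots> = M.expectation (trunc (B m))"
      proof (rule integral_cong_AE)
        show "AE X in M. hadj (trunc (B m) X) = trunc (B m) X"
          using herm_AE by eventually_elim (use herm_trunc in \<open>auto simp: herm_def\<close>)
        show "(\<lambda>X. hadj (trunc (B m) X)) \<in> borel_measurable M"
          by (rule measurable_compose[OF _ borel_measurable_continuous_onI[OF continuous_on_hadj]]) simp
      qed simp
      finally show ?thesis by (simp add: herm_def hadj_scaleR)
    qed
    with conv show "\<exists>A. (\<forall>m. herm (A m)) \<and> conv_distr (\<lambda>m. normalized_sum_distr M m (B m) (A m)) L"
      by (intro exI[where x="\<lambda>m. real m *\<^sub>R M.expectation (trunc (B m))"]) blast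
  qed
qed

lemma gauss_cond_iff_diag:
  fixes L :: "(real^'n) measure"
  assumes B: "\<And>m. B m > 0" and L: "prob_space L" "sets L = sets borel"
    and Lchar: "\<And>s. vchar L s = of_real (exp (- ((u * (s \<bullet> s) + v * (s \<bullet> ones)\<^sup>2) / 2)))"
    and pos: "u * CARD('n) + v * (real CARD('n))\<^sup>2 > 0"
  shows "(\<exists>A. conv_distr (\<lambda>m. normalized_sum_distr (distr M borel diag_vec) m (B m) (A m)) L) \<longleftrightarrow> gauss_cond B u v"
proof -
  let ?Q = "\<lambda>s::real^'n. u * (s \<bullet> s) + v * (s \<bullet> ones)\<^sup>2"
  interpret M: prob_space M by (rule prob_M)
  have tr: "truncation M diag_vec B (\<lambda>m. {x. norm x \<le> B m})" if "null_array M (\<lambda>m X. (1 / B m) *\<^sub>R X)"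
    by (rule truncation_self[OF prob_M sets_M _ norm_diag_vec_le B that]) simp
  have P: "prob_space (distr M borel diag_vec)" by (rule M.prob_space_distr) simp
  show ?thesis
  proof
    assume "\<exists>A. conv_distr (\<lambda>m. normalized_sum_distr (distr M borel diag_vec) m (B m) (A m)) L"
    then obtain A where conv: "conv_distr (\<lambda>m. normalized_sum_distr (distr M borel diag_vec) m (B m) (A m)) L" by blast
    have Qpos: "?Q ones > 0" using pos by (simp only: inner_ones)
    have scale: "?Q (t *\<^sub>R s) = t\<^sup>2 * ?Q s" for t s
      by (simp add: power_mult_distrib algebra_simps power2_eq_square)
    have "null_array (distr M borel diag_vec) (\<lambda>m x. (1 / B m) *\<^sub>R x)"
      by (rule attraction_imp_null_array[where Q="?Q" and e=ones, OF P sets_distr L Lchar scale Qpos B conv])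
    then have "null_array M (\<lambda>m X. (1 / B m) *\<^sub>R diag_vec X)" by (subst (asm) null_array_distr) simp_all
    \<comment> \<open>Tails pass from the diagonal to the whole matrix, so that truncation by the
      matrix norm becomes legitimate.\<close>
    then have null: "null_array M (\<lambda>m X. (1 / B m) *\<^sub>R X)" by (rule null_array_diag_imp[OF law inv B])
    have "(\<lambda>m. real m * M.variance (\<lambda>X. s \<bullet> diag_vec (trunc (B m) X))) \<longlonglongrightarrow> ?Q s" for s
      using truncation.attraction_imp_variance_tendsto[OF tr[OF null] L Lchar conv, of s]
      unfolding diag_vec_trunc .
    with null show "gauss_cond B u v" unfolding gauss_cond_def using diag_limits_iff[where B=B, OF B] by blast
  next
    assume c: "gauss_cond B u v"
    then have null: "null_array M (\<lambda>m X. (1 / B m) *\<^sub>R X)" by (simp only: gauss_cond_def)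
    have lim: "(\<lambda>m. real m * M.variance (\<lambda>X. s \<bullet> diag_vec (trunc (B m) X))) \<longlonglongrightarrow> ?Q s" for s
      using c unfolding gauss_cond_def using diag_limits_iff[where B=B, OF B] by blast
    show "\<exists>A. conv_distr (\<lambda>m. normalized_sum_distr (distr M borel diag_vec) m (B m) (A m)) L"
      using truncation.variance_tendsto_imp_attraction[where Q="?Q", OF tr[OF null] L Lchar, unfolded diag_vec_trunc, OF lim]
      by (rule exI[where x="\<lambda>m. real m *\<^sub>R M.expectation (\<lambda>X. diag_vec (trunc (B m) X))"])
  qed
qed

lemma gauss_cond_iff_eig:
  fixes L :: "(real^'n) measure"
  assumes B: "\<And>m. B m > 0" and L: "prob_space L" "sets L = sets borel"
    and Lchar: "\<And>s. vchar L s = of_real (exp (- (((real CARD('n) + 1) * u * (s \<bullet> s) + (v - u) * (s \<bullet> ones)\<^sup>2) / 2)))"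
    and pos: "u * CARD('n) + v * (real CARD('n))\<^sup>2 > 0"
  shows "(\<exists>A. conv_distr (\<lambda>m. normalized_sum_distr (eig_distr M eig) m (B m) (A m)) L) \<longleftrightarrow> gauss_cond B u v"
proof -
  let ?N = "eig_distr M eig"
  let ?Q = "\<lambda>s::real^'n. (real CARD('n) + 1) * u * (s \<bullet> s) + (v - u) * (s \<bullet> ones)\<^sup>2"
  interpret N: prob_space ?N by (rule prob_eig)
  have id: "distr ?N borel (\<lambda>v. v) = ?N" by (rule distr_id2) (simp add: sets_eig)
  have tr: "truncation ?N (\<lambda>v. v) B (\<lambda>m. {x. norm x \<le> B m})" if "null_array ?N (\<lambda>m v. (1 / B m) *\<^sub>R v)"
    by (rule truncation_self[OF prob_eig sets_eig _ _ B that]) simp_all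
  show ?thesis
  proof
    assume "\<exists>A. conv_distr (\<lambda>m. normalized_sum_distr ?N m (B m) (A m)) L"
    then obtain A where conv: "conv_distr (\<lambda>m. normalized_sum_distr ?N m (B m) (A m)) L" by blast
    \<comment> \<open>The same number as for the matrix and the diagonal: the coordinate sum of the
      eigenvalues is the trace.\<close>
    have "?Q ones = u * CARD('n) + v * (real CARD('n))\<^sup>2" unfolding inner_ones by (simp add: algebra_simps power2_eq_square)
    then have Qpos: "?Q ones > 0" using pos by simp
    have scale: "?Q (t *\<^sub>R s) = t\<^sup>2 * ?Q s" for t s
      by (simp add: power_mult_distrib algebra_simps power2_eq_square)
    have null: "null_array ?N (\<lambda>m v. (1 / B m) *\<^sub>R v)"
      by (rule attraction_imp_null_array[where Q="?Q" and e=ones, OF prob_eig sets_eig L Lchar scale Qpos B conv])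
    have "(\<lambda>m. real m * N.variance (\<lambda>v. s \<bullet> trunc (B m) v)) \<longlonglongrightarrow> ?Q s" for s
      using truncation.attraction_imp_variance_tendsto[where Q="?Q" and s=s, OF tr[OF null] L Lchar, unfolded id trunc_alt, OF conv] .
    then show "gauss_cond B u v"
      unfolding gauss_cond_def using eig_limits_iff[where B=B, OF B] null null_array_eig_iff[of B] by blast
  next
    assume c: "gauss_cond B u v"
    then have null: "null_array ?N (\<lambda>m v. (1 / B m) *\<^sub>R v)" by (simp only: gauss_cond_def null_array_eig_iff)
    have lim: "(\<lambda>m. real m * N.variance (\<lambda>w. s \<bullet> trunc (B m) w)) \<longlonglongrightarrow> ?Q s" for s
      using c unfolding gauss_cond_def using eig_limits_iff[where B=B, OF B] by blast
    show "\<exists>A. conv_distr (\<lambda>m. normalized_sum_distr ?N m (B m) (A m)) L"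
      using truncation.variance_tendsto_imp_attraction[where Q="?Q", OF tr[OF null] L Lchar, unfolded id trunc_alt, OF lim]
      by (rule exI[where x="\<lambda>m. real m *\<^sub>R N.expectation (trunc (B m))"])
  qed
qed

end

theorem theorem5p4:
  fixes \<sigma> \<kappa> :: real
    and MX MY :: "'n::finite cmat measure"
    and G :: "(real ^ 'n) measure"
    and eig :: "'n cmat \<Rightarrow> real ^ 'n"
  assumes sigma_pos: "\<sigma> > 0"
    and kappa: "\<kappa> > - \<sigma>\<^sup>2 / real CARD('n)"
    and Y_law: "herm_law MY"
    and Y_char: "\<And>S. herm S \<Longrightarrow>
        (\<integral>Y. exp (\<i> * complex_of_real (Re (mtrace (Y ** S)))) \<partial>MY) =
        complex_of_real (exp (- (\<sigma>\<^sup>2 / 2) * Re (mtrace (S ** S)) - (\<kappa> / 2) * (Re (mtrace S))\<^sup>2))"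
    and X_law: "herm_law MX"
    and X_inv: "invariant_law MX"
    and eig_meas: "eig \<in> borel_measurable borel"
    and eig_ok: "AE X in MX. is_eig_vec X (eig X)"
    and G_prob: "prob_space G"
    and G_sets: "sets G = sets borel"
    and G_char: "\<And>s :: real ^ 'n.
        (\<integral>x. exp (\<i> * complex_of_real (s \<bullet> x)) \<partial>G) =
        complex_of_real (exp (- real (CARD('n) + 1) * \<sigma>\<^sup>2 * (norm s)\<^sup>2 / 2
                               - (\<kappa> - \<sigma>\<^sup>2) * (s \<bullet> (\<chi> i. 1))\<^sup>2 / 2))"
  shows "(dom_attr {A. herm A} MX MY \<longleftrightarrow> dom_attr UNIV (distr MX borel diag_vec) (distr MY borel diag_vec))
       \<and> (dom_attr UNIV (distr MX borel diag_vec) (distr MY borel diag_vec) \<longleftrightarrow> dom_attr UNIV (eig_distr MX eig) G)"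
proof -
  interpret eig_setup MX eig by unfold_locales (fact X_law X_inv eig_meas eig_ok)+
  have PY: "prob_space MY" and sY [measurable_cong]: "sets MY = sets borel" and hY: "AE Y in MY. herm Y"
    using Y_law by (auto simp: herm_law_def)
  interpret Y: prob_space MY by (rule PY)
  \<comment> \<open>The lower bound on \<kappa> multiplied by N^2: the limiting variance of the
    trace is positive.\<close>
  have pos: "\<sigma>\<^sup>2 * CARD('n) + \<kappa> * (real CARD('n))\<^sup>2 > 0"
  proof -
    have c: "real CARD('n) > 0" by simp
    have "\<sigma>\<^sup>2 + \<kappa> * CARD('n) > 0" using kappa c by (simp add: field_simps)
    then have "CARD('n) * (\<sigma>\<^sup>2 + \<kappa> * CARD('n)) > 0" using c by simp
    then show ?thesis by (simp add: algebra_simps power2_eq_square)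
  qed
  \<comment> \<open>The characteristic function of Y is given at Hermitian arguments only; it
    extends to all S through the Hermitian part, since Y is almost surely Hermitian.\<close>
  have Ychar: "vchar MY S = of_real (exp (- ((\<sigma>\<^sup>2 * (norm (herm_part S))\<^sup>2 + \<kappa> * (Re (mtrace S))\<^sup>2) / 2)))" for S
  proof -
    have h: "herm (herm_part S)" by (rule herm_herm_part)
    have "vchar MY S = (CLINT Y|MY. iexp (Re (mtrace (Y ** herm_part S))))"
      unfolding vchar_def
    proof (rule integral_cong_AE)
      show "AE Y in MY. iexp (S \<bullet> Y) = iexp (Re (mtrace (Y ** herm_part S)))"
        using hY by eventually_elim (simp only: inner_herm_part herm_inner_eq_mtrace[OF h, symmetric])
      show "(\<lambda>Y. iexp (Re (mtrace (Y ** herm_part S)))) \<in> borel_measurable MY"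
        unfolding herm_inner_eq_mtrace[OF h, symmetric] by measurable
    qed measurable
    also have "\<dots> = complex_of_real (exp (- (\<sigma>\<^sup>2 / 2) * Re (mtrace (herm_part S ** herm_part S)) - (\<kappa> / 2) * (Re (mtrace (herm_part S)))\<^sup>2))"
      by (rule Y_char[OF h])
    also have "Re (mtrace (herm_part S ** herm_part S)) = (norm (herm_part S))\<^sup>2"
      unfolding herm_inner_eq_mtrace[OF h, symmetric] by (rule power2_norm_eq_inner[symmetric])
    finally show ?thesis unfolding Re_mtrace_herm_part by (simp add: algebra_simps add_divide_distrib)
  qed
  have Dchar: "vchar (distr MY borel diag_vec) s = of_real (exp (- ((\<sigma>\<^sup>2 * (s \<bullet> s) + \<kappa> * (s \<bullet> ones)\<^sup>2) / 2)))" for s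
  proof -
    have "vchar (distr MY borel diag_vec) s = vchar MY (diagm s)"
      by (subst vchar_distr) (simp_all add: vchar_def diagm_inner)
    then show ?thesis
      unfolding Ychar herm_part_herm[OF herm_diagm] norm_diagm mtrace_diagm by (simp add: power2_norm_eq_inner)
  qed
  have PD: "prob_space (distr MY borel diag_vec)" by (rule Y.prob_space_distr) simp
  have Gchar: "vchar G s = of_real (exp (- (((real CARD('n) + 1) * \<sigma>\<^sup>2 * (s \<bullet> s) + (\<kappa> - \<sigma>\<^sup>2) * (s \<bullet> ones)\<^sup>2) / 2)))" for s
    unfolding vchar_def G_char power2_norm_eq_inner by (simp add: algebra_simps add_divide_distrib diff_divide_distrib)
  have m: "dom_attr {A. herm A} MX MY \<longleftrightarrow> (\<exists>B. (\<forall>m. B m > 0) \<and> gauss_cond B (\<sigma>\<^sup>2) \<kappa>)"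
    unfolding dom_attr_def using gauss_cond_iff_matrix[OF _ PY sY Ychar pos] by (simp only: mem_Collect_eq) blast
  have d: "dom_attr UNIV (distr MX borel diag_vec) (distr MY borel diag_vec) \<longleftrightarrow> (\<exists>B. (\<forall>m. B m > 0) \<and> gauss_cond B (\<sigma>\<^sup>2) \<kappa>)"
    unfolding dom_attr_def using gauss_cond_iff_diag[OF _ PD sets_distr Dchar pos] by blast
  have e: "dom_attr UNIV (eig_distr MX eig) G \<longleftrightarrow> (\<exists>B. (\<forall>m. B m > 0) \<and> gauss_cond B (\<sigma>\<^sup>2) \<kappa>)"
    unfolding dom_attr_def using gauss_cond_iff_eig[OF _ G_prob G_sets Gchar pos] by blast
  show ?thesis unfolding m d e by blast
qed

end
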